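(* Let $\pi\colon (X,G)\to (Y,G)$ be a factor map between topological dynamical systems, and let $\mu\in M^e(X,G)$ satisfy $h_\mu(G\mid\pi)>0$. Then for every integer $n\ge 2$, $\pi$ is relative mean $\mu$-$n$-sensitive with respect to $\mathcal{F}$.
   Context: Standing setting: $G$ is a countable discrete infinite amenable group and $\mathcal{F}=\{F_m\}_{m=1}^\infty$ is a fixed (two-sided) F{\o}lner sequence of $G$, i.e. each $F_m\subset G$ is finite and non-empty and for every $g\in G$, $\lim_{m\to\infty}|gF_m\Delta F_m|/|F_m|=0$ and $\lim_{m\to\infty}|F_mg\Delta F_m|/|F_m|=0$. A topological dynamical system (TDS) $(X,G)$ is a compact metric space $X$ (with metric $d$) with a continuous action $G\times X\to X$, $(g,x)\mapsto gx$. A factor map $\pi\colon (X,G)\to(Y,G)$ is a continuous surjection $\pi\colon X\to Y$ with $\pi(gx)=g\pi(x)$ for all $g\in G$, $x\in X$. $\mathcal{B}_X$ is the Borel $\sigma$-algebra of $X$; $M(X,G)$ is the set of $G$-invariant Borel probability measures on $X$, and $M^e(X,G)$ the set of ergodic ones. Relative measure entropy: for a finite Borel partition $\alpha$ of $X$ and $\mu\in M(X,G)$, $H_\mu(\alpha\mid\pi)=\sum_{A\in\alpha}\int_X -\mathbb{E}_\mu(1_A\mid\pi^{-1}\mathcal{B}_Y)\log\mathbb{E}_\mu(1_A\mid\pi^{-1}\mathcal{B}_Y)\,d\mu$; $h_\mu(G,\alpha\mid\pi)=\lim_{m\to\infty}\frac{1}{|F_m|}H_\mu\big(\bigvee_{g\in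 F_m}g^{-1}\alpha\mid\pi\big)$ (the limit exists and does not depend on the F{\o}lner sequence); $h_\mu(G\mid\pi)=\sup_\alpha h_\mu(G,\alpha\mid\pi)$ over all finite Borel partitions $\alpha$ of $X$. Relative mean $\mu$-$n$-sensitivity: for $\mu\in M(X,G)$ and $n\ge2$, $\pi$ is relative mean $\mu$-$n$-sensitive with respect to $\mathcal{F}$ if there is $\epsilon>0$ such that for any $A\in\mathcal{B}_X$ with $\mu(A)>0$ there are $n$ distinct points $x_1,\dots,x_n\in A$ with $\pi(x_1)=\cdots=\pi(x_n)$ and $\limsup_{m\to\infty}\frac{1}{|F_m|}\sum_{g\in F_m}\min_{1\le i\ne j\le n}d(gx_i,gx_j)>\epsilon$. *)

theory Defs
  imports
    "HOL-Probability.Probability"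
    "HOL-Algebra.Group_Action"
    "HOL-Library.Disjoint_Sets"
begin

definition folner_sequence :: "('g, 'r) monoid_scheme \<Rightarrow> (nat \<Rightarrow> 'g set) \<Rightarrow> bool" where
  "folner_sequence G F \<longleftrightarrow>
     (\<forall>m. finite (F m) \<and> F m \<noteq> {} \<and> F m \<subseteq> carrier G) \<and>
     (\<forall>g\<in>carrier G.
        (\<lambda>m. real (card (sym_diff (g <#\<^bsub>G\<^esub> F m) (F m))) / real (card (F m))) \<longlonglongrightarrow> 0 \<and>
        (\<lambda>m. real (card (sym_diff (F m #>\<^bsub>G\<^esub> g) (F m))) / real (card (F m))) \<longlonglongrightarrow> 0)"

text \<open>For a countable group, amenability is the existence of a two-sided Folner sequence.\<close>

definition countable_amenable_group :: "('g, 'r) monoid_scheme \<Rightarrow> bool" where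
  "countable_amenable_group G \<longleftrightarrow>
     group G \<and> countable (carrier G) \<and> (\<exists>F. folner_sequence G F)"

text \<open>The phase space is the whole type, with the metric of the type class.\<close>

definition tds :: "('g, 'r) monoid_scheme \<Rightarrow> ('g \<Rightarrow> 'x \<Rightarrow> 'x::metric_space) \<Rightarrow> bool" where
  "tds G \<phi> \<longleftrightarrow>
     compact (UNIV :: 'x set) \<and>
     group_action G UNIV \<phi> \<and>
     continuous_map (prod_topology (discrete_topology (carrier G)) euclidean) euclidean
       (\<lambda>(g, x). \<phi> g x)"

definition factor_map ::
  "('g, 'r) monoid_scheme \<Rightarrow> ('g \<Rightarrow> 'x \<Rightarrow> 'x::metric_space) \<Rightarrow> ('g \<Rightarrow> 'y \<Rightarrow> 'y::metric_space)
     \<Rightarrow> ('x \<Rightarrow> 'y) \<Rightarrow> bool" where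
  "factor_map G \<phi> \<psi> \<pi> \<longleftrightarrow>
     continuous_on UNIV \<pi> \<and> surj \<pi> \<and> (\<forall>g\<in>carrier G. \<forall>x. \<pi> (\<phi> g x) = \<psi> g (\<pi> x))"

definition invariant_measures ::
  "('g, 'r) monoid_scheme \<Rightarrow> ('g \<Rightarrow> 'x \<Rightarrow> 'x::metric_space) \<Rightarrow> 'x measure set" where
  "invariant_measures G \<phi> =
     {\<mu>. prob_space \<mu> \<and> sets \<mu> = sets borel \<and>
         (\<forall>g\<in>carrier G. \<forall>A\<in>sets borel. measure \<mu> (\<phi> g -` A) = measure \<mu> A)}"

definition ergodic_measures ::
  "('g, 'r) monoid_scheme \<Rightarrow> ('g \<Rightarrow> 'x \<Rightarrow> 'x::metric_space) \<Rightarrow> 'x measure set" where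
  "ergodic_measures G \<phi> =
     {\<mu> \<in> invariant_measures G \<phi>.
        \<forall>A\<in>sets borel. (\<forall>g\<in>carrier G. \<phi> g -` A = A) \<longrightarrow> measure \<mu> A = 0 \<or> measure \<mu> A = 1}"

text \<open>Since \<open>ln 0 = 0\<close> in HOL, null conditional probabilities contribute \<open>0\<close> as usual; the
  exclusion of empty cells by \<open>partition_on\<close> and \<open>common_refinement\<close> below is harmless for the
  same reason.\<close>

definition rel_entropy_partition ::
  "'x::metric_space measure \<Rightarrow> 'x set set \<Rightarrow> ('x \<Rightarrow> 'y::metric_space) \<Rightarrow> real" where
  "rel_entropy_partition \<mu> \<alpha> \<pi> =
     (\<Sum>A\<in>\<alpha>. \<integral>x.
        - real_cond_exp \<mu> (vimage_algebra UNIV \<pi> borel) (indicator A) x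
          * ln (real_cond_exp \<mu> (vimage_algebra UNIV \<pi> borel) (indicator A) x) \<partial>\<mu>)"

text \<open>The limit exists for every invariant \<open>\<mu>\<close> and does not depend on the Folner sequence \<open>F\<close>.\<close>

definition rel_entropy_wrt ::
  "('g \<Rightarrow> 'x \<Rightarrow> 'x::metric_space) \<Rightarrow> (nat \<Rightarrow> 'g set) \<Rightarrow> 'x measure \<Rightarrow> 'x set set
     \<Rightarrow> ('x \<Rightarrow> 'y::metric_space) \<Rightarrow> real" where
  "rel_entropy_wrt \<phi> F \<mu> \<alpha> \<pi> =
     lim (\<lambda>m. rel_entropy_partition \<mu>
                (common_refinement ((\<lambda>g. (\<lambda>A. \<phi> g -` A) ` \<alpha>) ` F m)) \<pi>
              / real (card (F m)))"

definition rel_entropy ::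
  "('g \<Rightarrow> 'x \<Rightarrow> 'x::metric_space) \<Rightarrow> (nat \<Rightarrow> 'g set) \<Rightarrow> 'x measure
     \<Rightarrow> ('x \<Rightarrow> 'y::metric_space) \<Rightarrow> ereal" where
  "rel_entropy \<phi> F \<mu> \<pi> =
     (SUP \<alpha>\<in>{\<alpha>. finite \<alpha> \<and> \<alpha> \<subseteq> sets borel \<and> partition_on UNIV \<alpha>}.
        ereal (rel_entropy_wrt \<phi> F \<mu> \<alpha> \<pi>))"

definition rel_mean_sensitive ::
  "('g \<Rightarrow> 'x \<Rightarrow> 'x::metric_space) \<Rightarrow> (nat \<Rightarrow> 'g set) \<Rightarrow> 'x measure
     \<Rightarrow> ('x \<Rightarrow> 'y::metric_space) \<Rightarrow> nat \<Rightarrow> bool" where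
  "rel_mean_sensitive \<phi> F \<mu> \<pi> n \<longleftrightarrow>
     (\<exists>\<epsilon>>0. \<forall>A\<in>sets borel. measure \<mu> A > 0 \<longrightarrow>
        (\<exists>x :: nat \<Rightarrow> 'x.
           inj_on x {1..n} \<and> x ` {1..n} \<subseteq> A \<and>
           (\<forall>i\<in>{1..n}. \<forall>j\<in>{1..n}. \<pi> (x i) = \<pi> (x j)) \<and>
           limsup (\<lambda>m. ereal
             ((\<Sum>g\<in>F m. Min {dist (\<phi> g (x i)) (\<phi> g (x j)) | i j.
                              i \<in> {1..n} \<and> j \<in> {1..n} \<and> i \<noteq> j})
              / real (card (F m)))) > ereal \<epsilon>))"

end

theory Submission
  imports Defs "HOL-Library.Ramsey"
begin

text \<open>
  The proof compares the entropy of names with the distinctness of the names of independent points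
  in a common fibre; neither a Pinsker factor nor a disintegration over the factor is used.

  Positive relative entropy gives a finite partition \<open>\<alpha>\<close> and a constant \<open>c > 0\<close> such that, for
  infinitely many \<open>m\<close>, the names over the Folner set \<open>F m\<close> have relative entropy greater than
  \<open>c * card (F m)\<close>. Fix a finite window \<open>K\<close> in the group with \<open>log n\<close> much smaller than
  \<open>c * card K\<close>. By Shearer's inequality (\<open>block_entropy\<close>), on average over the \<open>g\<close> in
  \<open>F m\<close>, the names over the translate of \<open>K\<close> to \<open>g\<close> have conditional entropy well above \<open>log n\<close>. A
  distribution on boundedly many names with such an entropy has at least \<open>n\<close> atoms of definite mass,
  so that \<open>n\<close> independent points of a cell have pairwise distinct names with definite probability
  (\<open>ent_le_distinct_names\<close>). After discarding a set of small measure, distinct names over \<open>K\<close> force a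
  distance of at least some \<open>\<epsilon>\<close> (\<open>separating_set\<close>). Hence a random \<open>n\<close>-tuple from a cell is, with
  probability at least \<open>\<theta>\<close>, \<open>\<epsilon>\<close>-separated for a proportion \<open>\<theta>\<close> of the \<open>g\<close> in \<open>F m\<close>
  (\<open>distinct_tuples_frequent\<close>).

  A set \<open>A\<close> of positive measure may be very small, but \<open>\<epsilon>\<close> and \<open>\<theta>\<close> must not depend on it. By
  ergodicity finitely many, say \<open>r\<close>, translates of \<open>A\<close> cover almost everything. Adding to the
  conditioning the index of the first translate that contains the point costs an entropy of at most
  \<open>log (r + 1)\<close>, which is negligible against \<open>card (F m)\<close>. The tuples may thus be drawn inside
  translates of \<open>A\<close>, and moving a tuple from a translate of \<open>A\<close> into \<open>A\<close> does not change the upper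
  mean of its separations, because the Folner sequence is right invariant in the limit.

  The factor is only seen through finite partitions of its space, and the tuples obtained lie in a
  small cell instead of a fibre. This is repaired by compactness: a Ramsey argument
  (\<open>charged_intersections\<close>) selects infinitely many \<open>m\<close> such that, for any finitely many of them,
  arbitrarily fine cells contain tuples that are well separated over all these \<open>F m\<close>
  simultaneously. A limit of such tuples lies in one fibre (\<open>fibre_tuple_in_translate\<close>).
\<close>

section \<open>Shannon entropy of finite labellings\<close>

text \<open>The entropy function \<open>- t log t\<close>; the value at \<open>0\<close> is \<open>0\<close> because \<open>ln 0 = 0\<close>.\<close>

definition eta :: "real \<Rightarrow> real" where
  "eta t = - t * ln t"

lemma eta_0 [simp]: "eta 0 = 0"
  by (simp add: eta_def)

lemma eta_nonneg:
  assumes "0 \<le> t" "t \<le> 1"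
  shows "0 \<le> eta t"
proof (cases "t = 0")
  case False
  with assms have "ln t \<le> 0" by simp
  with assms show ?thesis by (simp add: eta_def mult_nonneg_nonpos)
qed simp

text \<open>Concavity, in the form used throughout: the graph lies below its tangent at \<open>s\<close>.\<close>

lemma eta_le_tangent:
  assumes "0 \<le> u" "0 < s"
  shows "eta u \<le> - u * ln s + s - u"
proof (cases "u = 0")
  case False
  with assms have u: "u > 0" by simp
  have "ln (s / u) \<le> s / u - 1"
    using u assms by (intro ln_le_minus_one) auto
  then have "u * (ln s - ln u) \<le> u * (s / u - 1)"
    using u assms by (intro mult_left_mono) (auto simp: ln_div)
  then show ?thesis using u by (simp add: eta_def algebra_simps)
qed (use assms in \<open>simp add: eta_def\<close>)

lemma eta_sum_le:
  assumes "finite I" "\<And>i. i \<in> I \<Longrightarrow> 0 \<le> u i"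
  shows "eta (sum u I) \<le> (\<Sum>i\<in>I. eta (u i))"
proof -
  have "eta (sum u I) = (\<Sum>i\<in>I. - u i * ln (sum u I))"
    by (simp add: eta_def sum_negf sum_distrib_right)
  also have "\<dots> \<le> (\<Sum>i\<in>I. eta (u i))"
  proof (intro sum_mono)
    fix i assume i: "i \<in> I"
    show "- u i * ln (sum u I) \<le> eta (u i)"
    proof (cases "u i = 0")
      case False
      with assms i have "u i > 0" by force
      moreover have "u i \<le> sum u I" using assms i by (intro member_le_sum) auto
      ultimately show ?thesis by (simp add: eta_def)
    qed simp
  qed
  finally show ?thesis .
qed

text \<open>Homogeneous form of the bound \<open>log N\<close> for the entropy of a distribution with at most \<open>N\<close>
  atoms: the masses \<open>u i\<close> need not add up to \<open>1\<close>.\<close>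

lemma sum_eta_le:
  assumes "finite I" "\<And>i. i \<in> I \<Longrightarrow> 0 \<le> u i" "card I \<le> N" "1 \<le> N"
  shows "(\<Sum>i\<in>I. eta (u i)) \<le> eta (sum u I) + sum u I * ln (real N)"
proof (cases "sum u I = 0")
  case True
  then have "\<And>i. i \<in> I \<Longrightarrow> u i = 0" using assms by (simp add: sum_nonneg_eq_0_iff)
  with True show ?thesis by simp
next
  case False
  then have w: "sum u I > 0" using assms by (simp add: sum_nonneg order_less_le)
  let ?w = "sum u I"
  have "(\<Sum>i\<in>I. eta (u i)) \<le> (\<Sum>i\<in>I. - u i * ln (?w / N) + ?w / N - u i)"
    using w assms by (intro sum_mono eta_le_tangent) auto
  also have "\<dots> = - ?w * ln (?w / N) + card I * (?w / N) - ?w"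
    by (simp add: sum.distrib sum_subtractf sum_negf sum_distrib_right)
  also have "\<dots> \<le> - ?w * ln (?w / N)"
  proof -
    have "card I * (?w / N) \<le> N * (?w / N)"
      using assms w by (intro mult_right_mono) auto
    then show ?thesis using assms by simp
  qed
  also have "\<dots> = eta ?w + ?w * ln N"
    using w assms by (simp add: eta_def ln_div algebra_simps)
  finally show ?thesis .
qed

text \<open>Shannon entropy of the finite partition into the fibres of a labelling \<open>f\<close>. Partitions are
  encoded by simple functions throughout, so that the join of two partitions is the pairing of
  their labellings, and the conditional entropy of \<open>f\<close> given \<open>z\<close> is
  \<open>ent M (\<lambda>x. (f x, z x)) - ent M z\<close>.\<close>

definition ent :: "'a measure \<Rightarrow> ('a \<Rightarrow> 'b) \<Rightarrow> real" where
  "ent M f = (\<Sum>b\<in>f ` space M. eta (measure M (f -` {b} \<inter> space M)))"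

lemma simple_function_cong_fibres:
  assumes f: "simple_function M f" and r: "\<And>x y. x \<in> space M \<Longrightarrow> y \<in> space M \<Longrightarrow> f x = f y \<Longrightarrow> g x = g y"
  shows "simple_function M g"
proof -
  have 1: "g x = (g \<circ> (\<lambda>b. SOME y. y \<in> space M \<and> f y = b) \<circ> f) x" if "x \<in> space M" for x
  proof -
    have "\<exists>y. y \<in> space M \<and> f y = f x" using that by auto
    then have "(SOME y. y \<in> space M \<and> f y = f x) \<in> space M \<and> f (SOME y. y \<in> space M \<and> f y = f x) = f x"
      by (rule someI_ex)
    then show ?thesis using r that by (metis comp_apply)
  qed
  have "simple_function M (g \<circ> (\<lambda>b. SOME y. y \<in> space M \<and> f y = b) \<circ> f)"
    using f by (rule simple_function_compose)
  then show ?thesis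
    using simple_function_cong[of M g] 1 by blast
qed

context prob_space
begin

lemma ent_superset:
  assumes "finite B" "f ` space M \<subseteq> B"
  shows "ent M f = (\<Sum>b\<in>B. eta (prob (f -` {b} \<inter> space M)))"
  unfolding ent_def
proof (intro sum.mono_neutral_left ballI)
  fix b assume "b \<in> B - f ` space M"
  then have "f -` {b} \<inter> space M = {}" by auto
  then show "eta (prob (f -` {b} \<inter> space M)) = 0" by (simp only: measure_empty eta_0)
qed (use assms in auto)

lemma prob_fibre_sum:
  assumes f: "simple_function M f" and A: "A \<in> events"
  shows "(\<Sum>b\<in>f ` space M. prob (f -` {b} \<inter> A)) = prob A"
proof -
  have fin: "finite (f ` space M)" using f by (simp add: simple_function_def)
  have "prob (\<Union>b\<in>f ` space M. f -` {b} \<inter> A) = (\<Sum>b\<in>f ` space M. prob (f -` {b} \<inter> A))"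
  proof (intro finite_measure_finite_Union fin)
    show "(\<lambda>b. f -` {b} \<inter> A) ` f ` space M \<subseteq> events"
    proof safe
      fix x assume "x \<in> space M"
      have "(f -` {f x} \<inter> space M) \<inter> A \<in> events"
        using simple_functionD(2)[OF f, of "{f x}"] A by blast
      moreover have "(f -` {f x} \<inter> space M) \<inter> A = f -` {f x} \<inter> A"
        using sets.sets_into_space[OF A] by auto
      ultimately show "f -` {f x} \<inter> A \<in> events" by simp
    qed
    show "disjoint_family_on (\<lambda>b. f -` {b} \<inter> A) (f ` space M)"
      by (auto simp: disjoint_family_on_def)
  qed
  moreover have "(\<Union>b\<in>f ` space M. f -` {b} \<inter> A) = A"
    using sets.sets_into_space[OF A] by auto
  ultimately show ?thesis by simp
qed

lemma vimage_event:
  assumes "simple_function M f"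
  shows "f -` {b} \<inter> space M \<in> events"
  using simple_functionD(2)[OF assms] by simp

text \<open>The joint entropy of two labellings, written cell by cell.\<close>

lemma ent_pair:
  assumes f: "simple_function M f" and z: "simple_function M z"
  shows "ent M (\<lambda>x. (f x, z x)) =
    (\<Sum>c\<in>z ` space M. \<Sum>b\<in>f ` space M. eta (prob (f -` {b} \<inter> (z -` {c} \<inter> space M))))"
proof -
  have "ent M (\<lambda>x. (f x, z x)) = (\<Sum>p\<in>f ` space M \<times> z ` space M.
      eta (prob ((\<lambda>x. (f x, z x)) -` {p} \<inter> space M)))"
    using f z by (intro ent_superset) (auto simp: simple_function_def)
  also have "\<dots> = (\<Sum>b\<in>f ` space M. \<Sum>c\<in>z ` space M.
      eta (prob ((\<lambda>x. (f x, z x)) -` {(b, c)} \<inter> space M)))"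
    by (simp add: sum.cartesian_product)
  also have "\<dots> = (\<Sum>b\<in>f ` space M. \<Sum>c\<in>z ` space M.
      eta (prob (f -` {b} \<inter> (z -` {c} \<inter> space M))))"
    by (intro sum.cong refl arg_cong[of _ _ eta] arg_cong[of _ _ prob]) auto
  also have "\<dots> = (\<Sum>c\<in>z ` space M. \<Sum>b\<in>f ` space M.
      eta (prob (f -` {b} \<inter> (z -` {c} \<inter> space M))))"
    by (rule sum.swap)
  finally show ?thesis .
qed

lemma ent_mono:
  assumes f: "simple_function M f"
    and r: "\<And>x y. x \<in> space M \<Longrightarrow> y \<in> space M \<Longrightarrow> f x = f y \<Longrightarrow> g x = g y"
  shows "ent M g \<le> ent M f"
proof -
  have g: "simple_function M g" by (rule simple_function_cong_fibres[OF f r])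
  have fin: "finite (f ` space M)" "finite (g ` space M)" using f g by (auto simp: simple_function_def)
  obtain j where j: "\<And>x. x \<in> space M \<Longrightarrow> g x = j (f x)"
  proof -
    have "\<forall>x\<in>space M. g x = g (SOME y. y \<in> space M \<and> f y = f x)"
      by (metis (mono_tags, lifting) r someI_ex)
    then show ?thesis using that[of "\<lambda>b. g (SOME y. y \<in> space M \<and> f y = b)"] by blast
  qed
  have "ent M g \<le> (\<Sum>c\<in>g ` space M. \<Sum>b\<in>{b\<in>f ` space M. j b = c}. eta (prob (f -` {b} \<inter> space M)))"
    unfolding ent_def
  proof (intro sum_mono)
    fix c assume "c \<in> g ` space M"
    have "prob (g -` {c} \<inter> space M) = (\<Sum>b\<in>f ` space M. prob (f -` {b} \<inter> (g -` {c} \<inter> space M)))"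
      using prob_fibre_sum[OF f vimage_event[OF g]] by simp
    also have "\<dots> = (\<Sum>b\<in>{b\<in>f ` space M. j b = c}. prob (f -` {b} \<inter> space M))"
    proof (intro sum.mono_neutral_cong_right fin ballI)
      fix b assume "b \<in> f ` space M - {b \<in> f ` space M. j b = c}"
      then have "f -` {b} \<inter> (g -` {c} \<inter> space M) = {}" using j by auto
      then show "prob (f -` {b} \<inter> (g -` {c} \<inter> space M)) = 0" by (simp only: measure_empty)
    next
      fix b assume "b \<in> {b \<in> f ` space M. j b = c}"
      then have "f -` {b} \<inter> (g -` {c} \<inter> space M) = f -` {b} \<inter> space M" using j by auto
      then show "prob (f -` {b} \<inter> (g -` {c} \<inter> space M)) = prob (f -` {b} \<inter> space M)" by simp
    qed auto
    finally show "eta (prob (g -` {c} \<inter> space M)) \<le>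
        (\<Sum>b\<in>{b\<in>f ` space M. j b = c}. eta (prob (f -` {b} \<inter> space M)))"
      using eta_sum_le[of "{b\<in>f ` space M. j b = c}" "\<lambda>b. prob (f -` {b} \<inter> space M)"] fin by simp
  qed
  also have "\<dots> = ent M f"
    unfolding ent_def using fin j by (intro sum.group) auto
  finally show ?thesis .
qed

lemma ent_cong:
  assumes "simple_function M f"
    and "\<And>x y. x \<in> space M \<Longrightarrow> y \<in> space M \<Longrightarrow> f x = f y \<longleftrightarrow> g x = g y"
  shows "ent M f = ent M g"
proof (rule antisym)
  have "simple_function M g" using simple_function_cong_fibres[OF assms(1)] assms(2) by blast
  then show "ent M f \<le> ent M g" using assms(2) by (intro ent_mono) auto
  show "ent M g \<le> ent M f" using assms by (intro ent_mono) auto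
qed

lemma ent_pair_le:
  assumes f: "simple_function M f" and z: "simple_function M z"
    and N: "card (f ` space M) \<le> N"
  shows "ent M (\<lambda>x. (f x, z x)) - ent M z \<le> ln (real N)"
proof -
  have fin: "finite (f ` space M)" "finite (z ` space M)" using f z by (auto simp: simple_function_def)
  have N1: "1 \<le> N" using N fin not_empty by (metis One_nat_def Suc_leI card_gt_0_iff image_is_empty le_trans)
  have "ent M (\<lambda>x. (f x, z x)) \<le> (\<Sum>c\<in>z ` space M. eta (prob (z -` {c} \<inter> space M)) + prob (z -` {c} \<inter> space M) * ln N)"
    unfolding ent_pair[OF f z]
  proof (intro sum_mono)
    fix c assume "c \<in> z ` space M"
    show "(\<Sum>b\<in>f ` space M. eta (prob (f -` {b} \<inter> (z -` {c} \<inter> space M))))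
        \<le> eta (prob (z -` {c} \<inter> space M)) + prob (z -` {c} \<inter> space M) * ln N"
      using sum_eta_le[OF fin(1) _ N N1, of "\<lambda>b. prob (f -` {b} \<inter> (z -` {c} \<inter> space M))"]
      by (simp add: prob_fibre_sum[OF f vimage_event[OF z]])
  qed
  also have "\<dots> = ent M z + (\<Sum>c\<in>z ` space M. prob (z -` {c} \<inter> space M)) * ln N"
    by (simp add: sum.distrib ent_def sum_distrib_right)
  also have "(\<Sum>c\<in>z ` space M. prob (z -` {c} \<inter> space M)) = 1"
    using prob_fibre_sum[OF z sets.top] by (simp add: prob_space)
  finally show ?thesis by simp
qed

text \<open>Strong subadditivity: conditioning on \<open>g\<close> in addition to \<open>h\<close> cannot increase the entropy
  of \<open>f\<close>.\<close>

lemma ent_submodular: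
  assumes f: "simple_function M f" and g: "simple_function M g" and h: "simple_function M h"
  shows "ent M (\<lambda>x. (f x, g x, h x)) + ent M h \<le> ent M (\<lambda>x. (f x, h x)) + ent M (\<lambda>x. (g x, h x))"
proof -
  define A B C where "A = f ` space M" and "B = g ` space M" and "C = h ` space M"
  have fin: "finite A" "finite B" "finite C"
    using f g h by (auto simp: simple_function_def A_def B_def C_def)
  define p where "p a b c = prob (f -` {a} \<inter> (g -` {b} \<inter> (h -` {c} \<inter> space M)))" for a b c
  define pa where "pa a c = prob (f -` {a} \<inter> (h -` {c} \<inter> space M))" for a c
  define pb where "pb b c = prob (g -` {b} \<inter> (h -` {c} \<inter> space M))" for b c
  define pc where "pc c = prob (h -` {c} \<inter> space M)" for c
  have gh: "simple_function M (\<lambda>x. (g x, h x))" and fh: "simple_function M (\<lambda>x. (f x, h x))"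
    using f g h by (auto intro: simple_function_Pair)
  have ev_g: "g -` {b} \<inter> (h -` {c} \<inter> space M) \<in> events" for b c
    using sets.Int[OF vimage_event[OF g, of b] vimage_event[OF h, of c]] by (simp add: Int_ac)
  have ev_f: "f -` {a} \<inter> (h -` {c} \<inter> space M) \<in> events" for a c
    using sets.Int[OF vimage_event[OF f, of a] vimage_event[OF h, of c]] by (simp add: Int_ac)
  have suma: "(\<Sum>a\<in>A. p a b c) = pb b c" for b c
    unfolding A_def p_def pb_def by (rule prob_fibre_sum[OF f ev_g])
  have sumb: "(\<Sum>b\<in>B. p a b c) = pa a c" for a c
    using prob_fibre_sum[OF g ev_f[of a c]] by (simp add: B_def p_def pa_def Int_left_commute)
  have sumac: "(\<Sum>a\<in>A. pa a c) = pc c" for c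
    unfolding A_def pa_def pc_def by (rule prob_fibre_sum[OF f vimage_event[OF h]])
  have sumbc: "(\<Sum>b\<in>B. pb b c) = pc c" for c
    unfolding B_def pb_def pc_def by (rule prob_fibre_sum[OF g vimage_event[OF h]])
  have nn: "p a b c \<ge> 0" "pa a c \<ge> 0" "pb b c \<ge> 0" "pc c \<ge> 0" for a b c
    by (auto simp: p_def pa_def pb_def pc_def)
  have efg: "ent M (\<lambda>x. (f x, g x, h x)) = (\<Sum>c\<in>C. \<Sum>b\<in>B. \<Sum>a\<in>A. eta (p a b c))"
  proof -
    have "ent M (\<lambda>x. (f x, g x, h x)) = (\<Sum>q\<in>A \<times> B \<times> C.
      eta (prob ((\<lambda>x. (f x, g x, h x)) -` {q} \<inter> space M)))"
      using fin by (intro ent_superset) (auto simp: A_def B_def C_def)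
    also have "\<dots> = (\<Sum>a\<in>A. \<Sum>b\<in>B. \<Sum>c\<in>C. eta (prob ((\<lambda>x. (f x, g x, h x)) -` {(a, b, c)} \<inter> space M)))"
      by (simp add: sum.cartesian_product)
    also have "\<dots> = (\<Sum>a\<in>A. \<Sum>b\<in>B. \<Sum>c\<in>C. eta (p a b c))"
      unfolding p_def
      by (intro sum.cong refl arg_cong[of _ _ eta] arg_cong[of _ _ prob]) auto
    also have "\<dots> = (\<Sum>a\<in>A. \<Sum>c\<in>C. \<Sum>b\<in>B. eta (p a b c))"
      by (intro sum.cong refl sum.swap)
    also have "\<dots> = (\<Sum>c\<in>C. \<Sum>a\<in>A. \<Sum>b\<in>B. eta (p a b c))"
      by (rule sum.swap)
    also have "\<dots> = (\<Sum>c\<in>C. \<Sum>b\<in>B. \<Sum>a\<in>A. eta (p a b c))"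
      by (intro sum.cong refl sum.swap)
    finally show ?thesis .
  qed
  have eh: "ent M h = (\<Sum>c\<in>C. \<Sum>b\<in>B. \<Sum>a\<in>A. - p a b c * ln (pc c))"
  proof -
    have "(\<Sum>b\<in>B. \<Sum>a\<in>A. - p a b c * ln (pc c)) = eta (pc c)" for c
      by (simp add: eta_def sum_negf flip: sum_distrib_right, simp add: suma sumbc)
    then show ?thesis by (simp add: ent_def C_def pc_def)
  qed
  have efh: "ent M (\<lambda>x. (f x, h x)) = (\<Sum>c\<in>C. \<Sum>b\<in>B. \<Sum>a\<in>A. - p a b c * ln (pa a c))"
  proof -
    have "(\<Sum>b\<in>B. \<Sum>a\<in>A. - p a b c * ln (pa a c)) = (\<Sum>a\<in>A. eta (pa a c))" for c
    proof -
      have "(\<Sum>b\<in>B. \<Sum>a\<in>A. - p a b c * ln (pa a c)) = (\<Sum>a\<in>A. \<Sum>b\<in>B. - p a b c * ln (pa a c))"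
        by (rule sum.swap)
      also have "\<dots> = (\<Sum>a\<in>A. eta (pa a c))"
        by (simp add: eta_def sum_negf flip: sum_distrib_right, simp add: sumb)
      finally show ?thesis .
    qed
    then show ?thesis by (simp add: ent_pair[OF f h] pa_def A_def C_def)
  qed
  have egh: "ent M (\<lambda>x. (g x, h x)) = (\<Sum>c\<in>C. \<Sum>b\<in>B. \<Sum>a\<in>A. - p a b c * ln (pb b c))"
  proof -
    have "(\<Sum>a\<in>A. - p a b c * ln (pb b c)) = eta (pb b c)" for b c
      by (simp add: eta_def sum_negf flip: sum_distrib_right, simp add: suma)
    then show ?thesis by (simp add: ent_pair[OF g h] pb_def B_def C_def)
  qed
  have "ent M (\<lambda>x. (f x, g x, h x)) + ent M h - ent M (\<lambda>x. (f x, h x)) - ent M (\<lambda>x. (g x, h x))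
     = (\<Sum>c\<in>C. \<Sum>b\<in>B. \<Sum>a\<in>A. eta (p a b c) - p a b c * ln (pc c) + p a b c * ln (pa a c) + p a b c * ln (pb b c))"
    unfolding efg eh efh egh by (simp add: sum.distrib sum_subtractf sum_negf)
  also have "\<dots> \<le> (\<Sum>c\<in>C. \<Sum>b\<in>B. \<Sum>a\<in>A. pa a c * pb b c / pc c - p a b c)"
  proof (intro sum_mono)
    fix a b c assume *: "a \<in> A" "b \<in> B" "c \<in> C"
    show "eta (p a b c) - p a b c * ln (pc c) + p a b c * ln (pa a c) + p a b c * ln (pb b c)
      \<le> pa a c * pb b c / pc c - p a b c"
    proof (cases "p a b c = 0")
      case True
      then show ?thesis using nn by simp
    next
      case False
      then have p: "p a b c > 0" using nn(1)[of a b c] by linarith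
      have "p a b c \<le> pa a c" using fin * nn unfolding sumb[symmetric] by (intro member_le_sum) auto
      moreover have "p a b c \<le> pb b c" using fin * nn unfolding suma[symmetric] by (intro member_le_sum[where f="\<lambda>a. p a b c"]) auto
      moreover have "pa a c \<le> pc c" using fin * nn unfolding sumac[symmetric] by (intro member_le_sum[where f="\<lambda>a. pa a c"]) auto
      ultimately have pos: "pa a c > 0" "pb b c > 0" "pc c > 0" using p by linarith+
      \<comment> \<open>tangent at the mass that the cell would have if \<open>f\<close> and \<open>g\<close> were independent given \<open>h\<close>\<close>
      have "eta (p a b c) \<le> - p a b c * ln (pa a c * pb b c / pc c) + pa a c * pb b c / pc c - p a b c"
        using p pos by (intro eta_le_tangent) auto
      also have "ln (pa a c * pb b c / pc c) = ln (pa a c) + ln (pb b c) - ln (pc c)"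
        using pos by (simp add: ln_mult ln_div)
      finally show ?thesis by (simp add: algebra_simps)
    qed
  qed
  also have "\<dots> = (\<Sum>c\<in>C. (\<Sum>b\<in>B. (\<Sum>a\<in>A. pa a c) * pb b c / pc c) - pc c)"
    by (simp add: sum_subtractf suma sumbc sum_distrib_right sum_divide_distrib)
  also have "\<dots> = 0"
  proof (intro sum.neutral ballI)
    fix c assume "c \<in> C"
    have "(\<Sum>b\<in>B. (\<Sum>a\<in>A. pa a c) * pb b c / pc c) = pc c * (\<Sum>b\<in>B. pb b c) / pc c"
      by (simp add: sumac sum_distrib_left sum_divide_distrib)
    then show "(\<Sum>b\<in>B. (\<Sum>a\<in>A. pa a c) * pb b c / pc c) - pc c = 0"
      by (simp add: sumbc)
  qed
  finally show ?thesis by simp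
qed

end

section \<open>Shearer's inequality\<close>

text \<open>If every point of \<open>F\<close> lies in exactly \<open>M\<close> of the sets \<open>S i\<close>, then the \<open>M\<close>-fold increment
  of a submodular set function \<open>h\<close> on \<open>F\<close> is at most the sum of its increments on the traces
  \<open>S i \<inter> F\<close>.\<close>

lemma shearer_inequality:
  fixes h :: "'g set \<Rightarrow> real"
  assumes submod: "\<And>A B f. A \<subseteq> B \<Longrightarrow> finite B \<Longrightarrow> B \<subseteq> U \<Longrightarrow> f \<in> U - B \<Longrightarrow>
      h (insert f B) + h A \<le> h (insert f A) + h B"
    and "finite F" "F \<subseteq> U" "finite I"
    and "\<And>f. f \<in> F \<Longrightarrow> card {i\<in>I. f \<in> S i} = M"
  shows "real M * (h F - h {}) \<le> (\<Sum>i\<in>I. h (S i \<inter> F) - h {})"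
  using assms(2,3,5)
proof (induction F)
  case (insert f F)
  let ?J = "{i\<in>I. f \<in> S i}"
  have "(\<Sum>i\<in>I. h (S i \<inter> insert f F) - h {}) - (\<Sum>i\<in>I. h (S i \<inter> F) - h {})
      = (\<Sum>i\<in>I. h (S i \<inter> insert f F) - h (S i \<inter> F))"
    by (simp add: sum_subtractf)
  also have "\<dots> = (\<Sum>i\<in>?J. h (S i \<inter> insert f F) - h (S i \<inter> F))"
    using \<open>finite I\<close> by (intro sum.mono_neutral_right) auto
  also have "\<dots> \<ge> (\<Sum>i\<in>?J. h (insert f F) - h F)"
  proof (intro sum_mono)
    fix i assume "i \<in> ?J"
    then have "S i \<inter> insert f F = insert f (S i \<inter> F)" by auto
    then show "h (insert f F) - h F \<le> h (S i \<inter> insert f F) - h (S i \<inter> F)"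
      using submod[of "S i \<inter> F" F f] insert by auto
  qed
  finally have "real M * (h (insert f F) - h F) \<le>
      (\<Sum>i\<in>I. h (S i \<inter> insert f F) - h {}) - (\<Sum>i\<in>I. h (S i \<inter> F) - h {})"
    using insert.prems by simp
  moreover have "real M * (h F - h {}) \<le> (\<Sum>i\<in>I. h (S i \<inter> F) - h {})"
    using insert by auto
  ultimately show ?case by (simp add: algebra_simps)
qed simp

section \<open>Infinite subfamilies of uniformly charged events\<close>

text \<open>Sequential compactness of a countable power of a compact metric space.\<close>

lemma countable_product_subsequence:
  fixes x :: "nat \<Rightarrow> 'i::countable \<Rightarrow> 'a::metric_space"
  assumes K: "compact K" and x: "\<And>k i. x k i \<in> K"
  obtains l r where "strict_mono r" "\<And>i. l i \<in> K" "\<And>i. (\<lambda>k. x (r k) i) \<longlonglongrightarrow> l i"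
proof -
  have "compactin (product_topology (\<lambda>i::'i. euclidean) UNIV) (PiE UNIV (\<lambda>_. K))"
    using K by (subst compactin_PiE) auto
  then have "compact (PiE (UNIV::'i set) (\<lambda>_. K))"
    by (simp add: euclidean_product_topology)
  moreover have "x k \<in> PiE UNIV (\<lambda>_. K)" for k using x by auto
  ultimately obtain l r where l: "l \<in> PiE UNIV (\<lambda>_. K)" "strict_mono r" "(x \<circ> r) \<longlonglongrightarrow> l"
    by (meson compact_def)
  have "(\<lambda>k. x (r k) i) \<longlonglongrightarrow> l i" for i
    using continuous_on_tendsto_compose[OF continuous_on_product_coordinates[of i] l(3)]
    by (simp add: o_def)
  with l that show thesis by blast
qed

text \<open>Finitely additive set functions of total mass at most \<open>1\<close> on an algebra of sets.\<close>

locale subprobability_content = algebra \<Omega> \<A> for \<Omega> :: "'w set" and \<A> +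
  fixes P :: "'w set \<Rightarrow> real"
  assumes add: "\<And>A B. A \<in> \<A> \<Longrightarrow> B \<in> \<A> \<Longrightarrow> A \<inter> B = {} \<Longrightarrow> P (A \<union> B) = P A + P B"
    and nonneg: "\<And>A. A \<in> \<A> \<Longrightarrow> 0 \<le> P A"
    and total: "P \<Omega> \<le> 1"
begin

lemma mono: "A \<in> \<A> \<Longrightarrow> B \<in> \<A> \<Longrightarrow> A \<subseteq> B \<Longrightarrow> P A \<le> P B"
  using add[of A "B - A"] nonneg[of "B - A"] Diff[of B A] by (simp add: Un_absorb1)

lemma le_1: "A \<in> \<A> \<Longrightarrow> P A \<le> 1"
  using mono[of A \<Omega>] total sets_into_space by force

lemma subadditive: "A \<in> \<A> \<Longrightarrow> B \<in> \<A> \<Longrightarrow> P (A \<union> B) \<le> P A + P B"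
  using add[of A "B - A"] mono[of "B - A" B] Diff[of B A] by simp

lemma empty: "P {} = 0"
  using add[of "{}" "{}"] by simp

lemma subadditive_UN:
  assumes "finite Y" "\<And>m. m \<in> Y \<Longrightarrow> B m \<in> \<A>"
  shows "P (\<Union>m\<in>Y. B m) \<le> (\<Sum>m\<in>Y. P (B m))"
  using assms
proof (induction Y)
  case (insert m Y)
  have "P (B m \<union> (\<Union>m\<in>Y. B m)) \<le> P (B m) + P (\<Union>m\<in>Y. B m)"
    using insert by (intro subadditive) auto
  with insert show ?case by force
qed (simp add: empty)

lemma bonferroni:
  assumes "finite Y" "\<And>m. m \<in> Y \<Longrightarrow> B m \<in> \<A>"
  shows "(\<Sum>m\<in>Y. P (B m)) \<le> P (\<Union>m\<in>Y. B m) + (\<Sum>m\<in>Y. \<Sum>m'\<in>Y - {m}. P (B m \<inter> B m'))"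
  using assms
proof (induction Y)
  case (insert m Y)
  let ?U = "\<Union>m\<in>Y. B m"
  have U: "?U \<in> \<A>" using insert by auto
  have Bm: "B m \<in> \<A>" using insert by auto
  have D: "B m - ?U \<in> \<A>" "B m \<inter> ?U \<in> \<A>" using U Bm by (auto intro: Diff Int)
  have "P (B m) = P (B m - ?U) + P (B m \<inter> ?U)"
  proof -
    have "(B m - ?U) \<union> (B m \<inter> ?U) = B m" "(B m - ?U) \<inter> (B m \<inter> ?U) = {}" by auto
    then show ?thesis using add[OF D] by metis
  qed
  moreover have "P (\<Union>m\<in>insert m Y. B m) = P ?U + P (B m - ?U)"
    using add[of ?U "B m - ?U"] U D(1) by (simp add: Un_commute)
  moreover have "P (B m \<inter> ?U) \<le> (\<Sum>m'\<in>Y. P (B m \<inter> B m'))"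
    using subadditive_UN[of Y "\<lambda>m'. B m \<inter> B m'"] insert.prems insert.hyps by auto
  moreover have "(\<Sum>k\<in>Y. \<Sum>m'\<in>Y - {k}. P (B k \<inter> B m')) \<le> (\<Sum>k\<in>Y. \<Sum>m'\<in>insert m Y - {k}. P (B k \<inter> B m'))"
    using insert by (intro sum_mono sum_mono2 nonneg) auto
  moreover have "(\<Sum>k\<in>insert m Y. \<Sum>m'\<in>insert m Y - {k}. P (B k \<inter> B m'))
     = (\<Sum>m'\<in>Y. P (B m \<inter> B m')) + (\<Sum>k\<in>Y. \<Sum>m'\<in>insert m Y - {k}. P (B k \<inter> B m'))"
    using insert by simp
  ultimately show ?case using insert by simp
qed (simp add: empty)

end

text \<open>Suppose that each of infinitely many events \<open>E m\<close> has mass at least \<open>\<theta>\<close> under each of the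
  contents \<open>P k\<close>. Then infinitely many of the events can be selected so that every finite
  intersection of them has positive mass under infinitely many \<open>P k\<close>. This replaces Fatou's lemma
  for a limit measure of the \<open>P k\<close>, which is never constructed: along a subsequence of \<open>k\<close>, the
  masses of all finite intersections converge, and Ramsey's theorem, applied to the limits, extends
  a finite selection by one event after another.\<close>

lemma charged_intersections:
  fixes P :: "nat \<Rightarrow> 'w set \<Rightarrow> real" and E :: "nat \<Rightarrow> 'w set"
  assumes content: "\<And>k. subprobability_content \<Omega> \<A> (P k)"
    and E: "\<And>m. E m \<in> \<A>" and \<theta>: "0 < \<theta>" and S: "infinite S"
    and large: "\<And>m k. m \<in> S \<Longrightarrow> \<theta> \<le> P k (E m)"
  obtains T where "T \<subseteq> S" "infinite T"
    "\<And>T'. T' \<subseteq> T \<Longrightarrow> finite T' \<Longrightarrow> \<exists>\<^sub>\<infinity>k. 0 < P k (\<Omega> \<inter> (\<Inter>m\<in>T'. E m))"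
proof -
  interpret subprobability_content \<Omega> \<A> "P k" for k by (rule content)
  define I where "I T = \<Omega> \<inter> (\<Inter>m\<in>T. E m)" for T
  have I: "I T \<in> \<A>" if "finite T" for T
    using that
  proof (induction T)
    case (insert m T)
    then have "E m \<inter> I T \<in> \<A>" using Int[OF E[of m]] by blast
    moreover have "I (insert m T) = E m \<inter> I T" by (auto simp: I_def)
    ultimately show ?case by simp
  qed (simp add: I_def)
  have I_insert: "I (insert m T) = E m \<inter> I T" for m T by (auto simp: I_def)
  have I_mono: "I T \<subseteq> I T'" if "T' \<subseteq> T" for T T' using that by (auto simp: I_def)
  obtain p r where r: "strict_mono r" and p: "\<And>l::nat list. (\<lambda>k. P (r k) (I (set l))) \<longlonglongrightarrow> p l"
  proof (rule countable_product_subsequence[of "{0..1::real}" "\<lambda>k l. P k (I (set l))"])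
    show "P k (I (set l)) \<in> {0..1}" for k and l :: "nat list" using nonneg le_1 I by auto
  qed auto
  define q where "q T = p (sorted_list_of_set T)" for T
  have q: "(\<lambda>k. P (r k) (I T)) \<longlonglongrightarrow> q T" if "finite T" for T
    using p[of "sorted_list_of_set T"] that by (simp add: q_def)
  have q_mono: "q T \<le> q T'" if "T' \<subseteq> T" "finite T" for T T'
  proof (rule LIMSEQ_le)
    have T': "finite T'" using that by (rule finite_subset)
    show "(\<lambda>k. P (r k) (I T)) \<longlonglongrightarrow> q T" "(\<lambda>k. P (r k) (I T')) \<longlonglongrightarrow> q T'" using q that T' by auto
    show "\<exists>N. \<forall>n\<ge>N. P (r n) (I T) \<le> P (r n) (I T')" using mono[OF I I I_mono] that T' by blast
  qed
  \<comment> \<open>Among \<open>R > 4 / c\<close> events of mass more than \<open>c / 2\<close> inside \<open>I T\<close>, Bonferroni's inequality yields two whose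
    intersection has mass at least \<open>1 / R\<^sup>2\<close>, so pairs with small intersection cannot be homogeneous.\<close>
  have step: "\<exists>m\<in>M. \<exists>M'\<subseteq>M - {m}. infinite M' \<and> (\<exists>c'>0. \<forall>m'\<in>M'. c' \<le> q (insert m' (insert m T)))"
    if T: "finite T" and M: "infinite M" and c: "0 < c" "\<And>m. m \<in> M \<Longrightarrow> c \<le> q (insert m T)" for T M c
  proof -
    obtain R :: nat where R: "real R > 4 / c" using reals_Archimedean2 by blast
    have R0: "R > 0" using R c by (metis divide_pos_pos less_trans of_nat_0_less_iff zero_less_numeral)
    define c' where "c' = 1 / real R ^ 2"
    have c': "c' > 0" using R0 by (simp add: c'_def)
    define f where "f X = (if c' \<le> q (X \<union> T) then 1 else 0 :: nat)" for X
    have "\<exists>Y t. Y \<subseteq> M \<and> infinite Y \<and> t < 2 \<and> (\<forall>x\<in>Y. \<forall>y\<in>Y. x \<noteq> y \<longrightarrow> f {x, y} = t)"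
      by (intro Ramsey2 M) (auto simp: f_def)
    then obtain Y t where Yt: "Y \<subseteq> M \<and> infinite Y \<and> t < 2 \<and> (\<forall>x\<in>Y. \<forall>y\<in>Y. x \<noteq> y \<longrightarrow> f {x, y} = t)"
      by (elim exE)
    then have Y: "Y \<subseteq> M" "infinite Y" by simp_all
    have hom: "f {x, y} = t" if "x \<in> Y" "y \<in> Y" "x \<noteq> y" for x y
      using Yt that by simp
    have "t = 1"
    proof (rule ccontr)
      assume "t \<noteq> 1"
      then have small: "q ({x, y} \<union> T) < c'" if "x \<in> Y" "y \<in> Y" "x \<noteq> y" for x y
        using hom[OF that] by (auto simp: f_def split: if_splits)
      obtain Y0 where Y0: "Y0 \<subseteq> Y" "finite Y0" "card Y0 = R"
        using infinite_arbitrarily_large[OF Y(2)] by blast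
      have "\<forall>\<^sub>F k in sequentially. \<forall>x\<in>Y0. \<forall>y\<in>Y0 - {x}. P (r k) (I ({x, y} \<union> T)) < c'"
      proof (intro eventually_ball_finite ballI)
        fix x y assume "x \<in> Y0" "y \<in> Y0 - {x}"
        then show "\<forall>\<^sub>F k in sequentially. P (r k) (I ({x, y} \<union> T)) < c'"
          using Y0 T small[of x y] by (intro order_tendstoD(2)[OF q]) auto
      qed (use Y0 in auto)
      moreover have "\<forall>\<^sub>F k in sequentially. \<forall>x\<in>Y0. c / 2 < P (r k) (I (insert x T))"
      proof (intro eventually_ball_finite ballI)
        fix x assume "x \<in> Y0"
        then have "c / 2 < q (insert x T)" using c(2)[of x] c(1) Y0 Y by force
        then show "\<forall>\<^sub>F k in sequentially. c / 2 < P (r k) (I (insert x T))"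
          using T by (intro order_tendstoD(1)[OF q]) auto
      qed (use Y0 in auto)
      ultimately have "\<forall>\<^sub>F k in sequentially. (\<forall>x\<in>Y0. \<forall>y\<in>Y0 - {x}. P (r k) (I ({x, y} \<union> T)) < c') \<and>
          (\<forall>x\<in>Y0. c / 2 < P (r k) (I (insert x T)))"
        by (rule eventually_conj)
      then obtain k where k1: "\<forall>x\<in>Y0. \<forall>y\<in>Y0 - {x}. P (r k) (I ({x, y} \<union> T)) < c'"
        and k2: "\<forall>x\<in>Y0. c / 2 < P (r k) (I (insert x T))"
        by (auto dest!: eventually_happens)
      have eq: "I (insert x T) \<inter> I (insert y T) = I ({x, y} \<union> T)" for x y by (auto simp: I_def)
      have "R * (c / 2) \<le> (\<Sum>x\<in>Y0. P (r k) (I (insert x T)))"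
        using k2 Y0(3) sum_bounded_below[of Y0 "c / 2" "\<lambda>x. P (r k) (I (insert x T))"] by force
      also have "\<dots> \<le> P (r k) (\<Union>x\<in>Y0. I (insert x T)) + (\<Sum>x\<in>Y0. \<Sum>y\<in>Y0 - {x}. P (r k) (I ({x, y} \<union> T)))"
        using bonferroni[where B = "\<lambda>x. I (insert x T)" and Y = Y0 and k = "r k"] Y0 T I unfolding eq by simp
      also have "\<dots> \<le> 1 + (\<Sum>x\<in>Y0. \<Sum>y\<in>Y0 - {x}. c')"
      proof (intro add_mono sum_mono)
        have "(\<Union>x\<in>Y0. I (insert x T)) \<in> \<A>" using Y0(2) T by (intro finite_UN I) auto
        then show "P (r k) (\<Union>x\<in>Y0. I (insert x T)) \<le> 1" by (rule le_1)
        show "P (r k) (I ({x, y} \<union> T)) \<le> c'" if "x \<in> Y0" "y \<in> Y0 - {x}" for x y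
          using k1 that by (simp add: less_imp_le)
      qed
      also have "\<dots> \<le> 1 + (\<Sum>x\<in>Y0. \<Sum>y\<in>Y0. c')"
        using Y0 c' by (intro add_left_mono sum_mono sum_mono2) auto
      also have "\<dots> = 2" using Y0 R0 by (simp add: c'_def power2_eq_square)
      finally show False using R c by (simp add: field_simps)
    qed
    from Y(2) obtain m where m: "m \<in> Y" using infinite_imp_nonempty by blast
    have "c' \<le> q (insert m' (insert m T))" if "m' \<in> Y - {m}" for m'
    proof -
      have "f {m', m} = 1" using hom[of m' m] that m \<open>t = 1\<close> by auto
      then show ?thesis by (simp add: f_def split: if_splits)
    qed
    moreover have "infinite (Y - {m})" using Y(2) by simp
    ultimately show ?thesis using m Y(1) c' by (intro bexI[of _ m] exI[of _ "Y - {m}"] conjI exI[of _ c']) auto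
  qed
  \<comment> \<open>A state consists of the events selected so far and an infinite supply of candidates, each of
    which keeps a mass bounded away from zero when intersected with the selection.\<close>
  define good where "good s \<longleftrightarrow> finite (fst s) \<and> fst s \<subseteq> S \<and> infinite (snd s) \<and> snd s \<subseteq> S \<and> fst s \<inter> snd s = {} \<and>
      (\<exists>c>0. \<forall>m\<in>snd s. c \<le> q (insert m (fst s)))" for s :: "nat set \<times> nat set"
  have "\<exists>s. \<forall>n. good (s n) \<and> fst (s n) \<subset> fst (s (Suc n))"
  proof (rule dependent_nat_choice)
    have "\<theta> \<le> q {m}" if "m \<in> S" for m
    proof -
      have "\<theta> \<le> P (r k) (I {m})" for k
        using large[OF that, of "r k"] sets_into_space[OF E[of m]] by (simp add: I_def Int_absorb1)
      then show ?thesis using q[of "{m}"] by (intro LIMSEQ_le_const) auto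
    qed
    then have "good ({}, S)" using S \<theta> by (auto simp: good_def)
    then show "\<exists>s. good s" by blast
  next
    fix s :: "nat set \<times> nat set" and n :: nat assume "good s"
    then obtain c where s: "finite (fst s)" "fst s \<subseteq> S" "infinite (snd s)" "snd s \<subseteq> S" "fst s \<inter> snd s = {}"
      "0 < c" "\<And>m. m \<in> snd s \<Longrightarrow> c \<le> q (insert m (fst s))" by (auto simp: good_def)
    obtain m M' c' where *: "m \<in> snd s" "M' \<subseteq> snd s - {m}" "infinite M'" "0 < c'"
      "\<forall>m'\<in>M'. c' \<le> q (insert m' (insert m (fst s)))"
      using step[OF s(1,3,6,7)] by blast
    then have "good (insert m (fst s), M')" using s by (auto simp: good_def)
    moreover have "fst s \<subset> insert m (fst s)" using * s by auto
    ultimately show "\<exists>s'. good s' \<and> fst s \<subset> fst s'" by (intro exI[of _ "(insert m (fst s), M')"]) simp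
  qed
  then obtain s where s: "\<And>n. good (s n)" "\<And>n. fst (s n) \<subset> fst (s (Suc n))" by blast
  have chain: "fst (s i) \<subseteq> fst (s j)" if "i \<le> j" for i j
    using that by (rule lift_Suc_mono_le[of "\<lambda>n. fst (s n)", rotated]) (use s(2) in blast)
  define T where "T = (\<Union>n. fst (s n))"
  show thesis
  proof (rule that)
    have sub: "fst (s n) \<subseteq> S" and fin: "finite (fst (s n))" for n
      using s(1)[of n] by (auto simp: good_def)
    show "T \<subseteq> S" unfolding T_def using sub by blast
    show "infinite T"
    proof
      assume "finite T"
      have "n \<le> card (fst (s n))" for n
      proof (induction n)
        case (Suc n)
        have "card (fst (s n)) < card (fst (s (Suc n)))"
          by (intro psubset_card_mono fin s(2))
        with Suc show ?case by simp
      qed simp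
      moreover have "card (fst (s n)) \<le> card T" for n
        using \<open>finite T\<close> by (intro card_mono) (auto simp: T_def)
      ultimately show False by (metis not_less_eq_eq order_trans)
    qed
    fix T' assume T': "T' \<subseteq> T" "finite T'"
    obtain n where n: "T' \<subseteq> fst (s n)"
    proof -
      have "\<exists>n. T' \<subseteq> fst (s n)" using T'(2,1)
      proof (induction T')
        case (insert m T')
        then obtain i j where "T' \<subseteq> fst (s i)" "m \<in> fst (s j)" by (auto simp: T_def)
        then show ?case using chain[of i "max i j"] chain[of j "max i j"] by (intro exI[of _ "max i j"]) auto
      qed simp
      then show ?thesis using that by blast
    qed
    from s(1)[of n] obtain c where c: "finite (fst (s n))" "infinite (snd (s n))" "0 < c"
        "\<forall>m\<in>snd (s n). c \<le> q (insert m (fst (s n)))"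
      by (auto simp: good_def)
    then obtain m where m: "m \<in> snd (s n)" using infinite_imp_nonempty by blast
    have "0 < q T'" using c m q_mono[of T' "insert m (fst (s n))"] n by force
    then have "\<forall>\<^sub>F k in sequentially. 0 < P (r k) (I T')"
      using order_tendstoD(1)[OF q[OF T'(2)]] by blast
    then obtain k0 where k0: "\<And>k. k \<ge> k0 \<Longrightarrow> 0 < P (r k) (I T')"
      by (auto simp: eventually_sequentially)
    show "\<exists>\<^sub>\<infinity>k. 0 < P k (\<Omega> \<inter> (\<Inter>m\<in>T'. E m))"
      unfolding INFM_nat_le
    proof
      fix j
      have "0 < P (r (max j k0)) (I T')" by (rule k0) simp
      moreover have "j \<le> r (max j k0)" using seq_suble[OF r, of "max j k0"] by linarith
      ultimately show "\<exists>k\<ge>j. 0 < P k (\<Omega> \<inter> (\<Inter>m\<in>T'. E m))" by (auto simp: I_def)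
    qed
  qed
qed

section \<open>Entropy and distinct names of independent points\<close>

text \<open>Let \<open>v'\<close> be the part of the masses \<open>v\<close> carried by a good event. If fewer than \<open>n\<close> labels have
  a good mass of at least the fraction \<open>t / N\<close> of the total, the entropy is essentially that of a
  choice among \<open>n\<close> possibilities: one for each heavy label and one for all the others together,
  whose total mass is at most \<open>t\<close> plus the mass of the bad event.\<close>

lemma sum_eta_le_few_heavy:
  fixes v v' :: "'b \<Rightarrow> real"
  assumes "finite B" and v: "\<And>b. b \<in> B \<Longrightarrow> 0 \<le> v' b" "\<And>b. b \<in> B \<Longrightarrow> v' b \<le> v b"
    and N: "card B \<le> N" "1 \<le> N" and "0 < t"
    and few: "card {b\<in>B. t / N * sum v B \<le> v' b} < n"
  shows "(\<Sum>b\<in>B. eta (v b)) \<le> eta (sum v B) + sum v B * ln n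
      + (sum v B * t + (\<Sum>b\<in>B. v b - v' b)) * ln N"
proof -
  define T where "T = {b\<in>B. t / N * sum v B \<le> v' b}"
  define r where "r = sum v (B - T)"
  have T: "finite T" "T \<subseteq> B" "card T < n" using assms by (auto simp: T_def)
  have v0: "\<And>b. b \<in> B \<Longrightarrow> 0 \<le> v b" using v by force
  have w0: "sum v B \<ge> 0" using v0 by (intro sum_nonneg)
  have split: "sum g B = sum g T + sum g (B - T)" for g :: "'b \<Rightarrow> real"
    using sum.subset_diff[OF T(2) assms(1), of g] by simp
  have r0: "r \<ge> 0" unfolding r_def using v0 by (intro sum_nonneg) auto
  have lnN: "ln (real N) \<ge> 0" using N by simp
  have "card (B - T) \<le> N" using N(1) card_mono[of B "B - T"] assms(1) by auto
  then have rest: "(\<Sum>b\<in>B - T. eta (v b)) \<le> eta r + r * ln N"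
    unfolding r_def using assms v0 by (intro sum_eta_le) auto
  have top: "(\<Sum>b\<in>T. eta (v b)) + eta r \<le> eta (sum v B) + sum v B * ln n"
  proof -
    \<comment> \<open>\<open>None\<close> stands for all light labels merged into one\<close>
    let ?u = "\<lambda>x. case x of None \<Rightarrow> r | Some b \<Rightarrow> v b"
    let ?I = "insert None (Some ` T)"
    have s: "(\<Sum>i\<in>?I. g i) = g None + (\<Sum>b\<in>T. g (Some b))" for g :: "'b option \<Rightarrow> real"
      using T(1) by (subst sum.insert) (auto simp: sum.reindex)
    have "card ?I \<le> n" using T by (simp add: card_image card_insert_if)
    then have "(\<Sum>i\<in>?I. eta (?u i)) \<le> eta (sum ?u ?I) + sum ?u ?I * ln n"
      using T v0 r0 by (intro sum_eta_le) auto
    moreover have "sum ?u ?I = sum v B" unfolding s by (simp add: r_def split[of v])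
    ultimately show ?thesis unfolding s by simp
  qed
  have "r = sum v' (B - T) + (\<Sum>b\<in>B - T. v b - v' b)"
    by (simp add: r_def sum_subtractf)
  also have "\<dots> \<le> (\<Sum>b\<in>B - T. t / N * sum v B) + (\<Sum>b\<in>B. v b - v' b)"
    using assms(1) v by (intro add_mono sum_mono sum_mono2) (auto simp: T_def)
  also have "(\<Sum>b\<in>B - T. t / N * sum v B) \<le> N * (t / N * sum v B)"
    unfolding sum_constant using \<open>card (B - T) \<le> N\<close> \<open>0 < t\<close> w0 by (intro mult_right_mono) auto
  also have "N * (t / N * sum v B) = sum v B * t" using N by simp
  finally have "r * ln N \<le> (sum v B * t + (\<Sum>b\<in>B. v b - v' b)) * ln N"
    using lnN by (intro mult_right_mono) auto
  then show ?thesis using rest top split[of "\<lambda>b. eta (v b)"] by linarith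
qed

text \<open>Finite version of the relatively independent \<open>n\<close>-fold self-joining over a factor: choose a
  point of \<open>M\<close>; if its \<open>z\<close>-label \<open>c\<close> lies in \<open>J\<close>, draw \<open>n\<close> independent points from the cell of
  \<open>c\<close>, otherwise stop. The value at \<open>E\<close> is the probability of obtaining a tuple in \<open>E\<close>. Cells of
  measure zero contribute nothing, whatever the (then degenerate) uniform measure on them is.\<close>

definition cell_tuples :: "'a measure \<Rightarrow> ('a \<Rightarrow> 'c) \<Rightarrow> 'c set \<Rightarrow> nat \<Rightarrow> (nat \<Rightarrow> 'a) set \<Rightarrow> real" where
  "cell_tuples M z J n E = (\<Sum>c\<in>J. measure M (z -` {c} \<inter> space M) *
     measure (\<Pi>\<^sub>M i\<in>{1..n}. uniform_measure M (z -` {c} \<inter> space M)) E)"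

text \<open>The \<open>n\<close>-tuples of points of \<open>W\<close> whose labels under \<open>f\<close> are pairwise distinct.\<close>

definition distinct_names :: "'a measure \<Rightarrow> ('a \<Rightarrow> 'b) \<Rightarrow> 'a set \<Rightarrow> nat \<Rightarrow> (nat \<Rightarrow> 'a) set" where
  "distinct_names M f W n = {x \<in> {1..n} \<rightarrow>\<^sub>E W. inj_on (\<lambda>i. f (x i)) {1..n}}"

context prob_space
begin

lemma sets_PiM_uniform:
  "sets (\<Pi>\<^sub>M i\<in>{1..n}. uniform_measure M A) = sets (\<Pi>\<^sub>M i\<in>{1..n}. M)"
  by (intro sets_PiM_cong) auto

lemma distinct_names_sets:
  assumes f: "simple_function M f" and W: "W \<in> events"
  shows "distinct_names M f W n \<in> sets (\<Pi>\<^sub>M i\<in>{1..n::nat}. M)"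
proof -
  define X where "X = {s \<in> {1..n} \<rightarrow>\<^sub>E f ` space M. inj_on s {1..n}}"
  have "finite ({1..n} \<rightarrow>\<^sub>E f ` space M)" using f by (intro finite_PiE) (auto simp: simple_function_def)
  then have "finite X" unfolding X_def by (rule rev_finite_subset) auto
  have Wsub: "W \<subseteq> space M" using W sets.sets_into_space by blast
  have "distinct_names M f W n = (\<Union>s\<in>X. \<Pi>\<^sub>E i\<in>{1..n}. (f -` {s i} \<inter> space M) \<inter> W)"
  proof (rule equalityI; rule subsetI)
    fix x assume x: "x \<in> distinct_names M f W n"
    let ?s = "restrict (\<lambda>i. f (x i)) {1..n}"
    have "inj_on ?s {1..n} \<longleftrightarrow> inj_on (\<lambda>i. f (x i)) {1..n}" by (intro inj_on_cong) simp
    then have 1: "?s \<in> X" using x Wsub by (auto simp: X_def distinct_names_def PiE_iff)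
    have 2: "x \<in> (\<Pi>\<^sub>E i\<in>{1..n}. (f -` {?s i} \<inter> space M) \<inter> W)"
      using x Wsub by (auto simp: distinct_names_def PiE_iff)
    from 1 2 show "x \<in> (\<Union>s\<in>X. \<Pi>\<^sub>E i\<in>{1..n}. (f -` {s i} \<inter> space M) \<inter> W)" by (intro UN_I[where a="?s"]) auto
  next
    fix x assume "x \<in> (\<Union>s\<in>X. \<Pi>\<^sub>E i\<in>{1..n}. (f -` {s i} \<inter> space M) \<inter> W)"
    then obtain s where s: "s \<in> X" "x \<in> (\<Pi>\<^sub>E i\<in>{1..n}. (f -` {s i} \<inter> space M) \<inter> W)"
      by (rule UN_E)
    then have "\<And>i. i \<in> {1..n} \<Longrightarrow> f (x i) = s i" by (auto simp: PiE_iff)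
    then have "inj_on (\<lambda>i. f (x i)) {1..n} \<longleftrightarrow> inj_on s {1..n}" by (intro inj_on_cong)
    then show "x \<in> distinct_names M f W n" using s by (auto simp: distinct_names_def X_def PiE_iff)
  qed
  also have "\<dots> \<in> sets (\<Pi>\<^sub>M i\<in>{1..n}. M)"
    using \<open>finite X\<close> vimage_event[OF f] W by (intro sets.finite_UN sets_PiM_I_finite) auto
  finally show ?thesis .
qed

lemma prob_space_cell_product:
  assumes "Z \<in> events" "prob Z > 0"
  shows "finite_product_prob_space (\<lambda>_. uniform_measure M Z) {1..n::nat}"
proof -
  have "prob_space (uniform_measure M Z)"
    using assms emeasure_eq_measure by (intro prob_space_uniform_measure) auto
  then show ?thesis
    unfolding finite_product_prob_space_def product_prob_space_def product_prob_space_axioms_def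
      finite_product_sigma_finite_def finite_product_sigma_finite_axioms_def product_sigma_finite_def
    using prob_space_imp_sigma_finite by auto
qed

text \<open>If at least \<open>n\<close> labels are heavy in a cell \<open>Z\<close>, then \<open>n\<close> independent points of \<open>Z\<close> have distinct
  labels with a definite probability: prescribe a different heavy label for each of them.\<close>

lemma heavy_names_tuples:
  assumes f: "simple_function M f" and W: "W \<in> events" and Z: "Z \<in> events" "prob Z > 0"
    and s: "0 \<le> s" and heavy: "n \<le> card {b\<in>f ` space M. s * prob Z \<le> prob (f -` {b} \<inter> Z \<inter> W)}"
  shows "s ^ n \<le> measure (\<Pi>\<^sub>M i\<in>{1..n}. uniform_measure M Z) (distinct_names M f W n)"
proof -
  let ?T = "{b\<in>f ` space M. s * prob Z \<le> prob (f -` {b} \<inter> Z \<inter> W)}"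
  have "finite ?T" using f by (auto simp: simple_function_def)
  moreover have "card {1..n} \<le> card ?T" using heavy by simp
  ultimately obtain \<tau> where \<tau>: "\<tau> ` {1..n} \<subseteq> ?T" "inj_on \<tau> {1..n}"
    using card_le_inj[of "{1..n}" ?T] by auto
  interpret P: finite_product_prob_space "\<lambda>i. uniform_measure M Z" "{1..n}"
    by (rule prob_space_cell_product[OF Z])
  let ?A = "\<lambda>i. (f -` {\<tau> i} \<inter> space M) \<inter> W"
  have A: "?A i \<in> events" for i using vimage_event[OF f] W by blast
  have Wsub: "W \<subseteq> space M" using W sets.sets_into_space by blast
  have "s ^ n = (\<Prod>i\<in>{1..n}. s)" by simp
  also have "\<dots> \<le> (\<Prod>i\<in>{1..n}. measure (uniform_measure M Z) (?A i))"
  proof (intro prod_mono conjI s)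
    fix i assume "i \<in> {1..n}"
    then have "\<tau> i \<in> ?T" using \<tau>(1) by blast
    then have "s * prob Z \<le> prob (f -` {\<tau> i} \<inter> Z \<inter> W)" by simp
    also have "f -` {\<tau> i} \<inter> Z \<inter> W = Z \<inter> ?A i" using Wsub by auto
    finally have "s \<le> prob (Z \<inter> ?A i) / prob Z" using Z by (simp add: field_simps)
    also have "\<dots> = measure (uniform_measure M Z) (?A i)"
      using Z emeasure_eq_measure A by (subst measure_uniform_measure) auto
    finally show "s \<le> measure (uniform_measure M Z) (?A i)" .
  qed
  also have "\<dots> = measure (\<Pi>\<^sub>M i\<in>{1..n}. uniform_measure M Z) (\<Pi>\<^sub>E i\<in>{1..n}. ?A i)"
    using A by (intro P.finite_measure_PiM_emb[symmetric]) simp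
  also have "\<dots> \<le> measure (\<Pi>\<^sub>M i\<in>{1..n}. uniform_measure M Z) (distinct_names M f W n)"
  proof (rule P.finite_measure_mono)
    show "distinct_names M f W n \<in> sets (\<Pi>\<^sub>M i\<in>{1..n}. uniform_measure M Z)"
      using distinct_names_sets[OF f W] by (simp add: sets_PiM_uniform)
    show "(\<Pi>\<^sub>E i\<in>{1..n}. ?A i) \<subseteq> distinct_names M f W n"
    proof
      fix x assume x: "x \<in> (\<Pi>\<^sub>E i\<in>{1..n}. ?A i)"
      then have "\<And>i. i \<in> {1..n} \<Longrightarrow> f (x i) = \<tau> i" by (auto simp: PiE_iff)
      then have "inj_on (\<lambda>i. f (x i)) {1..n} \<longleftrightarrow> inj_on \<tau> {1..n}" by (intro inj_on_cong)
      then show "x \<in> distinct_names M f W n" using x \<tau>(2) by (auto simp: distinct_names_def PiE_iff)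
    qed
  qed
  finally show ?thesis .
qed

text \<open>A labelling with at most \<open>N\<close> values and conditional entropy well above \<open>log n\<close> has distinct
  labels on a non-negligible set of \<open>n\<close>-tuples drawn from the cells of \<open>z\<close>. In each cell either
  fewer than \<open>n\<close> labels are heavy and \<open>sum_eta_le_few_heavy\<close> applies, or the trivial bound \<open>log N\<close>
  is paid for by the probability estimate of \<open>heavy_names_tuples\<close>.\<close>

lemma ent_le_distinct_names:
  assumes f: "simple_function M f" and z: "simple_function M z" and W: "W \<in> events"
    and N: "card (f ` space M) \<le> N" and n: "1 \<le> n" and t: "0 < t"
    and J: "J \<subseteq> z ` space M"
  shows "ent M (\<lambda>x. (f x, z x)) - ent M z \<le>
    ln n + (t + prob (space M - W) + prob {x\<in>space M. z x \<notin> J}) * ln N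
    + ln N / (t / N) ^ n * cell_tuples M z J n (distinct_names M f W n)"
proof -
  have fin: "finite (f ` space M)" "finite (z ` space M)" using f z by (auto simp: simple_function_def)
  have N1: "1 \<le> N" using N fin not_empty by (metis One_nat_def Suc_leI card_gt_0_iff image_is_empty le_trans)
  have lnN: "ln (real N) \<ge> 0" using N1 by simp
  have lnn: "ln (real n) \<ge> 0" using n by simp
  define Z where "Z c = z -` {c} \<inter> space M" for c
  define Q where "Q c = measure (\<Pi>\<^sub>M i\<in>{1..n}. uniform_measure M (Z c)) (distinct_names M f W n)" for c
  have Zev: "Z c \<in> events" for c unfolding Z_def by (rule vimage_event[OF z])
  have C0: "ln N / (t / N) ^ n \<ge> 0" using lnN t N1 by simp
  have sumv: "(\<Sum>b\<in>f ` space M. prob (f -` {b} \<inter> Z c)) = prob (Z c)" for c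
    by (rule prob_fibre_sum[OF f Zev])
  have gen: "(\<Sum>b\<in>f ` space M. eta (prob (f -` {b} \<inter> Z c))) \<le> eta (prob (Z c)) + prob (Z c) * ln N" for c
    using sum_eta_le[OF fin(1) _ N N1, of "\<lambda>b. prob (f -` {b} \<inter> Z c)"] by (simp add: sumv)
  have good: "(\<Sum>b\<in>f ` space M. eta (prob (f -` {b} \<inter> Z c))) \<le> eta (prob (Z c)) + prob (Z c) * ln n
      + (prob (Z c) * t + prob (Z c - W)) * ln N + ln N / (t / N) ^ n * (prob (Z c) * Q c)" for c
  proof (cases "n \<le> card {b\<in>f ` space M. t / N * prob (Z c) \<le> prob (f -` {b} \<inter> Z c \<inter> W)}")
    case True
    show ?thesis
    proof (cases "prob (Z c) > 0")
      case pos: True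
      have "(t / N) ^ n \<le> Q c" unfolding Q_def
        using True t by (intro heavy_names_tuples f W Zev pos) auto
      then have "1 \<le> 1 / (t / N) ^ n * Q c" using t N1 by (simp add: field_simps)
      then have "prob (Z c) * ln N * 1 \<le> prob (Z c) * ln N * (1 / (t / N) ^ n * Q c)"
        using lnN by (intro mult_left_mono) auto
      then have "prob (Z c) * ln N \<le> ln N / (t / N) ^ n * (prob (Z c) * Q c)" by (simp add: mult_ac)
      moreover have "0 \<le> prob (Z c) * ln n + (prob (Z c) * t + prob (Z c - W)) * ln N"
        using lnN lnn t by simp
      ultimately show ?thesis using gen[of c] by linarith
    next
      case False
      then have "prob (Z c) = 0" using measure_nonneg[of M "Z c"] by linarith
      then show ?thesis using gen[of c] lnN order_trans[OF _ mult_nonneg_nonneg[OF measure_nonneg[of M "Z c - W"] lnN]] by simp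
    qed
  next
    case False
    have ev: "f -` {b} \<inter> Z c \<in> events" for b
    proof -
      have "f -` {b} \<inter> Z c = (f -` {b} \<inter> space M) \<inter> Z c" by (auto simp: Z_def)
      then show ?thesis using vimage_event[OF f] Zev by (metis sets.Int)
    qed
    have "(\<Sum>b\<in>f ` space M. prob (f -` {b} \<inter> Z c) - prob (f -` {b} \<inter> Z c \<inter> W))
        = (\<Sum>b\<in>f ` space M. prob (f -` {b} \<inter> (Z c - W)))"
      using ev W by (intro sum.cong refl, subst finite_measure_Diff'[symmetric]) (auto intro!: arg_cong[of _ _ prob])
    also have "\<dots> = prob (Z c - W)" using W Zev by (intro prob_fibre_sum f) auto
    finally have *: "(\<Sum>b\<in>f ` space M. prob (f -` {b} \<inter> Z c) - prob (f -` {b} \<inter> Z c \<inter> W)) = prob (Z c - W)" .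
    have "(\<Sum>b\<in>f ` space M. eta (prob (f -` {b} \<inter> Z c))) \<le> eta (prob (Z c)) + prob (Z c) * ln n
      + (prob (Z c) * t + prob (Z c - W)) * ln N"
      using sum_eta_le_few_heavy[OF fin(1), of "\<lambda>b. prob (f -` {b} \<inter> Z c \<inter> W)" "\<lambda>b. prob (f -` {b} \<inter> Z c)" N t n]
        False N N1 t ev W unfolding sumv * by (auto intro!: finite_measure_mono)
    moreover have "0 \<le> ln N / (t / N) ^ n * (prob (Z c) * Q c)"
      using C0 by (intro mult_nonneg_nonneg) (auto simp: Q_def)
    ultimately show ?thesis by linarith
  qed
  have "ent M (\<lambda>x. (f x, z x)) - ent M z =
      (\<Sum>c\<in>z ` space M. (\<Sum>b\<in>f ` space M. eta (prob (f -` {b} \<inter> Z c))) - eta (prob (Z c)))"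
    by (simp add: ent_pair[OF f z] ent_def[of _ z] sum_subtractf Z_def)
  also have "\<dots> = (\<Sum>c\<in>J. (\<Sum>b\<in>f ` space M. eta (prob (f -` {b} \<inter> Z c))) - eta (prob (Z c)))
     + (\<Sum>c\<in>z ` space M - J. (\<Sum>b\<in>f ` space M. eta (prob (f -` {b} \<inter> Z c))) - eta (prob (Z c)))"
    using sum.subset_diff[OF J fin(2)] by (simp only: add.commute)
  also have "\<dots> \<le> (\<Sum>c\<in>J. prob (Z c) * ln n + (prob (Z c) * t + prob (Z c - W)) * ln N
        + ln N / (t / N) ^ n * (prob (Z c) * Q c)) + (\<Sum>c\<in>z ` space M - J. prob (Z c) * ln N)"
  proof (intro add_mono sum_mono)
    fix c
    show "(\<Sum>b\<in>f ` space M. eta (prob (f -` {b} \<inter> Z c))) - eta (prob (Z c)) \<le>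
      prob (Z c) * ln n + (prob (Z c) * t + prob (Z c - W)) * ln N + ln N / (t / N) ^ n * (prob (Z c) * Q c)"
      using good[of c] by linarith
    show "(\<Sum>b\<in>f ` space M. eta (prob (f -` {b} \<inter> Z c))) - eta (prob (Z c)) \<le> prob (Z c) * ln N"
      using gen[of c] by linarith
  qed
  also have "\<dots> = (\<Sum>c\<in>J. prob (Z c)) * ln n + ((\<Sum>c\<in>J. prob (Z c)) * t + (\<Sum>c\<in>J. prob (Z c - W))) * ln N
      + ln N / (t / N) ^ n * (\<Sum>c\<in>J. prob (Z c) * Q c) + (\<Sum>c\<in>z ` space M - J. prob (Z c)) * ln N"
    by (simp add: sum.distrib sum_distrib_right sum_distrib_left distrib_right)
  also have "\<dots> \<le> 1 * ln n + (1 * t + prob (space M - W)) * ln N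
      + ln N / (t / N) ^ n * (\<Sum>c\<in>J. prob (Z c) * Q c) + prob {x\<in>space M. z x \<notin> J} * ln N"
  proof -
    have a: "(\<Sum>c\<in>J. prob (Z c)) \<le> 1"
    proof -
      have "(\<Sum>c\<in>J. prob (Z c)) \<le> (\<Sum>c\<in>z ` space M. prob (Z c))"
        using fin J by (intro sum_mono2) auto
      also have "\<dots> = 1" using prob_fibre_sum[OF z sets.top] by (simp add: prob_space Z_def)
      finally show ?thesis .
    qed
    have b: "(\<Sum>c\<in>J. prob (Z c - W)) \<le> prob (space M - W)"
    proof -
      have "(\<Sum>c\<in>J. prob (Z c - W)) \<le> (\<Sum>c\<in>z ` space M. prob (Z c - W))"
        using fin J by (intro sum_mono2) auto
      also have "\<dots> = (\<Sum>c\<in>z ` space M. prob (z -` {c} \<inter> (space M - W)))"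
        by (intro sum.cong refl arg_cong[of _ _ prob]) (auto simp: Z_def)
      also have "\<dots> = prob (space M - W)" using W by (intro prob_fibre_sum z) auto
      finally show ?thesis .
    qed
    have c: "(\<Sum>c\<in>z ` space M - J. prob (Z c)) = prob {x\<in>space M. z x \<notin> J}"
    proof -
      have "(\<Union>c\<in>z ` space M - J. Z c) = {x\<in>space M. z x \<notin> J}" by (auto simp: Z_def)
      moreover have "prob (\<Union>c\<in>z ` space M - J. Z c) = (\<Sum>c\<in>z ` space M - J. prob (Z c))"
        using fin Zev by (intro finite_measure_finite_Union) (auto simp: disjoint_family_on_def Z_def)
      ultimately show ?thesis by simp
    qed
    show ?thesis unfolding c
      using a b t lnN lnn by (intro add_mono mult_right_mono order_refl) auto
  qed
  finally show ?thesis
    by (simp add: cell_tuples_def Q_def Z_def algebra_simps)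
qed

lemma cell_tuples_content:
  assumes z: "simple_function M z" and J: "J \<subseteq> z ` space M"
  shows "subprobability_content (space (\<Pi>\<^sub>M i\<in>{1..n}. M)) (sets (\<Pi>\<^sub>M i\<in>{1..n}. M)) (cell_tuples M z J n)"
proof -
  let ?S = "\<Pi>\<^sub>M i\<in>{1..n}. M"
  define Z where "Z c = z -` {c} \<inter> space M" for c
  let ?Q = "\<lambda>c. \<Pi>\<^sub>M i\<in>{1..n}. uniform_measure M (Z c)"
  have Z: "Z c \<in> events" for c unfolding Z_def by (rule vimage_event[OF z])
  have fin: "finite (z ` space M)" "finite J" using z J by (auto simp: simple_function_def finite_subset)
  show ?thesis
  proof
    fix A B assume AB: "A \<in> sets ?S" "B \<in> sets ?S" "A \<inter> B = {}"
    have "prob (Z c) * measure (?Q c) (A \<union> B) = prob (Z c) * measure (?Q c) A + prob (Z c) * measure (?Q c) B" for c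
    proof (cases "prob (Z c) > 0")
      case True
      interpret Q: finite_product_prob_space "\<lambda>_. uniform_measure M (Z c)" "{1..n}"
        by (rule prob_space_cell_product[OF Z True])
      show ?thesis using Q.finite_measure_Union[of A B] AB by (simp add: sets_PiM_uniform distrib_left)
    next
      case False
      then have "prob (Z c) = 0" using measure_nonneg[of M "Z c"] by linarith
      then show ?thesis by simp
    qed
    then show "cell_tuples M z J n (A \<union> B) = cell_tuples M z J n A + cell_tuples M z J n B"
      by (simp add: cell_tuples_def Z_def sum.distrib)
  next
    fix A show "0 \<le> cell_tuples M z J n A" by (simp add: cell_tuples_def sum_nonneg)
  next
    have "prob (Z c) * measure (?Q c) (space ?S) \<le> prob (Z c)" for c
    proof (cases "prob (Z c) > 0")
      case True
      interpret Q: finite_product_prob_space "\<lambda>_. uniform_measure M (Z c)" "{1..n}"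
        by (rule prob_space_cell_product[OF Z True])
      show ?thesis using Q.prob_le_1 True by simp
    next
      case False
      then have "prob (Z c) = 0" using measure_nonneg[of M "Z c"] by linarith
      then show ?thesis by simp
    qed
    then have "cell_tuples M z J n (space ?S) \<le> (\<Sum>c\<in>J. prob (Z c))"
      unfolding cell_tuples_def Z_def by (intro sum_mono)
    also have "\<dots> \<le> (\<Sum>c\<in>z ` space M. prob (Z c))" using fin J by (intro sum_mono2) auto
    also have "\<dots> = 1" using prob_fibre_sum[OF z sets.top] by (simp add: prob_space Z_def)
    finally show "cell_tuples M z J n (space ?S) \<le> 1" .
  qed
qed

text \<open>An event of positive mass contains a tuple all of whose points lie in one and the same cell
  with label in \<open>J\<close>.\<close>

lemma cell_tuples_pos_imp:
  assumes z: "simple_function M z" and E: "E \<in> sets (\<Pi>\<^sub>M i\<in>{1..n}. M)"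
    and pos: "0 < cell_tuples M z J n E"
  obtains c x where "c \<in> J" "x \<in> E" "\<And>i. i \<in> {1..n} \<Longrightarrow> x i \<in> space M \<and> z (x i) = c"
proof -
  define Z where "Z c = z -` {c} \<inter> space M" for c
  have Z: "Z c \<in> events" for c unfolding Z_def by (rule vimage_event[OF z])
  have "\<exists>c\<in>J. prob (Z c) * measure (\<Pi>\<^sub>M i\<in>{1..n}. uniform_measure M (Z c)) E > 0"
  proof (rule ccontr)
    assume "\<not> ?thesis"
    then have "cell_tuples M z J n E \<le> 0"
      unfolding cell_tuples_def Z_def by (intro sum_nonpos) (auto simp: not_less)
    with pos show False by simp
  qed
  then obtain c where c: "c \<in> J" "prob (Z c) * measure (\<Pi>\<^sub>M i\<in>{1..n}. uniform_measure M (Z c)) E > 0" by blast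
  then have p: "prob (Z c) > 0" and q: "measure (\<Pi>\<^sub>M i\<in>{1..n}. uniform_measure M (Z c)) E > 0"
    by (auto simp: zero_less_mult_iff measure_nonneg not_less[symmetric] zero_less_measure_iff)
  interpret Q: finite_product_prob_space "\<lambda>_. uniform_measure M (Z c)" "{1..n}"
    by (rule prob_space_cell_product[OF Z p])
  let ?Q = "\<Pi>\<^sub>M i\<in>{1..n}. uniform_measure M (Z c)" and ?B = "\<Pi>\<^sub>E i\<in>{1..n}. Z c"
  have B: "?B \<in> sets ?Q" using Z by (intro sets_PiM_I_finite) auto
  have "measure ?Q ?B = (\<Prod>i\<in>{1..n}. measure (uniform_measure M (Z c)) (Z c))"
    using Z by (intro Q.finite_measure_PiM_emb) simp
  also have "\<dots> = 1" using p Z emeasure_eq_measure by (subst measure_uniform_measure) auto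
  finally have B1: "measure ?Q ?B = 1" .
  have "E \<inter> ?B \<noteq> {}"
  proof
    assume "E \<inter> ?B = {}"
    moreover have "E \<in> sets ?Q" using E by (simp add: sets_PiM_uniform)
    ultimately have "measure ?Q (E \<union> ?B) = measure ?Q E + measure ?Q ?B"
      using B by (intro Q.finite_measure_Union) auto
    then show False using q B1 Q.prob_le_1[of "E \<union> ?B"] by linarith
  qed
  then obtain x where "x \<in> E" "x \<in> ?B" by blast
  then show thesis using that[OF c(1), of x] by (auto simp: Z_def PiE_iff)
qed

text \<open>Reverse Markov inequality: if the events \<open>S g\<close> have a large average probability, then it is
  likely that at least a proportion \<open>\<theta>\<close> of them occurs.\<close>

lemma cell_tuples_markov:
  fixes \<theta> :: real
  assumes z: "simple_function M z" and J: "J \<subseteq> z ` space M" and H: "finite H" "H \<noteq> {}"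
    and S: "\<And>g. g \<in> H \<Longrightarrow> S g \<in> sets (\<Pi>\<^sub>M i\<in>{1..n}. M)" and \<theta>: "0 \<le> \<theta>"
    and E: "E = {x \<in> space (\<Pi>\<^sub>M i\<in>{1..n}. M). \<theta> * card H \<le> card {g\<in>H. x \<in> S g}}"
  shows "E \<in> sets (\<Pi>\<^sub>M i\<in>{1..n}. M)"
    and "(\<Sum>g\<in>H. cell_tuples M z J n (S g)) \<le> card H * cell_tuples M z J n E + \<theta> * card H"
proof -
  let ?S = "\<Pi>\<^sub>M i\<in>{1..n}. M"
  have cnt: "real (card {g\<in>H. x \<in> S g}) = (\<Sum>g\<in>H. indicat_real (S g) x)" for x
    using H by (simp add: indicator_def sum.If_cases Int_def)
  have "(\<lambda>x. real (card {g\<in>H. x \<in> S g})) \<in> borel_measurable ?S"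
    unfolding cnt using S by (intro borel_measurable_sum borel_measurable_indicator)
  then show E': "E \<in> sets ?S"
    unfolding E by (rule borel_measurable_le[OF borel_measurable_const])
  define Z where "Z c = z -` {c} \<inter> space M" for c
  let ?Q = "\<lambda>c. \<Pi>\<^sub>M i\<in>{1..n}. uniform_measure M (Z c)"
  have Z: "Z c \<in> events" for c unfolding Z_def by (rule vimage_event[OF z])
  have cell: "(\<Sum>g\<in>H. prob (Z c) * measure (?Q c) (S g)) \<le> card H * (prob (Z c) * measure (?Q c) E) + \<theta> * card H * prob (Z c)" for c
  proof (cases "prob (Z c) > 0")
    case True
    interpret Q: finite_product_prob_space "\<lambda>_. uniform_measure M (Z c)" "{1..n}"
      by (rule prob_space_cell_product[OF Z True])
    have sets: "S g \<in> sets (?Q c)" if "g \<in> H" for g using S[OF that] by (simp add: sets_PiM_uniform)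
    have EQ: "E \<in> sets (?Q c)" using E' by (simp add: sets_PiM_uniform)
    have sp: "space (?Q c) = space ?S" by (simp add: space_PiM)
    have i: "integrable (?Q c) (indicator A :: _ \<Rightarrow> real)" if "A \<in> sets (?Q c)" for A
      by (rule integrable_real_indicator[OF that]) (use Q.emeasure_finite[of A] in \<open>simp add: less_top\<close>)
    have iE: "integrable (?Q c) (\<lambda>x. card H * indicat_real E x + \<theta> * card H)"
      by (intro Bochner_Integration.integrable_add integrable_mult_right i[OF EQ] Q.integrable_const)
    have "(\<Sum>g\<in>H. measure (?Q c) (S g)) = (\<integral>x. (\<Sum>g\<in>H. indicat_real (S g) x) \<partial>?Q c)"
      using sets i by (subst Bochner_Integration.integral_sum) auto
    also have "\<dots> \<le> (\<integral>x. card H * indicat_real E x + \<theta> * card H \<partial>?Q c)"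
    proof (rule integral_mono)
      fix x assume x: "x \<in> space (?Q c)"
      have "real (card {g\<in>H. x \<in> S g}) \<le> card H" using H by (intro of_nat_mono card_mono) auto
      moreover have "0 \<le> \<theta> * card H" using \<theta> by simp
      ultimately show "(\<Sum>g\<in>H. indicat_real (S g) x) \<le> card H * indicat_real E x + \<theta> * card H"
        using x sp unfolding cnt[symmetric] by (auto simp: E indicator_def)
    qed (use sets i iE in auto)
    also have "\<dots> = card H * measure (?Q c) E + \<theta> * card H"
      using EQ by (subst Bochner_Integration.integral_add[OF integrable_mult_right[OF i[OF EQ]] Q.integrable_const])
        (simp add: Q.P.prob_space del: One_nat_def)
    finally have "prob (Z c) * (\<Sum>g\<in>H. measure (?Q c) (S g)) \<le> prob (Z c) * (card H * measure (?Q c) E + \<theta> * card H)"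
      using True by (intro mult_left_mono) auto
    then show ?thesis by (simp add: sum_distrib_left algebra_simps)
  next
    case False
    then have "prob (Z c) = 0" using measure_nonneg[of M "Z c"] by linarith
    then show ?thesis by simp
  qed
  have "(\<Sum>g\<in>H. cell_tuples M z J n (S g)) = (\<Sum>c\<in>J. \<Sum>g\<in>H. prob (Z c) * measure (?Q c) (S g))"
    unfolding cell_tuples_def Z_def by (rule sum.swap)
  also have "\<dots> \<le> (\<Sum>c\<in>J. card H * (prob (Z c) * measure (?Q c) E) + \<theta> * card H * prob (Z c))"
    by (intro sum_mono cell)
  also have "\<dots> = card H * cell_tuples M z J n E + \<theta> * card H * (\<Sum>c\<in>J. prob (Z c))"
    by (simp add: cell_tuples_def Z_def sum.distrib sum_distrib_left)
  also have "\<dots> \<le> card H * cell_tuples M z J n E + \<theta> * card H * 1"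
  proof -
    have "(\<Sum>c\<in>J. prob (Z c)) \<le> (\<Sum>c\<in>z ` space M. prob (Z c))"
      using z J by (intro sum_mono2) (auto simp: simple_function_def)
    also have "\<dots> = 1" using prob_fibre_sum[OF z sets.top] by (simp add: prob_space Z_def)
    finally show ?thesis using \<theta> by (intro add_left_mono mult_left_mono) auto
  qed
  finally show "(\<Sum>g\<in>H. cell_tuples M z J n (S g)) \<le> card H * cell_tuples M z J n E + \<theta> * card H" by simp
qed

end

section \<open>Relative entropy and finite partitions of the factor\<close>

text \<open>Jensen's inequality over each cell of a finite partition measurable with respect to \<open>\<F>\<close>: the
  tangent of \<open>eta\<close> at the conditional probability of \<open>A\<close> given the cell is integrated over the
  cell.\<close>

lemma (in prob_space) cond_exp_entropy_le:
  assumes sub: "subalgebra M \<F>" and A: "A \<in> events"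
    and z: "simple_function M z" and zF: "\<And>c. z -` {c} \<inter> space M \<in> sets \<F>"
  shows "(\<integral>x. eta (real_cond_exp M \<F> (indicator A) x) \<partial>M)
    \<le> (\<Sum>c\<in>z ` space M. eta (prob (A \<inter> (z -` {c} \<inter> space M)))
        + prob (A \<inter> (z -` {c} \<inter> space M)) * ln (prob (z -` {c} \<inter> space M)))"
proof -
  interpret finite_measure_subalgebra M \<F> by unfold_locales (rule sub)
  define E where "E = real_cond_exp M \<F> (indicator A)"
  have fin: "finite (z ` space M)" using z by (simp add: simple_function_def)
  have iA: "integrable M (indicator A :: 'a \<Rightarrow> real)"
    by (rule integrable_real_indicator[OF A]) (simp add: emeasure_eq_measure)
  have E[measurable]: "E \<in> borel_measurable M" unfolding E_def by simp
  have E01: "AE x in M. 0 \<le> E x \<and> E x \<le> 1"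
    using real_cond_exp_ge_c[OF iA, of 0] real_cond_exp_le_c[OF iA, of 1]
    unfolding E_def by (auto simp: indicator_def)
  have [measurable]: "(\<lambda>x. eta (E x)) \<in> borel_measurable M" unfolding eta_def by simp
  have eta01: "AE x in M. norm (eta (E x)) \<le> 1"
    using E01
  proof eventually_elim
    case (elim x)
    then show ?case using eta_nonneg[of "E x"] eta_le_tangent[of "E x" 1] by auto
  qed
  have int_eta: "integrable M (\<lambda>x. eta (E x))"
    by (rule integrable_const_bound[OF eta01]) simp
  have int_E: "integrable M E" unfolding E_def using iA by (rule real_cond_exp_int)
  define Z where "Z c = z -` {c} \<inter> space M" for c
  have Z: "Z c \<in> events" "Z c \<in> sets \<F>" for c
    using vimage_event[OF z] zF by (auto simp: Z_def)
  have int: "integrable M (\<lambda>x. indicator (Z c) x * E x)" "integrable M (\<lambda>x. indicator (Z c) x * eta (E x))"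
    "integrable M (indicator (Z c) :: 'a \<Rightarrow> real)" for c
    using integrable_mult_indicator[OF Z(1) int_E] integrable_mult_indicator[OF Z(1) int_eta]
      integrable_mult_indicator[OF Z(1) integrable_const[of "1::real"]] by simp_all
  have EZ: "(\<integral>x. indicator (Z c) x * E x \<partial>M) = prob (A \<inter> Z c)" for c
  proof -
    have "(\<integral>x. indicator (Z c) x * E x \<partial>M) = (\<integral>x. indicator (Z c) x * indicator A x \<partial>M)"
      using real_cond_exp_intA[OF iA Z(2)] by (simp add: set_lebesgue_integral_def E_def)
    also have "\<dots> = (\<integral>x. indicator (A \<inter> Z c) x \<partial>M)"
      by (intro Bochner_Integration.integral_cong) (auto simp: indicator_def)
    also have "\<dots> = prob (A \<inter> Z c)" using A Z(1) by simp
    finally show ?thesis .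
  qed
  have tangent: "(\<integral>x. indicator (Z c) x * eta (E x) \<partial>M)
      \<le> - prob (A \<inter> Z c) * ln s + s * prob (Z c) - prob (A \<inter> Z c)" if "s > 0" for c s
  proof -
    have "(\<integral>x. indicator (Z c) x * eta (E x) \<partial>M)
        \<le> (\<integral>x. - ln s * (indicator (Z c) x * E x) + s * indicator (Z c) x - indicator (Z c) x * E x \<partial>M)"
    proof (rule integral_mono_AE)
      show "integrable M (\<lambda>x. indicator (Z c) x * eta (E x))"
        "integrable M (\<lambda>x. - ln s * (indicator (Z c) x * E x) + s * indicator (Z c) x - indicator (Z c) x * E x)"
        using int by simp_all
      show "AE x in M. indicator (Z c) x * eta (E x)
          \<le> - ln s * (indicator (Z c) x * E x) + s * indicator (Z c) x - indicator (Z c) x * E x"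
        using E01
      proof eventually_elim
        case (elim x)
        then show ?case using eta_le_tangent[of "E x" s] that by (auto simp: indicator_def mult.commute)
      qed
    qed
    also have "\<dots> = - ln s * prob (A \<inter> Z c) + s * prob (Z c) - prob (A \<inter> Z c)"
      using int Z(1) by (simp add: EZ)
    finally show ?thesis by (simp add: mult.commute)
  qed
  have cell: "(\<integral>x. indicator (Z c) x * eta (E x) \<partial>M) \<le> eta (prob (A \<inter> Z c)) + prob (A \<inter> Z c) * ln (prob (Z c))" for c
  proof (cases "prob (A \<inter> Z c) = 0")
    case True
    \<comment> \<open>there is no tangent at \<open>0\<close>, so the tangents at small \<open>e\<close> are used instead\<close>
    have "(\<integral>x. indicator (Z c) x * eta (E x) \<partial>M) \<le> 0 + e" if "e > 0" for e
    proof -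
      have "(\<integral>x. indicator (Z c) x * eta (E x) \<partial>M) \<le> e * prob (Z c)"
        using tangent[OF that, of c] True by simp
      also have "\<dots> \<le> e * 1" using that by (intro mult_left_mono prob_le_1) auto
      finally show ?thesis by simp
    qed
    then have "(\<integral>x. indicator (Z c) x * eta (E x) \<partial>M) \<le> 0" by (rule field_le_epsilon)
    then show ?thesis using True by simp
  next
    case False
    then have p: "prob (A \<inter> Z c) > 0" by (simp add: zero_less_measure_iff)
    moreover have "prob (A \<inter> Z c) \<le> prob (Z c)" using Z(1) by (intro finite_measure_mono) auto
    ultimately have "prob (Z c) > 0" by linarith
    then show ?thesis using tangent[of "prob (A \<inter> Z c) / prob (Z c)" c] p
      by (simp add: eta_def ln_div algebra_simps)
  qed
  have "(\<integral>x. eta (E x) \<partial>M) = (\<integral>x. (\<Sum>c\<in>z ` space M. indicator (Z c) x * eta (E x)) \<partial>M)"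
  proof (intro Bochner_Integration.integral_cong refl)
    fix x assume "x \<in> space M"
    then have "(\<Sum>c\<in>z ` space M. indicator (Z c) x * eta (E x)) = (\<Sum>c\<in>z ` space M. if c = z x then eta (E x) else 0)"
      by (intro sum.cong) (auto simp: Z_def)
    then show "eta (E x) = (\<Sum>c\<in>z ` space M. indicator (Z c) x * eta (E x))"
      using fin \<open>x \<in> space M\<close> by simp
  qed
  also have "\<dots> = (\<Sum>c\<in>z ` space M. \<integral>x. indicator (Z c) x * eta (E x) \<partial>M)"
    using int by (intro Bochner_Integration.integral_sum)
  also have "\<dots> \<le> (\<Sum>c\<in>z ` space M. eta (prob (A \<inter> Z c)) + prob (A \<inter> Z c) * ln (prob (Z c)))"
    by (intro sum_mono cell)
  finally show ?thesis by (simp add: E_def Z_def)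
qed

text \<open>Relative entropy is at most the conditional entropy given any finite partition measurable with
  respect to \<open>\<F>\<close>.\<close>

lemma (in prob_space) sum_cond_exp_entropy_le:
  assumes sub: "subalgebra M \<F>" and f: "simple_function M f"
    and z: "simple_function M z" and zF: "\<And>c. z -` {c} \<inter> space M \<in> sets \<F>"
  shows "(\<Sum>b\<in>f ` space M. \<integral>x. eta (real_cond_exp M \<F> (indicator (f -` {b} \<inter> space M)) x) \<partial>M)
    \<le> ent M (\<lambda>x. (f x, z x)) - ent M z"
proof -
  define Z where "Z c = z -` {c} \<inter> space M" for c
  have eq: "f -` {b} \<inter> space M \<inter> Z c = f -` {b} \<inter> Z c" for b c by (auto simp: Z_def)
  have Z: "Z c \<in> events" for c unfolding Z_def by (rule vimage_event[OF z])
  have "(\<Sum>b\<in>f ` space M. \<integral>x. eta (real_cond_exp M \<F> (indicator (f -` {b} \<inter> space M)) x) \<partial>M)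
    \<le> (\<Sum>b\<in>f ` space M. \<Sum>c\<in>z ` space M. eta (prob (f -` {b} \<inter> Z c)) + prob (f -` {b} \<inter> Z c) * ln (prob (Z c)))"
    using cond_exp_entropy_le[OF sub vimage_event[OF f] z zF, folded Z_def, unfolded eq]
    by (intro sum_mono)
  also have "\<dots> = (\<Sum>c\<in>z ` space M. \<Sum>b\<in>f ` space M. eta (prob (f -` {b} \<inter> Z c)) + prob (f -` {b} \<inter> Z c) * ln (prob (Z c)))"
    by (rule sum.swap)
  also have "\<dots> = (\<Sum>c\<in>z ` space M. \<Sum>b\<in>f ` space M. eta (prob (f -` {b} \<inter> Z c)))
      + (\<Sum>c\<in>z ` space M. (\<Sum>b\<in>f ` space M. prob (f -` {b} \<inter> Z c)) * ln (prob (Z c)))"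
    by (simp add: sum.distrib sum_distrib_right)
  also have "\<dots> = ent M (\<lambda>x. (f x, z x)) - ent M z"
    by (simp add: ent_pair[OF f z] ent_def[of M z] prob_fibre_sum[OF f Z, unfolded Z_def] Z_def eta_def sum_negf)
  finally show ?thesis .
qed

lemma (in prob_space) cond_exp_entropy_nonneg:
  assumes sub: "subalgebra M \<F>" and A: "A \<in> events"
  shows "0 \<le> (\<integral>x. eta (real_cond_exp M \<F> (indicator A) x) \<partial>M)"
proof (rule integral_nonneg_AE)
  interpret finite_measure_subalgebra M \<F> by unfold_locales (rule sub)
  have iA: "integrable M (indicator A :: 'a \<Rightarrow> real)"
    by (rule integrable_real_indicator[OF A]) (simp add: emeasure_eq_measure)
  have "AE x in M. real_cond_exp M \<F> (indicator A) x \<ge> 0" "AE x in M. real_cond_exp M \<F> (indicator A) x \<le> 1"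
    by (auto intro!: real_cond_exp_ge_c real_cond_exp_le_c iA simp: indicator_def)
  then show "AE x in M. 0 \<le> eta (real_cond_exp M \<F> (indicator A) x)"
    by eventually_elim (rule eta_nonneg)
qed

section \<open>Names\<close>

text \<open>The element of the partition \<open>\<alpha>\<close> that contains \<open>x\<close>.\<close>

definition cell :: "'x set set \<Rightarrow> 'x \<Rightarrow> 'x set" where
  "cell \<alpha> x = (THE A. A \<in> \<alpha> \<and> x \<in> A)"

lemma cell_eq:
  assumes "partition_on UNIV \<alpha>" "A \<in> \<alpha>" "x \<in> A"
  shows "cell \<alpha> x = A"
  unfolding cell_def
proof (rule the_equality)
  fix B assume "B \<in> \<alpha> \<and> x \<in> B"
  then show "B = A" using assms by (auto simp: partition_on_def disjoint_def)
qed (use assms in simp)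

lemma cell_in:
  assumes "partition_on UNIV \<alpha>"
  shows "cell \<alpha> x \<in> \<alpha>" "x \<in> cell \<alpha> x"
proof -
  from assms obtain A where "A \<in> \<alpha>" "x \<in> A" by (auto simp: partition_on_def)
  then show "cell \<alpha> x \<in> \<alpha>" "x \<in> cell \<alpha> x" using cell_eq[OF assms] by auto
qed

text \<open>The \<open>\<alpha>\<close>-name of \<open>x\<close> over a set \<open>E\<close> of group elements: the record, for \<open>g\<close> in \<open>E\<close>, of the cell
  visited by the translate of \<open>x\<close> by \<open>g\<close>.\<close>

definition name :: "('g \<Rightarrow> 'x \<Rightarrow> 'x) \<Rightarrow> 'x set set \<Rightarrow> 'g set \<Rightarrow> 'x \<Rightarrow> 'g \<Rightarrow> 'x set" where
  "name \<phi> \<alpha> E x = restrict (\<lambda>g. cell \<alpha> (\<phi> g x)) E"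

lemma name_eq_iff: "name \<phi> \<alpha> E x = name \<phi> \<alpha> E y \<longleftrightarrow> (\<forall>g\<in>E. cell \<alpha> (\<phi> g x) = cell \<alpha> (\<phi> g y))"
  by (auto simp: name_def restrict_def fun_eq_iff)

lemma name_range:
  assumes \<alpha>: "partition_on UNIV \<alpha>"
  shows "range (name \<phi> \<alpha> E) \<subseteq> E \<rightarrow>\<^sub>E \<alpha>"
  using cell_in[OF \<alpha>] by (auto simp: name_def)

lemma card_name_range:
  assumes \<alpha>: "partition_on UNIV \<alpha>" "finite \<alpha>" and "finite E"
  shows "card (range (name \<phi> \<alpha> E)) \<le> card \<alpha> ^ card E"
proof -
  have "card (range (name \<phi> \<alpha> E)) \<le> card (E \<rightarrow>\<^sub>E \<alpha>)"
    using assms by (intro card_mono name_range finite_PiE) auto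
  then show ?thesis using assms by (simp add: card_PiE)
qed

text \<open>Two elements of \<open>E\<close> may pull \<open>\<alpha>\<close> back to the same partition; this does not matter, since
  the refinement only depends on the set of pulled-back partitions.\<close>

lemma common_refinement_names:
  fixes \<phi> :: "'g \<Rightarrow> 'x \<Rightarrow> 'x"
  assumes \<alpha>: "partition_on UNIV \<alpha>"
  shows "common_refinement ((\<lambda>g. (\<lambda>A. \<phi> g -` A) ` \<alpha>) ` E) =
    (\<lambda>b. name \<phi> \<alpha> E -` {b}) ` range (name \<phi> \<alpha> E)"
proof (rule equalityI; rule subsetI)
  let ?P = "\<lambda>g. (\<lambda>A. \<phi> g -` A) ` \<alpha>"
  fix X assume "X \<in> common_refinement (?P ` E)"
  then obtain f where f: "\<And>P. P \<in> ?P ` E \<Longrightarrow> f P \<in> P" and X: "X = \<Inter> (f ` ?P ` E)" "X \<noteq> {}"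
    by (auto simp: common_refinement)
  from X obtain x where x: "x \<in> X" by blast
  have "f (?P g) = \<phi> g -` cell \<alpha> (\<phi> g x)" if g: "g \<in> E" for g
  proof -
    obtain A where A: "A \<in> \<alpha>" "f (?P g) = \<phi> g -` A" using f[of "?P g"] g by auto
    moreover have "x \<in> f (?P g)" using x X g by auto
    ultimately show ?thesis using cell_eq[OF \<alpha>, of A "\<phi> g x"] by auto
  qed
  then have "X = (\<Inter>g\<in>E. \<phi> g -` cell \<alpha> (\<phi> g x))" using X by simp
  also have "\<dots> = name \<phi> \<alpha> E -` {name \<phi> \<alpha> E x}"
    using cell_eq[OF \<alpha> cell_in(1)[OF \<alpha>]] cell_in(2)[OF \<alpha>] by (auto simp: name_eq_iff) metis
  finally show "X \<in> (\<lambda>b. name \<phi> \<alpha> E -` {b}) ` range (name \<phi> \<alpha> E)" by blast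
next
  let ?P = "\<lambda>g. (\<lambda>A. \<phi> g -` A) ` \<alpha>"
  fix X assume "X \<in> (\<lambda>b. name \<phi> \<alpha> E -` {b}) ` range (name \<phi> \<alpha> E)"
  then obtain x where X: "X = name \<phi> \<alpha> E -` {name \<phi> \<alpha> E x}" by blast
  define f where "f P = (SOME B. B \<in> P \<and> x \<in> B)" for P :: "'x set set"
  have f: "f (?P g) = \<phi> g -` cell \<alpha> (\<phi> g x)" for g
    unfolding f_def
  proof (rule some_equality)
    show "\<phi> g -` cell \<alpha> (\<phi> g x) \<in> ?P g \<and> x \<in> \<phi> g -` cell \<alpha> (\<phi> g x)"
      using cell_in[OF \<alpha>] by auto
    show "\<And>B. B \<in> ?P g \<and> x \<in> B \<Longrightarrow> B = \<phi> g -` cell \<alpha> (\<phi> g x)"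
      using cell_eq[OF \<alpha>] by auto
  qed
  have "X = (\<Inter>g\<in>E. \<phi> g -` cell \<alpha> (\<phi> g x))"
    unfolding X using cell_eq[OF \<alpha> cell_in(1)[OF \<alpha>]] cell_in(2)[OF \<alpha>] by (auto simp: name_eq_iff) metis
  then have "X = \<Inter> (f ` ?P ` E)" using f by simp
  moreover have "f \<in> (\<Pi> P\<in>?P ` E. P)" using f cell_in(1)[OF \<alpha>] by auto
  moreover have "X \<noteq> {}" unfolding X by blast
  ultimately show "X \<in> common_refinement (?P ` E)"
    unfolding common_refinement by blast
qed

lemma sum_common_refinement:
  assumes \<alpha>: "partition_on UNIV \<alpha>"
  shows "(\<Sum>A\<in>common_refinement ((\<lambda>g. (\<lambda>A. \<phi> g -` A) ` \<alpha>) ` E). h A) =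
    (\<Sum>b\<in>range (name \<phi> \<alpha> E). h (name \<phi> \<alpha> E -` {b}))"
  unfolding common_refinement_names[OF \<alpha>]
  by (subst sum.reindex) (auto simp: inj_on_def)

section \<open>Regularity of Borel measures\<close>

lemma closed_decreasing_open:
  fixes C :: "'x::metric_space set"
  assumes "closed C"
  obtains V :: "nat \<Rightarrow> 'x set" where "\<And>n. open (V n)" "decseq V" "\<Inter> (range V) = C"
proof
  let ?V = "\<lambda>n. \<Union>x\<in>C. ball x (1 / Suc n)"
  show "open (?V n)" for n by auto
  show "decseq ?V"
  proof (intro decseq_SucI UN_mono order_refl subset_ball)
    fix n show "1 / real (Suc (Suc n)) \<le> 1 / real (Suc n)" by (intro divide_left_mono) auto
  qed
  show "\<Inter> (range ?V) = C"
  proof (rule equalityI; rule subsetI)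
    fix y assume y: "y \<in> \<Inter> (range ?V)"
    have "\<exists>x\<in>C. dist x y < e" if e: "e > 0" for e
    proof -
      obtain n where "inverse (real (Suc n)) < e" using reals_Archimedean[OF e] by blast
      then have "1 / Suc n < e" by (simp add: inverse_eq_divide)
      moreover from y have "y \<in> (\<Union>x\<in>C. ball x (1 / Suc n))" by blast
      then obtain x where "x \<in> C" "dist x y < 1 / Suc n" by auto
      ultimately show ?thesis by (intro bexI[of _ x]) auto
    qed
    then show "y \<in> C" using assms closed_approachable[of C y] by auto
  next
    fix y assume "y \<in> C"
    then show "y \<in> \<Inter> (range ?V)" by (intro INT_I UN_I[of y]) auto
  qed
qed

text \<open>Finite Borel measures on metric spaces are regular with respect to closed and open sets.\<close>

lemma borel_closed_open_approx:
  fixes M :: "'a::metric_space measure"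
  assumes M: "finite_measure M" and sets: "sets M = sets borel" and A: "A \<in> sets borel" and e: "e > 0"
  shows "\<exists>C U. closed C \<and> open U \<and> C \<subseteq> A \<and> A \<subseteq> U \<and> measure M (U - C) < e"
proof -
  interpret finite_measure M by (rule M)
  have A': "A \<in> sigma_sets UNIV {C. closed C}" using A by (simp add: borel_eq_closed)
  have m[measurable]: "open U \<Longrightarrow> U \<in> sets M" "closed U \<Longrightarrow> U \<in> sets M" for U using sets by auto
  from A' e show ?thesis
  proof (induction A arbitrary: e)
    case (Basic C)
    then have C: "closed C" by simp
    obtain V where V: "\<And>n::nat. open (V n)" "decseq V" "\<Inter> (range V) = C"
      using closed_decreasing_open[OF C] by blast
    have "(\<lambda>n. measure M (V n)) \<longlonglongrightarrow> measure M (\<Inter> (range V))"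
      using V m by (intro finite_Lim_measure_decseq) auto
    then have "\<forall>\<^sub>F n in sequentially. measure M (V n) < measure M C + e"
      using Basic V(3) by (intro order_tendstoD(2)) auto
    then obtain n where "measure M (V n) < measure M C + e" by (auto dest!: eventually_happens)
    moreover have "C \<subseteq> V n" using V(3) by auto
    ultimately show ?case using C V(1) m
      by (intro exI[of _ C] exI[of _ "V n"]) (auto simp: finite_measure_Diff)
  next
    case Empty
    show ?case by (rule exI[of _ "{}"], rule exI[of _ "{}"]) (use Empty in simp)
  next
    case (Compl A)
    from Compl.IH[OF Compl.prems]
    obtain C U where *: "closed C" "open U" "C \<subseteq> A" "A \<subseteq> U" "measure M (U - C) < e" by (elim exE conjE)
    have "(UNIV - C) - (UNIV - U) = U - C" by auto
    moreover have "closed (UNIV - U)" "open (UNIV - C)" using * by (auto intro: closed_Diff open_Diff)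
    moreover have "UNIV - U \<subseteq> UNIV - A" "UNIV - A \<subseteq> UNIV - C" using * by auto
    ultimately have "closed (UNIV - U) \<and> open (UNIV - C) \<and> UNIV - U \<subseteq> UNIV - A \<and> UNIV - A \<subseteq> UNIV - C \<and>
        measure M ((UNIV - C) - (UNIV - U)) < e" using *(5) by simp
    then show ?case by (intro exI)
  next
    case (Union A)
    \<comment> \<open>half of \<open>e\<close> is spent on the approximations of the \<open>A i\<close>, the other half on keeping only
      finitely many of the closed sets\<close>
    have "\<forall>i. \<exists>C U. closed C \<and> open U \<and> C \<subseteq> A i \<and> A i \<subseteq> U \<and> measure M (U - C) < e / 2 * (1 / 2) ^ Suc i"
    proof
      fix i
      have "0 < e / 2 * (1 / 2) ^ Suc i" using Union.prems by simp
      then show "\<exists>C U. closed C \<and> open U \<and> C \<subseteq> A i \<and> A i \<subseteq> U \<and> measure M (U - C) < e / 2 * (1 / 2) ^ Suc i"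
        by (rule Union.IH)
    qed
    then obtain C U where CU: "\<And>i. closed (C i)" "\<And>i. open (U i)" "\<And>i. C i \<subseteq> A i" "\<And>i. A i \<subseteq> U i"
      "\<And>i. measure M (U i - C i) < e / 2 * (1 / 2) ^ Suc i" by metis
    have sm: "summable (\<lambda>i. e / 2 * (1 / 2 :: real) ^ Suc i)" by (intro summable_mult) (simp add: summable_geometric)
    have tot: "(\<Sum>i. e / 2 * (1 / 2 :: real) ^ Suc i) = e / 2"
      using suminf_mult[of "\<lambda>i. (1/2::real) ^ Suc i" "e / 2"] power_half_series by (simp add: sums_iff)
    have le: "measure M (\<Union>i. U i - C i) \<le> e / 2"
    proof -
      have "summable (\<lambda>i. measure M (U i - C i))"
        using CU(5) by (intro summable_comparison_test'[OF sm, of 0]) (auto intro: less_imp_le)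
      then have "measure M (\<Union>i. U i - C i) \<le> (\<Sum>i. measure M (U i - C i))"
        using CU m by (intro finite_measure_subadditive_countably) auto
      also have "\<dots> \<le> (\<Sum>i. e / 2 * (1 / 2) ^ Suc i)"
        using CU(5) \<open>summable (\<lambda>i. measure M (U i - C i))\<close> sm by (intro suminf_le) (auto intro: less_imp_le)
      finally show ?thesis using tot by simp
    qed
    have "(\<lambda>n. measure M (\<Union>i\<le>n. C i)) \<longlonglongrightarrow> measure M (\<Union>n. \<Union>i\<le>n. C i)"
    proof (rule finite_Lim_measure_incseq)
      show "range (\<lambda>n. \<Union>i\<le>n. C i) \<subseteq> sets M" using CU m by auto
      show "incseq (\<lambda>n. \<Union>i\<le>n. C i)" by (intro incseq_SucI UN_mono) auto
    qed
    moreover have "(\<Union>n. \<Union>i\<le>n. C i) = (\<Union>i. C i)" by auto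
    ultimately have "\<forall>\<^sub>F n in sequentially. measure M (\<Union>i. C i) - e / 2 < measure M (\<Union>i\<le>n. C i)"
      using Union.prems by (intro order_tendstoD(1)) auto
    then obtain n where n: "measure M (\<Union>i. C i) - e / 2 < measure M (\<Union>i\<le>n. C i)"
      by (auto dest!: eventually_happens)
    let ?C = "\<Union>i\<le>n. C i" and ?U = "\<Union>i. U i" and ?D = "\<Union>i. C i"
    have ev: "?C \<in> sets M" "?U \<in> sets M" "?D \<in> sets M" "(\<Union>i. U i - C i) \<in> sets M" using CU m by auto
    have "measure M (?U - ?C) \<le> measure M ((\<Union>i. U i - C i) \<union> (?D - ?C))"
      using ev by (intro finite_measure_mono) auto
    also have "\<dots> \<le> measure M (\<Union>i. U i - C i) + measure M (?D - ?C)"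
      using ev by (intro measure_subadditive) (auto simp: emeasure_eq_measure)
    also have "measure M (?D - ?C) = measure M ?D - measure M ?C"
      using ev by (intro finite_measure_Diff) auto
    finally have "measure M (?U - ?C) < e" using le n by simp
    moreover have "closed ?C" "open ?U" using CU by auto
    moreover have "?C \<subseteq> (\<Union>i. A i)" "(\<Union>i. A i) \<subseteq> ?U" using CU(3,4) by blast+
    ultimately show ?case by blast
  qed
qed

lemma inner_regular_closed:
  fixes M :: "'a::metric_space measure"
  assumes M: "finite_measure M" "sets M = sets borel" "A \<in> sets borel" "e > 0"
  obtains C where "closed C" "C \<subseteq> A" "measure M (A - C) < e"
proof -
  interpret finite_measure M by (rule M(1))
  obtain C U where *: "closed C" "open U" "C \<subseteq> A" "A \<subseteq> U" "measure M (U - C) < e"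
    using borel_closed_open_approx[OF assms] by blast
  have "measure M (A - C) \<le> measure M (U - C)"
    using * M(2) by (intro finite_measure_mono) auto
  then show thesis using * that by force
qed

section \<open>Ergodic actions and Folner averages\<close>

text \<open>An ergodic measure for an action of an infinite amenable group on a compact metric space,
  together with a two-sided Folner sequence.\<close>

locale ergodic_system =
  fixes G :: "('g, 'r) monoid_scheme" (structure)
    and F :: "nat \<Rightarrow> 'g set" and \<phi> :: "'g \<Rightarrow> 'x \<Rightarrow> 'x::metric_space" and \<mu> :: "'x measure"
  assumes G: "countable_amenable_group G" and infinite_G: "infinite (carrier G)"
    and folner: "folner_sequence G F" and tds: "tds G \<phi>" and erg: "\<mu> \<in> ergodic_measures G \<phi>"

sublocale ergodic_system \<subseteq> group G
  using G by (simp add: countable_amenable_group_def)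

sublocale ergodic_system \<subseteq> prob_space \<mu>
  using erg by (simp add: ergodic_measures_def invariant_measures_def)

context ergodic_system
begin

lemma compact_UNIV: "compact (UNIV :: 'x set)"
  using tds by (simp add: tds_def)

lemma sets_mu: "sets \<mu> = sets borel"
  using erg by (simp add: ergodic_measures_def invariant_measures_def)

lemma space_mu [simp]: "space \<mu> = UNIV"
  using sets_eq_imp_space_eq[OF sets_mu] by simp

lemma act_one: "\<phi> \<one> x = x"
proof -
  interpret A: group_action G UNIV \<phi> using tds by (simp add: tds_def)
  show ?thesis using A.id_eq_one by (metis UNIV_I restrict_apply')
qed

lemma act_mult: "g \<in> carrier G \<Longrightarrow> h \<in> carrier G \<Longrightarrow> \<phi> (g \<otimes> h) x = \<phi> g (\<phi> h x)"
proof -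
  interpret A: group_action G UNIV \<phi> using tds by (simp add: tds_def)
  show "g \<in> carrier G \<Longrightarrow> h \<in> carrier G \<Longrightarrow> ?thesis" using A.composition_rule by simp
qed

lemma cont: "g \<in> carrier G \<Longrightarrow> continuous_on UNIV (\<phi> g)"
proof -
  assume g: "g \<in> carrier G"
  have "continuous_map euclidean (prod_topology (discrete_topology (carrier G)) euclidean) (\<lambda>x::'x. (g, x))"
    using g by (intro continuous_map_pairedI) auto
  then have "continuous_map euclidean euclidean ((\<lambda>(g, x). \<phi> g x) \<circ> (\<lambda>x. (g, x)))"
    using tds by (intro continuous_map_compose) (auto simp: tds_def)
  then show ?thesis by (simp add: o_def)
qed

lemma act_measurable: "g \<in> carrier G \<Longrightarrow> A \<in> sets borel \<Longrightarrow> \<phi> g -` A \<in> sets borel"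
  using measurable_sets_borel[OF borel_measurable_continuous_onI[OF cont]] by simp

lemma invariant: "g \<in> carrier G \<Longrightarrow> A \<in> sets borel \<Longrightarrow> prob (\<phi> g -` A) = prob A"
  using erg by (simp add: ergodic_measures_def invariant_measures_def)

lemma F: "finite (F m)" "F m \<noteq> {}" "F m \<subseteq> carrier G"
  using folner by (auto simp: folner_sequence_def)

lemma card_F_pos: "0 < card (F m)"
  using F by (simp add: card_gt_0_iff)

lemma folner_left: "g \<in> carrier G \<Longrightarrow>
    (\<lambda>m. real (card (sym_diff (g <# F m) (F m))) / real (card (F m))) \<longlonglongrightarrow> 0"
  and folner_right: "g \<in> carrier G \<Longrightarrow>
    (\<lambda>m. real (card (sym_diff (F m #> g) (F m))) / real (card (F m))) \<longlonglongrightarrow> 0"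
  using folner by (auto simp: folner_sequence_def)

text \<open>An infinite group has Folner sets of unbounded size: if \<open>F m\<close> has fewer than \<open>N\<close> elements, almost
  invariance under \<open>N\<close> group elements is exact invariance, so \<open>F m\<close> contains \<open>N\<close> translates of any
  of its points.\<close>

lemma card_F_at_top: "filterlim (\<lambda>m. real (card (F m))) at_top sequentially"
  unfolding filterlim_at_top
proof
  fix Z :: real
  obtain N :: nat where "max Z 0 < real N" using reals_Archimedean2 by blast
  then have N: "Z < real N" "0 < N" by auto
  obtain K where K: "K \<subseteq> carrier G" "finite K" "card K = N"
    using infinite_arbitrarily_large[OF infinite_G] by blast
  have "\<forall>\<^sub>F m in sequentially. \<forall>k\<in>K. real (card (sym_diff (k <# F m) (F m))) / real (card (F m)) < 1 / N"
    using K N by (intro eventually_ball_finite ballI order_tendstoD(2)[OF folner_left]) auto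
  then show "\<forall>\<^sub>F m in sequentially. Z \<le> real (card (F m))"
  proof eventually_elim
    case (elim m)
    show ?case
    proof (rule ccontr)
      assume "\<not> ?thesis"
      then have less: "card (F m) < N" using N by linarith
      have eq: "k <# F m = F m" if k: "k \<in> K" for k
      proof -
        have fin: "finite (sym_diff (k <# F m) (F m))" using F by (auto simp: l_coset_def)
        have "real (card (sym_diff (k <# F m) (F m))) < 1 / N * card (F m)"
          using elim k card_F_pos[of m] by (simp add: pos_divide_less_eq)
        also have "\<dots> < 1" using less by (simp add: field_simps)
        finally have "sym_diff (k <# F m) (F m) = {}" using fin by simp
        then show ?thesis by blast
      qed
      obtain f where f: "f \<in> F m" using F by blast
      have "(\<lambda>k. k \<otimes> f) ` K \<subseteq> F m"
      proof
        fix y assume "y \<in> (\<lambda>k. k \<otimes> f) ` K"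
        then obtain k where "k \<in> K" "y = k \<otimes> f" by blast
        then have "y \<in> k <# F m" using f by (auto simp: l_coset_def)
        then show "y \<in> F m" using eq \<open>k \<in> K\<close> by blast
      qed
      moreover have "inj_on (\<lambda>k. k \<otimes> f) K"
        using f K F by (intro inj_onI) (metis right_cancel subsetD)
      ultimately have "card K \<le> card (F m)" using F by (metis card_inj_on_le)
      then show False using less K by simp
    qed
  qed
qed

text \<open>Right almost invariance: averages over \<open>F m\<close> and over its right translate by \<open>g\<close> have the same
  asymptotics.\<close>

lemma translated_average:
  assumes g: "g \<in> carrier G" and u: "\<And>h. \<bar>u h\<bar> \<le> B"
  shows "(\<lambda>m. (\<Sum>h\<in>F m. u (h \<otimes> g)) / card (F m) - (\<Sum>h\<in>F m. u h) / card (F m)) \<longlonglongrightarrow> 0"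
proof (rule Lim_null_comparison)
  show "(\<lambda>m. B * (real (card (sym_diff (F m #> g) (F m))) / real (card (F m)))) \<longlonglongrightarrow> 0"
    using tendsto_mult[OF tendsto_const[of B] folner_right[OF g]] by simp
  show "\<forall>\<^sub>F m in sequentially. norm ((\<Sum>h\<in>F m. u (h \<otimes> g)) / card (F m) - (\<Sum>h\<in>F m. u h) / card (F m))
     \<le> B * (real (card (sym_diff (F m #> g) (F m))) / real (card (F m)))"
  proof (intro always_eventually allI)
    fix m
    have inj: "inj_on (\<lambda>h. h \<otimes> g) (F m)"
      using g F by (intro inj_onI) (metis right_cancel subsetD)
    have im: "F m #> g = (\<lambda>h. h \<otimes> g) ` F m" by (auto simp: r_coset_def)
    have fin: "finite (F m #> g)" using F by (simp add: im)
    let ?R = "F m #> g"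
    have "(\<Sum>h\<in>F m. u (h \<otimes> g)) = sum u ?R"
      unfolding im by (subst sum.reindex[OF inj]) simp
    moreover have "sum u ?R = sum u (?R \<inter> F m) + sum u (?R - F m)"
      by (rule sum.Int_Diff[OF fin])
    moreover have "sum u (F m) = sum u (?R \<inter> F m) + sum u (F m - ?R)"
      using sum.Int_Diff[OF F(1), of u m ?R] by (simp add: Int_commute)
    ultimately have "(\<Sum>h\<in>F m. u (h \<otimes> g)) - sum u (F m) = sum u (?R - F m) - sum u (F m - ?R)"
      by simp
    also have "\<bar>\<dots>\<bar> \<le> \<bar>sum u (?R - F m)\<bar> + \<bar>sum u (F m - ?R)\<bar>" by (rule abs_triangle_ineq4)
    also have "\<dots> \<le> card (?R - F m) * B + card (F m - ?R) * B"
      by (intro add_mono order_trans[OF sum_abs] sum_bounded_above u)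
    also have "\<dots> = B * card (sym_diff ?R (F m))"
      using fin F by (subst card_Un_disjoint) (auto simp: algebra_simps)
    finally have "\<bar>(\<Sum>h\<in>F m. u (h \<otimes> g)) - sum u (F m)\<bar> \<le> B * card (sym_diff ?R (F m))" .
    then show "norm ((\<Sum>h\<in>F m. u (h \<otimes> g)) / card (F m) - (\<Sum>h\<in>F m. u h) / card (F m))
      \<le> B * (real (card (sym_diff (F m #> g) (F m))) / real (card (F m)))"
      using card_F_pos[of m] by (simp add: diff_divide_distrib[symmetric] abs_divide divide_right_mono)
  qed
qed

text \<open>Ergodicity enters only here: finitely many translates of a set of positive measure fill the
  space up to measure \<open>t\<close>.\<close>

lemma finite_translates_cover:
  assumes A: "A \<in> sets borel" "prob A > 0" and t: "t > 0"
  obtains a and r :: nat where "\<And>i. a i \<in> carrier G" "prob (UNIV - (\<Union>i<r. \<phi> (a i) -` A)) < t"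
proof -
  define a where "a = from_nat_into (carrier G)"
  have range_a: "range a = carrier G"
    unfolding a_def using G by (intro range_from_nat_into) (auto simp: countable_amenable_group_def)
  have a: "a i \<in> carrier G" for i using range_a by auto
  define U where "U = (\<Union>i. \<phi> (a i) -` A)"
  have U_alt: "U = (\<Union>g\<in>carrier G. \<phi> g -` A)" unfolding U_def range_a[symmetric] by auto
  have ev: "\<phi> (a i) -` A \<in> sets borel" for i using act_measurable a A by auto
  have U: "U \<in> sets borel" unfolding U_def using ev by auto
  have inv: "\<phi> h -` U = U" if h: "h \<in> carrier G" for h
  proof (intro equalityI subsetI)
    fix x assume "x \<in> \<phi> h -` U"
    then obtain g where g: "g \<in> carrier G" "\<phi> g (\<phi> h x) \<in> A" by (auto simp: U_alt)
    then have "\<phi> (g \<otimes> h) x \<in> A" using h by (simp add: act_mult)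
    then show "x \<in> U" unfolding U_alt using g h by blast
  next
    fix x assume "x \<in> U"
    then obtain g where g: "g \<in> carrier G" "\<phi> g x \<in> A" by (auto simp: U_alt)
    have "\<phi> (g \<otimes> m_inv G h) (\<phi> h x) = \<phi> g x"
      using g h by (simp add: act_mult[symmetric] m_assoc)
    then have "\<phi> (g \<otimes> m_inv G h) (\<phi> h x) \<in> A" using g by simp
    moreover have "g \<otimes> m_inv G h \<in> carrier G" using g h by simp
    ultimately show "x \<in> \<phi> h -` U" unfolding U_alt by blast
  qed
  have "A \<subseteq> U"
  proof
    fix x assume "x \<in> A"
    then have "x \<in> \<phi> \<one> -` A" by (simp add: act_one)
    then show "x \<in> U" unfolding U_alt using one_closed by blast
  qed
  then have "prob U > 0" using A U finite_measure_mono[of A U] by (simp add: sets_mu)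
  moreover have "prob U = 0 \<or> prob U = 1"
  proof -
    have "\<forall>A\<in>sets borel. (\<forall>g\<in>carrier G. \<phi> g -` A = A) \<longrightarrow> prob A = 0 \<or> prob A = 1"
      using erg unfolding ergodic_measures_def by simp
    then show ?thesis using U inv by metis
  qed
  ultimately have "prob U = 1" by linarith
  have "(\<lambda>r. prob (\<Union>i<r. \<phi> (a i) -` A)) \<longlonglongrightarrow> prob (\<Union>r. \<Union>i<r. \<phi> (a i) -` A)"
  proof (rule finite_Lim_measure_incseq)
    show "range (\<lambda>r. \<Union>i<r. \<phi> (a i) -` A) \<subseteq> sets \<mu>" using ev by (auto simp: sets_mu)
    show "incseq (\<lambda>r. \<Union>i<r. \<phi> (a i) -` A)" by (intro incseq_SucI UN_mono) auto
  qed
  moreover have "(\<Union>r. \<Union>i<r. \<phi> (a i) -` A) = U" by (auto simp: U_def)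
  ultimately have "\<forall>\<^sub>F r in sequentially. 1 - t < prob (\<Union>i<r. \<phi> (a i) -` A)"
    using \<open>prob U = 1\<close> t by (intro order_tendstoD(1)) auto
  then obtain r where "1 - t < prob (\<Union>i<r. \<phi> (a i) -` A)" by (auto dest!: eventually_happens)
  moreover have "prob (UNIV - (\<Union>i<r. \<phi> (a i) -` A)) = 1 - prob (\<Union>i<r. \<phi> (a i) -` A)"
    using ev prob_compl[of "\<Union>i<r. \<phi> (a i) -` A"] by (simp add: sets_mu)
  ultimately show thesis using that[of a r] a by simp
qed

text \<open>Outside a set of small measure, being close forces equal names over the finite set \<open>K\<close>. The
  cells of \<open>\<alpha>\<close> are replaced by closed subsets, on whose union the label of the cell is continuous.\<close>

lemma separating_set:
  fixes \<delta> :: real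
  assumes \<alpha>: "finite \<alpha>" "\<alpha> \<subseteq> sets borel" "partition_on UNIV \<alpha>"
    and K: "finite K" "K \<subseteq> carrier G" and \<delta>: "\<delta> > 0"
  obtains \<epsilon> W where "\<epsilon> > 0" "W \<in> sets borel" "prob (UNIV - W) \<le> card K * \<delta>"
    "\<And>x y k. x \<in> W \<Longrightarrow> y \<in> W \<Longrightarrow> dist x y < \<epsilon> \<Longrightarrow> k \<in> K \<Longrightarrow> cell \<alpha> (\<phi> k x) = cell \<alpha> (\<phi> k y)"
proof -
  have c: "card \<alpha> > 0" using \<alpha> by (metis Union_empty UNIV_not_empty card_gt_0_iff partition_onD1)
  have "\<forall>A\<in>\<alpha>. \<exists>C. closed C \<and> C \<subseteq> A \<and> prob (A - C) < \<delta> / card \<alpha>"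
  proof
    fix A assume "A \<in> \<alpha>"
    then have A: "A \<in> sets borel" using \<alpha> by blast
    show "\<exists>C. closed C \<and> C \<subseteq> A \<and> prob (A - C) < \<delta> / card \<alpha>"
      using inner_regular_closed[OF finite_measure_axioms sets_mu A, of "\<delta> / card \<alpha>"] c \<delta> by (metis divide_pos_pos of_nat_0_less_iff)
  qed
  then obtain C where C: "\<And>A. A \<in> \<alpha> \<Longrightarrow> closed (C A)" "\<And>A. A \<in> \<alpha> \<Longrightarrow> C A \<subseteq> A"
    "\<And>A. A \<in> \<alpha> \<Longrightarrow> prob (A - C A) < \<delta> / card \<alpha>" by metis
  define D where "D = (\<Union>A\<in>\<alpha>. C A)"
  have D: "closed D" unfolding D_def using \<alpha> C by (intro closed_UN) auto
  have "prob (UNIV - D) \<le> prob (\<Union>A\<in>\<alpha>. A - C A)"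
  proof (rule finite_measure_mono)
    show "UNIV - D \<subseteq> (\<Union>A\<in>\<alpha>. A - C A)" using cell_in[OF \<alpha>(3)] by (auto simp: D_def)
    show "(\<Union>A\<in>\<alpha>. A - C A) \<in> events" using \<alpha> C by (auto simp: sets_mu intro!: sets.finite_UN)
  qed
  also have "\<dots> \<le> (\<Sum>A\<in>\<alpha>. prob (A - C A))"
    using \<alpha> C by (intro finite_measure_subadditive_finite) (auto simp: sets_mu)
  also have "\<dots> \<le> (\<Sum>A\<in>\<alpha>. \<delta> / card \<alpha>)" using C(3) by (intro sum_mono less_imp_le) auto
  also have "\<dots> = \<delta>" using c by simp
  finally have D\<delta>: "prob (UNIV - D) \<le> \<delta>" .
  obtain f :: "'x set \<Rightarrow> nat" where f: "inj_on f \<alpha>" using \<alpha>(1) finite_imp_inj_to_nat_seg by metis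
  have cont_f: "continuous_on D (\<lambda>x. real (f (cell \<alpha> x)))"
    unfolding D_def
  proof (rule continuous_on_closed_Union)
    fix A assume A: "A \<in> \<alpha>"
    have "continuous_on (C A) (\<lambda>x. real (f A))" by (rule continuous_on_const)
    moreover have "cell \<alpha> x = A" if "x \<in> C A" for x using cell_eq[OF \<alpha>(3) A] C(2)[OF A] that by blast
    ultimately show "continuous_on (C A) (\<lambda>x. real (f (cell \<alpha> x)))"
      by (simp cong: continuous_on_cong)
  qed (use \<alpha> C in auto)
  define W where "W = (\<Inter>k\<in>K. \<phi> k -` D)"
  have preD: "closed (\<phi> k -` D)" if "k \<in> K" for k
    using that K by (intro closed_vimage D cont) auto
  have W: "closed W" unfolding W_def using preD by (intro closed_INT) auto
  have cW: "compact W" using compact_UNIV W by (metis compact_Int_closed inf_top_left)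
  have "\<exists>e>0. \<forall>x\<in>W. \<forall>y\<in>W. dist x y < e \<longrightarrow> cell \<alpha> (\<phi> k x) = cell \<alpha> (\<phi> k y)" if k: "k \<in> K" for k
  proof -
    have kc: "k \<in> carrier G" using k K by auto
    have sub: "\<phi> k ` W \<subseteq> D" using k by (auto simp: W_def)
    have "continuous_on W (\<lambda>x. real (f (cell \<alpha> (\<phi> k x))))"
      using continuous_on_compose2[OF cont_f continuous_on_subset[OF cont[OF kc] subset_UNIV[of W]] sub] by simp
    then have "uniformly_continuous_on W (\<lambda>x. real (f (cell \<alpha> (\<phi> k x))))"
      using cW by (rule compact_uniformly_continuous)
    then obtain e where e: "e > 0" "\<forall>x\<in>W. \<forall>y\<in>W. dist y x < e \<longrightarrow>
        dist (real (f (cell \<alpha> (\<phi> k y)))) (real (f (cell \<alpha> (\<phi> k x)))) < 1"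
      unfolding uniformly_continuous_on_def by (meson zero_less_one)
    have "cell \<alpha> (\<phi> k x) = cell \<alpha> (\<phi> k y)" if "x \<in> W" "y \<in> W" "dist x y < e" for x y
    proof -
      have "dist (real (f (cell \<alpha> (\<phi> k x)))) (real (f (cell \<alpha> (\<phi> k y)))) < 1" using e that by blast
      then have "f (cell \<alpha> (\<phi> k x)) = f (cell \<alpha> (\<phi> k y))" by (simp add: dist_real_def)
      then show ?thesis using f cell_in(1)[OF \<alpha>(3)] by (auto dest: inj_onD)
    qed
    with e(1) show ?thesis by blast
  qed
  then obtain e where e: "\<And>k. k \<in> K \<Longrightarrow> e k > 0"
    "\<And>k x y. k \<in> K \<Longrightarrow> x \<in> W \<Longrightarrow> y \<in> W \<Longrightarrow> dist x y < e k \<Longrightarrow> cell \<alpha> (\<phi> k x) = cell \<alpha> (\<phi> k y)"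
    by metis
  define \<epsilon> where "\<epsilon> = Min (insert 1 (e ` K))"
  show thesis
  proof (rule that)
    show "\<epsilon> > 0" using e(1) K unfolding \<epsilon>_def by (subst Min_gr_iff) auto
    show "W \<in> sets borel" using W by simp
    have "prob (UNIV - W) \<le> prob (\<Union>k\<in>K. \<phi> k -` (UNIV - D))"
      using K D act_measurable by (intro finite_measure_mono) (auto simp: W_def sets_mu intro!: sets.finite_UN)
    also have "\<dots> \<le> (\<Sum>k\<in>K. prob (\<phi> k -` (UNIV - D)))"
      using K D act_measurable by (intro finite_measure_subadditive_finite) (auto simp: sets_mu)
    also have "\<dots> = (\<Sum>k\<in>K. prob (UNIV - D))"
      using K D by (intro sum.cong refl invariant) auto
    also have "\<dots> \<le> card K * \<delta>" using D\<delta> by (simp add: mult_left_mono)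
    finally show "prob (UNIV - W) \<le> card K * \<delta>" .
    fix x y k assume *: "x \<in> W" "y \<in> W" "dist x y < \<epsilon>" "k \<in> K"
    have "\<epsilon> \<le> e k" unfolding \<epsilon>_def using K * by (intro Min_le) auto
    then show "cell \<alpha> (\<phi> k x) = cell \<alpha> (\<phi> k y)" using e(2) * by force
  qed
qed

end

section \<open>Entropy of names over Folner sets\<close>

context ergodic_system
begin

text \<open>The translate of the window \<open>K\<close> to the position \<open>g\<close>.\<close>

abbreviation block :: "'g set \<Rightarrow> 'g \<Rightarrow> 'g set" where
  "block K g \<equiv> (\<lambda>k. k \<otimes> g) ` K"

lemma simple_name:
  assumes \<alpha>: "finite \<alpha>" "\<alpha> \<subseteq> sets borel" "partition_on UNIV \<alpha>" and E: "finite E" "E \<subseteq> carrier G"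
  shows "simple_function \<mu> (name \<phi> \<alpha> E)"
  unfolding simple_function_def
proof (intro conjI ballI)
  show "finite (name \<phi> \<alpha> E ` space \<mu>)"
    using name_range[OF \<alpha>(3), of \<phi> E] \<alpha> E finite_PiE[of E "\<lambda>_. \<alpha>"] by (auto intro: finite_subset)
  fix b assume "b \<in> name \<phi> \<alpha> E ` space \<mu>"
  then obtain x where b: "b = name \<phi> \<alpha> E x" by auto
  have "name \<phi> \<alpha> E -` {b} \<inter> space \<mu> = (\<Inter>g\<in>E. \<phi> g -` cell \<alpha> (\<phi> g x))"
    unfolding b using cell_eq[OF \<alpha>(3) cell_in(1)[OF \<alpha>(3)]] cell_in(2)[OF \<alpha>(3)]
    by (auto simp: name_eq_iff) metis
  also have "\<dots> \<in> sets \<mu>"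
  proof (cases "E = {}")
    case False
    then show ?thesis using E \<alpha>(2) cell_in(1)[OF \<alpha>(3)]
      by (intro sets.finite_INT) (auto simp: sets_mu intro!: act_measurable)
  qed (simp add: sets_mu)
  finally show "name \<phi> \<alpha> E -` {b} \<inter> space \<mu> \<in> sets \<mu>" .
qed

lemma subalgebra_fibres:
  assumes "continuous_on UNIV \<pi>"
  shows "subalgebra \<mu> (vimage_algebra UNIV \<pi> borel)"
  unfolding subalgebra_def
proof
  have "\<pi> \<in> borel_measurable borel" using assms by (rule borel_measurable_continuous_onI)
  then show "sets (vimage_algebra UNIV \<pi> borel) \<subseteq> sets \<mu>"
    by (auto simp: sets_vimage_algebra2 sets_mu dest: measurable_sets_borel)
qed simp

lemma rel_entropy_partition_names:
  assumes \<alpha>: "partition_on UNIV \<alpha>"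
  shows "rel_entropy_partition \<mu> (common_refinement ((\<lambda>g. (\<lambda>A. \<phi> g -` A) ` \<alpha>) ` E)) \<pi> =
    (\<Sum>b\<in>name \<phi> \<alpha> E ` space \<mu>. \<integral>x. eta (real_cond_exp \<mu> (vimage_algebra UNIV \<pi> borel)
        (indicator (name \<phi> \<alpha> E -` {b} \<inter> space \<mu>)) x) \<partial>\<mu>)"
  unfolding rel_entropy_partition_def sum_common_refinement[OF \<alpha>] by (simp add: eta_def)

text \<open>The entropy of a partition is defined by \<open>lim\<close>, whose value is unspecified for divergent
  sequences. Existence of the limit is not needed: were the entropies \<open>o(card (F m))\<close>, the limit
  would exist and be zero.\<close>

lemma positive_entropy_partition:
  assumes \<pi>: "continuous_on UNIV \<pi>" and pos: "rel_entropy \<phi> F \<mu> \<pi> > 0"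
  obtains \<alpha> and c :: real where "finite \<alpha>" "\<alpha> \<subseteq> sets borel" "partition_on UNIV \<alpha>" "c > 0"
    "\<exists>\<^sub>\<infinity>m. c * card (F m) < rel_entropy_partition \<mu> (common_refinement ((\<lambda>g. (\<lambda>A. \<phi> g -` A) ` \<alpha>) ` F m)) \<pi>"
proof -
  from pos obtain \<alpha> where \<alpha>: "finite \<alpha>" "\<alpha> \<subseteq> sets borel" "partition_on UNIV \<alpha>"
    and "rel_entropy_wrt \<phi> F \<mu> \<alpha> \<pi> > 0"
    unfolding rel_entropy_def less_SUP_iff by auto
  define H where "H m = rel_entropy_partition \<mu> (common_refinement ((\<lambda>g. (\<lambda>A. \<phi> g -` A) ` \<alpha>) ` F m)) \<pi>" for m
  have lim: "lim (\<lambda>m. H m / card (F m)) > 0"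
    using \<open>rel_entropy_wrt \<phi> F \<mu> \<alpha> \<pi> > 0\<close> by (simp add: rel_entropy_wrt_def H_def)
  have H0: "0 \<le> H m" for m
  proof -
    have "0 \<le> (\<integral>x. eta (real_cond_exp \<mu> (vimage_algebra UNIV \<pi> borel)
        (indicator (name \<phi> \<alpha> (F m) -` {b} \<inter> space \<mu>)) x) \<partial>\<mu>)" for b
      by (rule cond_exp_entropy_nonneg[OF subalgebra_fibres[OF \<pi>] vimage_event[OF simple_name[OF \<alpha> F(1,3)]]])
    then show ?thesis
      unfolding H_def rel_entropy_partition_names[OF \<alpha>(3)] by (rule sum_nonneg)
  qed
  have "\<exists>c>0::real. \<exists>\<^sub>\<infinity>m. c * card (F m) < H m"
  proof (rule ccontr)
    assume *: "\<not> ?thesis"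
    have "(\<lambda>m. H m / card (F m)) \<longlonglongrightarrow> 0"
    proof (rule LIMSEQ_I)
      fix e :: real assume e: "e > 0"
      then have "e / 2 > 0" by simp
      have "\<not> (\<exists>\<^sub>\<infinity>m. e / 2 * card (F m) < H m)"
      proof
        assume "\<exists>\<^sub>\<infinity>m. e / 2 * card (F m) < H m"
        with \<open>e / 2 > 0\<close> have "\<exists>c>0::real. \<exists>\<^sub>\<infinity>m. c * card (F m) < H m" by (intro exI[of _ "e / 2"] conjI)
        with * show False by (rule notE)
      qed
      then obtain m0 where m0: "\<And>m. m \<ge> m0 \<Longrightarrow> H m \<le> e / 2 * card (F m)"
        by (auto simp: INFM_nat_le not_less)
      have "norm (H m / card (F m) - 0) < e" if "m \<ge> m0" for m
      proof -
        have "H m / card (F m) \<le> e / 2" using m0[OF that] card_F_pos[of m] by (simp only: divide_le_eq) simp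
        also have "\<dots> < e" using e by simp
        finally show ?thesis using H0[of m] by (simp del: divide_le_eq_numeral1 times_divide_eq_left)
      qed
      then show "\<exists>m0. \<forall>m\<ge>m0. norm (H m / card (F m) - 0) < e" by (intro exI[of _ m0] allI impI)
    qed
    then show False using lim by (simp add: limI)
  qed
  then obtain c :: real where "c > 0" "\<exists>\<^sub>\<infinity>m. c * card (F m) < H m" by (elim exE conjE)
  then show thesis unfolding H_def by (rule that[OF \<alpha>])
qed

text \<open>The entropy of the name over \<open>F m\<close> is controlled by the average entropy of the names over the
  translates of \<open>K\<close> to the points of \<open>F m\<close>. This is Shearer's inequality for the translates of \<open>K\<close>
  that meet \<open>F m\<close>, each point of \<open>F m\<close> lying in \<open>card K\<close> of them; those based outside \<open>F m\<close> are few
  because \<open>F m\<close> is almost invariant.\<close>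

lemma block_entropy:
  assumes \<alpha>: "finite \<alpha>" "\<alpha> \<subseteq> sets borel" "partition_on UNIV \<alpha>" and z: "simple_function \<mu> z"
    and K: "finite K" "K \<subseteq> carrier G"
  shows "card K * (ent \<mu> (\<lambda>x. (name \<phi> \<alpha> (F m) x, z x)) - ent \<mu> z) \<le>
    (\<Sum>g\<in>F m. ent \<mu> (\<lambda>x. (name \<phi> \<alpha> (block K g) x, z x)) - ent \<mu> z)
    + (\<Sum>k\<in>K. card (sym_diff (inv k <# F m) (F m))) * ln (real (card \<alpha> ^ card K))"
proof -
  define h where "h E = ent \<mu> (\<lambda>x. (name \<phi> \<alpha> E x, z x))" for E
  have sn: "simple_function \<mu> (name \<phi> \<alpha> E)" if "finite E" "E \<subseteq> carrier G" for E
    using simple_name[OF \<alpha> that] .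
  have sp: "simple_function \<mu> (\<lambda>x. (name \<phi> \<alpha> E x, z x))" if "finite E" "E \<subseteq> carrier G" for E
    using simple_function_Pair[OF sn[OF that] z] .
  have h_mono: "h A \<le> h B" if "A \<subseteq> B" "finite B" "B \<subseteq> carrier G" for A B
    unfolding h_def using that by (intro ent_mono sp) (auto simp: name_eq_iff)
  have h_empty: "h {} = ent \<mu> z"
    unfolding h_def by (rule ent_cong[OF sp]) (auto simp: name_eq_iff)
  have h_le: "h E - h {} \<le> ln (real (card \<alpha> ^ card K))" if "E \<subseteq> block K g" "g \<in> carrier G" for E g
  proof -
    have E: "finite E" "E \<subseteq> carrier G" using that K by (auto intro: finite_subset)
    have "card E \<le> card (block K g)" using that K by (intro card_mono) auto
    also have "\<dots> \<le> card K" by (rule card_image_le[OF K(1)])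
    finally have "card E \<le> card K" .
    have "card \<alpha> \<ge> 1" using \<alpha> by (metis One_nat_def Suc_leI Union_empty UNIV_not_empty card_gt_0_iff partition_onD1)
    then have "card \<alpha> ^ card E \<le> card \<alpha> ^ card K" using \<open>card E \<le> card K\<close> by (rule power_increasing[rotated])
    moreover have "card (name \<phi> \<alpha> E ` space \<mu>) \<le> card \<alpha> ^ card E"
      using card_name_range[OF \<alpha>(3,1) E(1)] by simp
    ultimately show ?thesis
      unfolding h_empty unfolding h_def by (intro ent_pair_le sn E z) simp
  qed
  define I where "I = (\<lambda>(k, f). inv k \<otimes> f) ` (K \<times> F m)"
  have I: "finite I" "I \<subseteq> carrier G" using K F(1)[of m] F(3)[of m] by (auto simp: I_def subset_iff)
  have "real (card K) * (h (F m) - h {}) \<le> (\<Sum>g\<in>I. h (block K g \<inter> F m) - h {})"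
  proof (rule shearer_inequality[where U = "carrier G"])
    fix A B f assume AB: "A \<subseteq> B" "finite B" "B \<subseteq> carrier G" "f \<in> carrier G - B"
    have A: "finite A" "A \<subseteq> carrier G" using AB finite_subset by auto
    have f: "f \<in> carrier G" using AB by simp
    have sf: "simple_function \<mu> (name \<phi> \<alpha> {f})" using f by (intro sn) auto
    have "ent \<mu> (\<lambda>x. (name \<phi> \<alpha> {f} x, name \<phi> \<alpha> B x, name \<phi> \<alpha> A x, z x)) + ent \<mu> (\<lambda>x. (name \<phi> \<alpha> A x, z x))
      \<le> ent \<mu> (\<lambda>x. (name \<phi> \<alpha> {f} x, name \<phi> \<alpha> A x, z x)) + ent \<mu> (\<lambda>x. (name \<phi> \<alpha> B x, name \<phi> \<alpha> A x, z x))"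
      by (rule ent_submodular[OF sf sn[OF AB(2,3)] sp[OF A]])
    moreover have "h (insert f B) = ent \<mu> (\<lambda>x. (name \<phi> \<alpha> {f} x, name \<phi> \<alpha> B x, name \<phi> \<alpha> A x, z x))"
      unfolding h_def using AB f by (intro ent_cong sp) (auto simp: name_eq_iff)
    moreover have "h (insert f A) = ent \<mu> (\<lambda>x. (name \<phi> \<alpha> {f} x, name \<phi> \<alpha> A x, z x))"
      unfolding h_def using A f by (intro ent_cong sp) (auto simp: name_eq_iff)
    moreover have "h B = ent \<mu> (\<lambda>x. (name \<phi> \<alpha> B x, name \<phi> \<alpha> A x, z x))"
      unfolding h_def using AB by (intro ent_cong sp) (auto simp: name_eq_iff)
    ultimately show "h (insert f B) + h A \<le> h (insert f A) + h B" by (simp add: h_def)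
  next
    fix f assume f: "f \<in> F m"
    then have fc: "f \<in> carrier G" using F by blast
    have "{g \<in> I. f \<in> block K g} = (\<lambda>k. inv k \<otimes> f) ` K"
    proof (intro equalityI subsetI)
      fix g assume "g \<in> {g \<in> I. f \<in> block K g}"
      then obtain k where k: "g \<in> carrier G" "k \<in> K" "f = k \<otimes> g" using I by auto
      then have "g = inv k \<otimes> f" using K by (simp add: inv_solve_left subset_iff)
      then show "g \<in> (\<lambda>k. inv k \<otimes> f) ` K" using k by blast
    next
      fix g assume "g \<in> (\<lambda>k. inv k \<otimes> f) ` K"
      then obtain k where k: "k \<in> K" "g = inv k \<otimes> f" by blast
      then have "f = k \<otimes> g" using K fc by (simp add: m_assoc[symmetric] subset_iff)
      then show "g \<in> {g \<in> I. f \<in> block K g}" using k f by (auto simp: I_def)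
    qed
    moreover have "inj_on (\<lambda>k. inv k \<otimes> f) K"
      using K fc by (intro inj_onI) (metis inv_closed inv_inv right_cancel subsetD)
    ultimately show "card {g \<in> I. f \<in> block K g} = card K" by (simp add: card_image)
  qed (use F I in auto)
  also have "\<dots> = (\<Sum>g\<in>I \<inter> F m. h (block K g \<inter> F m) - h {}) + (\<Sum>g\<in>I - F m. h (block K g \<inter> F m) - h {})"
    by (rule sum.Int_Diff[OF I(1)])
  also have "(\<Sum>g\<in>I \<inter> F m. h (block K g \<inter> F m) - h {}) \<le> (\<Sum>g\<in>F m. h (block K g) - h {})"
  proof -
    have bl: "finite (block K g)" "block K g \<subseteq> carrier G" if "g \<in> F m" for g
      using that K F(3)[of m] by (auto simp: subset_iff)
    have "(\<Sum>g\<in>I \<inter> F m. h (block K g \<inter> F m) - h {}) \<le> (\<Sum>g\<in>I \<inter> F m. h (block K g) - h {})"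
      using bl by (intro sum_mono diff_right_mono h_mono) auto
    also have "\<dots> \<le> (\<Sum>g\<in>F m. h (block K g) - h {})"
      using bl F by (intro sum_mono2) (auto intro!: h_mono)
    finally show ?thesis .
  qed
  also have "(\<Sum>g\<in>I - F m. h (block K g \<inter> F m) - h {}) \<le> (\<Sum>g\<in>I - F m. ln (real (card \<alpha> ^ card K)))"
  proof (rule sum_mono)
    fix g assume "g \<in> I - F m"
    then show "h (block K g \<inter> F m) - h {} \<le> ln (real (card \<alpha> ^ card K))"
      using I by (intro h_le[of _ g]) auto
  qed
  also have "\<dots> \<le> (\<Sum>k\<in>K. card (sym_diff (inv k <# F m) (F m))) * ln (real (card \<alpha> ^ card K))"
  proof -
    have "I - F m \<subseteq> (\<Union>k\<in>K. sym_diff (inv k <# F m) (F m))"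
      by (auto simp: I_def l_coset_def)
    moreover have "finite (\<Union>k\<in>K. sym_diff (inv k <# F m) (F m))" using K F by (auto simp: l_coset_def)
    ultimately have "card (I - F m) \<le> card (\<Union>k\<in>K. sym_diff (inv k <# F m) (F m))" by (rule card_mono[rotated])
    also have "\<dots> \<le> (\<Sum>k\<in>K. card (sym_diff (inv k <# F m) (F m)))" using K by (intro card_UN_le)
    finally have "real (card (I - F m)) \<le> real (\<Sum>k\<in>K. card (sym_diff (inv k <# F m) (F m)))"
      by (rule of_nat_mono)
    moreover have "0 \<le> ln (real (card \<alpha> ^ card K))"
    proof -
      have "card \<alpha> \<ge> 1" using \<alpha> by (metis One_nat_def Suc_leI Union_empty UNIV_not_empty card_gt_0_iff partition_onD1)
      then show ?thesis by (intro ln_ge_zero) (simp add: one_le_power)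
    qed
    ultimately show ?thesis unfolding sum_constant by (rule mult_right_mono)
  qed
  finally show ?thesis unfolding h_empty by (simp add: h_def)
qed

end

section \<open>Separated tuples in the cells of finite partitions\<close>

text \<open>A compact metric space has finite Borel partitions into cells of diameter less than \<open>e\<close>.\<close>

lemma fine_partition:
  assumes "compact (UNIV :: 'y::metric_space set)" and e: "e > 0"
  obtains q :: "'y::metric_space \<Rightarrow> nat" where "finite (range q)" "\<And>i. q -` {i} \<in> sets borel"
    "\<And>y y'. q y = q y' \<Longrightarrow> dist y y' < e"
proof -
  obtain C :: "'y set" where C: "finite C" "UNIV \<subseteq> (\<Union>c\<in>C. ball c (e / 2))"
    using assms unfolding compact_eq_totally_bounded by (meson half_gt_zero)
  obtain cs where cs: "set cs = C" using finite_list[OF C(1)] by blast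
  define P where "P y i \<longleftrightarrow> i < length cs \<and> y \<in> ball (cs ! i) (e / 2)" for y i
  have ex: "\<exists>i. P y i" for y
  proof -
    obtain c where "c \<in> C" "y \<in> ball c (e / 2)" using C(2) by blast
    then show ?thesis unfolding P_def by (metis cs in_set_conv_nth)
  qed
  define q where "q y = (LEAST i. P y i)" for y
  have q: "P y (q y)" for y unfolding q_def using ex by (rule LeastI_ex)
  have q_less: "\<not> P y j" if "j < q y" for y j using that unfolding q_def by (rule not_less_Least)
  show thesis
  proof (rule that)
    have "range q \<subseteq> {..<length cs}" using q by (auto simp: P_def)
    then show "finite (range q)" by (rule finite_subset) simp
    fix i
    have P_borel: "{y. P y j} \<in> sets borel" for j
    proof -
      have "{y. P y j} = (if j < length cs then ball (cs ! j) (e / 2) else {})" by (auto simp: P_def)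
      then show ?thesis by simp
    qed
    have "q -` {i} = {y. P y i} - (\<Union>j<i. {y. P y j})"
    proof (intro equalityI subsetI)
      fix y assume "y \<in> q -` {i}"
      then show "y \<in> {y. P y i} - (\<Union>j<i. {y. P y j})" using q[of y] q_less[of _ y] by auto
    next
      fix y assume y: "y \<in> {y. P y i} - (\<Union>j<i. {y. P y j})"
      then have "q y = i" unfolding q_def by (intro Least_equality) (auto simp: not_le[symmetric])
      then show "y \<in> q -` {i}" by simp
    qed
    then show "q -` {i} \<in> sets borel" using P_borel by auto
  next
    fix y y' assume eq: "q y = q y'"
    have "dist (cs ! q y) y < e / 2" "dist (cs ! q y) y' < e / 2"
      using q[of y] q[of y'] eq by (auto simp: P_def)
    then show "dist y y' < e" by (metis dist_commute dist_triangle_half_r)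
  qed
qed

lemma tendsto_Min_image:
  fixes f :: "'a \<Rightarrow> 'b \<Rightarrow> real"
  assumes "finite P" "P \<noteq> {}" "\<And>p. p \<in> P \<Longrightarrow> (f p \<longlongrightarrow> l p) Q"
  shows "((\<lambda>x. Min ((\<lambda>p. f p x) ` P)) \<longlongrightarrow> Min (l ` P)) Q"
  using assms
proof (induction P rule: finite_ne_induct)
  case (insert p P)
  then have "((\<lambda>x. min (f p x) (Min ((\<lambda>p. f p x) ` P))) \<longlongrightarrow> min (l p) (Min (l ` P))) Q"
    by (intro tendsto_min) auto
  then show ?case using insert by simp
qed simp

context ergodic_system
begin

text \<open>The tuples that, for at least a proportion \<open>\<theta>\<close> of the \<open>g\<close> in \<open>F m\<close>, have pairwise distinct
  names over the translate of \<open>K\<close> to \<open>g\<close>, while all their points are translated by \<open>g\<close> into \<open>W\<close>.\<close>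

definition many_distinct :: "'x set set \<Rightarrow> 'g set \<Rightarrow> 'x set \<Rightarrow> nat \<Rightarrow> real \<Rightarrow> nat \<Rightarrow> (nat \<Rightarrow> 'x) set" where
  "many_distinct \<alpha> K W n \<theta> m = {x \<in> space (\<Pi>\<^sub>M i\<in>{1..n}. \<mu>). \<theta> * card (F m) \<le>
      card {g\<in>F m. x \<in> distinct_names \<mu> (name \<phi> \<alpha> (block K g)) (\<phi> g -` W) n}}"

text \<open>The window \<open>K\<close> is so large that \<open>log n\<close> is a small part of the entropy \<open>c * card K\<close> of a name
  over \<open>K\<close>. For any partition with labels \<open>d \<le> r\<close>, where the cells with \<open>d < r\<close> are usable and
  the remaining one has measure at most \<open>t\<close>, and any partition \<open>q\<close> that is measurable over the factor, tuples from the usable cells of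
  the joint partition belong to \<open>many_distinct\<close> with probability at least \<open>\<theta>\<close>. The constants do
  not depend on \<open>d\<close> and \<open>q\<close>; the number \<open>r\<close> of labels only delays the admissible \<open>m\<close>, and the
  infinite set of admissible \<open>m\<close> does not depend on \<open>q\<close>.\<close>

lemma distinct_tuples_frequent:
  fixes c :: real
  assumes \<pi>: "continuous_on UNIV \<pi>"
    and \<alpha>: "finite \<alpha>" "\<alpha> \<subseteq> sets borel" "partition_on UNIV \<alpha>" and c: "c > 0"
    and large: "\<exists>\<^sub>\<infinity>m. c * card (F m) < rel_entropy_partition \<mu> (common_refinement ((\<lambda>g. (\<lambda>A. \<phi> g -` A) ` \<alpha>) ` F m)) \<pi>"
    and n: "1 \<le> n"
  obtains K \<epsilon> W \<theta> t where "K \<subseteq> carrier G" "\<epsilon> > 0" "\<theta> > 0" "t > 0"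
    "\<And>x y k. x \<in> W \<Longrightarrow> y \<in> W \<Longrightarrow> dist x y < \<epsilon> \<Longrightarrow> k \<in> K \<Longrightarrow> cell \<alpha> (\<phi> k x) = cell \<alpha> (\<phi> k y)"
    "\<And>m. many_distinct \<alpha> K W n \<theta> m \<in> sets (\<Pi>\<^sub>M i\<in>{1..n}. \<mu>)"
    "\<And>(d :: 'x \<Rightarrow> nat) r. range d \<subseteq> {..r} \<Longrightarrow> simple_function \<mu> d \<Longrightarrow> prob (d -` {r}) \<le> t \<Longrightarrow>
      \<exists>S. infinite S \<and> (\<forall>(q :: 'x \<Rightarrow> nat) m. m \<in> S \<longrightarrow> simple_function \<mu> q \<longrightarrow>
        (\<forall>i. q -` {i} \<in> sets (vimage_algebra UNIV \<pi> borel)) \<longrightarrow>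
        \<theta> \<le> cell_tuples \<mu> (\<lambda>x. (q x, d x)) {p \<in> range (\<lambda>x. (q x, d x)). snd p < r} n (many_distinct \<alpha> K W n \<theta> m))"
proof -
  define L where "L = ln (real (card \<alpha>))"
  have c\<alpha>: "card \<alpha> \<ge> 1" using \<alpha> by (metis One_nat_def Suc_leI Union_empty UNIV_not_empty card_gt_0_iff partition_onD1)
  have L0: "L \<ge> 0" using c\<alpha> by (simp add: L_def)
  have lnn: "ln (real n) \<ge> 0" using n by simp
  obtain M :: nat where "max 1 (8 * ln n / c) < real M" using reals_Archimedean2 by blast
  then have M: "1 \<le> M" "8 * ln n / c \<le> M" by auto
  have lnM: "ln n \<le> M * c / 8" using M(2) c by (simp add: field_simps)
  obtain K where K: "finite K" "K \<subseteq> carrier G" "card K = M"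
    using infinite_arbitrarily_large[OF infinite_G] by blast
  \<comment> \<open>\<open>L + 1\<close> and \<open>C + 1\<close> instead of \<open>L\<close> and \<open>C\<close> only avoid division by zero; the shares of \<open>c\<close> given to
    the error terms add up to less than \<open>c\<close>\<close>
  define t where "t = c / (16 * (L + 1))"
  have t: "t > 0" using c L0 by (simp add: t_def)
  have tL: "t * L \<le> c / 16" using c L0 by (simp add: t_def field_simps)
  have "t / M > 0" using t M by simp
  obtain \<epsilon> W where W: "\<epsilon> > 0" "W \<in> sets borel" "prob (UNIV - W) \<le> card K * (t / M)"
    "\<And>x y k. x \<in> W \<Longrightarrow> y \<in> W \<Longrightarrow> dist x y < \<epsilon> \<Longrightarrow> k \<in> K \<Longrightarrow> cell \<alpha> (\<phi> k x) = cell \<alpha> (\<phi> k y)"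
    using separating_set[OF \<alpha> K(1,2) \<open>t / M > 0\<close>] by metis
  have Wt: "prob (UNIV - W) \<le> t" using W(3) K(3) M by simp
  define N where "N = card \<alpha> ^ M"
  have N1: "1 \<le> N" using c\<alpha> by (simp add: N_def one_le_power)
  have lnN: "ln (real N) = M * L" using c\<alpha> by (simp add: N_def L_def ln_realpow)
  define C where "C = ln (real N) / (t / N) ^ n"
  have C0: "C \<ge> 0" using N1 t by (simp add: C_def)
  define \<theta> where "\<theta> = M * c / (8 * (C + 1))"
  have \<theta>: "\<theta> > 0" using M c C0 by (simp add: \<theta>_def)
  have C\<theta>: "C * (2 * \<theta>) \<le> M * c / 4"
  proof -
    have "C * (2 * \<theta>) = (C / (C + 1)) * (M * c / 4)" using C0 by (simp add: \<theta>_def field_simps)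
    also have "\<dots> \<le> 1 * (M * c / 4)" using C0 c by (intro mult_right_mono) auto
    finally show ?thesis by simp
  qed
  have bl: "finite (block K g)" "block K g \<subseteq> carrier G" if "g \<in> carrier G" for g
    using that K by (auto simp: subset_iff)
  have sname: "simple_function \<mu> (name \<phi> \<alpha> (block K g))" if "g \<in> carrier G" for g
    by (rule simple_name[OF \<alpha> bl[OF that]])
  have Wg: "\<phi> g -` W \<in> events" if "g \<in> carrier G" for g
    using act_measurable[OF that W(2)] by (simp add: sets_mu)
  have dn: "distinct_names \<mu> (name \<phi> \<alpha> (block K g)) (\<phi> g -` W) n \<in> sets (\<Pi>\<^sub>M i\<in>{1..n}. \<mu>)" if "g \<in> carrier G" for g
    by (rule distinct_names_sets[OF sname[OF that] Wg[OF that]])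
  \<comment> \<open>measurability does not involve the partition, so the trivial one serves\<close>
  have triv: "simple_function \<mu> (\<lambda>x. ())" by simp
  have md: "many_distinct \<alpha> K W n \<theta> m \<in> sets (\<Pi>\<^sub>M i\<in>{1..n}. \<mu>)" for m
    by (rule cell_tuples_markov(1)[OF triv empty_subsetI F(1,2) dn less_imp_le[OF \<theta>] many_distinct_def])
      (use F(3) in blast)
  define bd where "bd m = (\<Sum>k\<in>K. real (card (sym_diff (inv k <# F m) (F m))))" for m
  have bd: "(\<lambda>m. bd m / card (F m)) \<longlonglongrightarrow> 0"
  proof -
    have "(\<lambda>m. \<Sum>k\<in>K. real (card (sym_diff (inv k <# F m) (F m))) / card (F m)) \<longlonglongrightarrow> (\<Sum>k\<in>K. 0)"
      using K by (intro tendsto_sum folner_left inv_closed) auto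
    then show ?thesis by (simp add: bd_def sum_divide_distrib)
  qed
  show thesis
  proof (rule that[OF K(2) W(1) \<theta> t W(4) md])
    fix d :: "'x \<Rightarrow> nat" and r
    assume d: "range d \<subseteq> {..r}" "simple_function \<mu> d" "prob (d -` {r}) \<le> t"
    define H where "H m = rel_entropy_partition \<mu> (common_refinement ((\<lambda>g. (\<lambda>A. \<phi> g -` A) ` \<alpha>) ` F m)) \<pi>" for m
    have ev1: "\<forall>\<^sub>F m in sequentially. bd m / card (F m) < c / (16 * (L + 1))"
      using c L0 by (intro order_tendstoD(2)[OF bd]) simp
    have ev2: "\<forall>\<^sub>F m in sequentially. 16 * ln (real (Suc r)) / c \<le> card (F m)"
      using card_F_at_top by (simp add: filterlim_at_top)
    define S where "S = {m. c * card (F m) < H m \<and> bd m / card (F m) < c / (16 * (L + 1)) \<and>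
        16 * ln (real (Suc r)) / c \<le> card (F m)}"
    have "\<exists>\<^sub>\<infinity>m. (c * card (F m) < H m) \<and> bd m / card (F m) < c / (16 * (L + 1)) \<and>
        16 * ln (real (Suc r)) / c \<le> card (F m)"
      using large eventually_conj[OF ev1 ev2] unfolding H_def cofinite_eq_sequentially
      by (rule frequently_rev_mp[OF _ eventually_mono]) auto
    then have S: "infinite S" unfolding S_def frequently_cofinite by simp
    have "\<theta> \<le> cell_tuples \<mu> (\<lambda>x. (q x, d x)) {p \<in> range (\<lambda>x. (q x, d x)). snd p < r} n (many_distinct \<alpha> K W n \<theta> m)"
      if m: "m \<in> S" and q: "simple_function \<mu> q" "\<And>i. q -` {i} \<in> sets (vimage_algebra UNIV \<pi> borel)"
      for q :: "'x \<Rightarrow> nat" and m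
    proof (rule ccontr)
      define z where "z x = (q x, d x)" for x
      define J where "J = {p \<in> range z. snd p < r}"
      define nm where "nm = name \<phi> \<alpha> (F m)"
      define f where "f = real (card (F m))"
      \<comment> \<open>otherwise the blocks, and hence the whole name over \<open>F m\<close>, carry too little entropy\<close>
      assume "\<not> ?thesis"
      then have small: "cell_tuples \<mu> z J n (many_distinct \<alpha> K W n \<theta> m) < \<theta>"
        by (simp add: z_def[abs_def] J_def)
      have f0: "f > 0" using card_F_pos[of m] by (simp add: f_def)
      have z: "simple_function \<mu> z" unfolding z_def using simple_function_Pair[OF q(1) d(2)] .
      have J: "J \<subseteq> z ` space \<mu>" by (auto simp: J_def)
      have nm: "simple_function \<mu> nm" unfolding nm_def by (rule simple_name[OF \<alpha> F(1,3)])
      have "c * f < H m" using m by (simp add: S_def f_def)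
      also have "H m \<le> ent \<mu> (\<lambda>x. (nm x, q x)) - ent \<mu> q"
        unfolding H_def rel_entropy_partition_names[OF \<alpha>(3)] nm_def[symmetric]
        using q(2) by (intro sum_cond_exp_entropy_le subalgebra_fibres \<pi> nm q(1)) simp
      also have "ent \<mu> (\<lambda>x. (nm x, q x)) \<le> ent \<mu> (\<lambda>x. (nm x, z x))"
        by (rule ent_mono[OF simple_function_Pair[OF nm z]]) (auto simp: z_def)
      finally have 1: "c * f < (ent \<mu> (\<lambda>x. (nm x, z x)) - ent \<mu> z) + (ent \<mu> z - ent \<mu> q)" by simp
      have 2: "ent \<mu> z - ent \<mu> q \<le> ln (real (Suc r))"
      proof -
        have "ent \<mu> z = ent \<mu> (\<lambda>x. (d x, q x))" by (rule ent_cong[OF z]) (auto simp: z_def)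
        moreover have "card (d ` space \<mu>) \<le> Suc r" using card_mono[OF _ d(1)] by simp
        ultimately show ?thesis using ent_pair_le[OF d(2) q(1), of "Suc r"] by simp
      qed
      have 3: "16 * ln (real (Suc r)) \<le> c * f"
        using m c by (simp add: S_def f_def divide_le_eq mult.commute)
      have 4: "bd m * L \<le> c / 16 * f"
      proof -
        have "bd m \<le> c / (16 * (L + 1)) * f" using m f0 by (simp add: S_def f_def pos_divide_less_eq)
        then have "bd m * L \<le> c / (16 * (L + 1)) * f * L" using L0 by (rule mult_right_mono)
        also have "\<dots> = c / 16 * f * (L / (L + 1))" by simp
        also have "\<dots> \<le> c / 16 * f * 1" using L0 c f0 by (intro mult_left_mono) auto
        finally show ?thesis by simp
      qed
      define ct where "ct g = cell_tuples \<mu> z J n (distinct_names \<mu> (name \<phi> \<alpha> (block K g)) (\<phi> g -` W) n)" for g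
      have zJ: "prob {x \<in> space \<mu>. z x \<notin> J} \<le> t"
      proof -
        have "d x \<le> r" for x using d(1) by (auto simp: image_subset_iff)
        moreover have "z x \<in> J \<longleftrightarrow> d x < r" for x by (auto simp: J_def z_def)
        ultimately have "{x \<in> space \<mu>. z x \<notin> J} = d -` {r}" by (auto simp: order.order_iff_strict)
        then show ?thesis using d(3) by simp
      qed
      have local: "ent \<mu> (\<lambda>x. (name \<phi> \<alpha> (block K g) x, z x)) - ent \<mu> z \<le> ln n + 3 * t * (M * L) + C * ct g"
        if g: "g \<in> F m" for g
      proof -
        have gc: "g \<in> carrier G" using g F(3) by blast
        have "card (block K g) \<le> M" using card_image_le[OF K(1)] K(3) by simp
        then have "card \<alpha> ^ card (block K g) \<le> N"
          unfolding N_def using c\<alpha> by (rule power_increasing)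
        then have "card (name \<phi> \<alpha> (block K g) ` space \<mu>) \<le> N"
          using card_name_range[OF \<alpha>(3,1) bl(1)[OF gc], of \<phi>] by simp
        then have "ent \<mu> (\<lambda>x. (name \<phi> \<alpha> (block K g) x, z x)) - ent \<mu> z \<le> ln n
          + (t + prob (space \<mu> - \<phi> g -` W) + prob {x \<in> space \<mu>. z x \<notin> J}) * ln N + C * ct g"
          unfolding C_def ct_def using n t by (intro ent_le_distinct_names sname gc z Wg J)
        moreover have "prob (space \<mu> - \<phi> g -` W) \<le> t"
        proof -
          have "space \<mu> - \<phi> g -` W = \<phi> g -` (UNIV - W)" by auto
          then show ?thesis using invariant[OF gc, of "UNIV - W"] W(2) Wt by simp
        qed
        then have "(t + prob (space \<mu> - \<phi> g -` W) + prob {x \<in> space \<mu>. z x \<notin> J}) * ln N \<le> (t + t + t) * ln N"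
          using zJ N1 by (intro mult_right_mono add_mono) auto
        ultimately show ?thesis by (simp add: lnN)
      qed
      have ctsum: "(\<Sum>g\<in>F m. ct g) \<le> f * (2 * \<theta>)"
      proof -
        have "(\<Sum>g\<in>F m. ct g) \<le> card (F m) * cell_tuples \<mu> z J n (many_distinct \<alpha> K W n \<theta> m) + \<theta> * card (F m)"
          unfolding ct_def
          by (rule cell_tuples_markov(2)[OF z J F(1,2) dn less_imp_le[OF \<theta>] many_distinct_def])
            (use F(3) in blast)
        also have "\<dots> \<le> f * \<theta> + \<theta> * f"
          unfolding f_def using small by (intro add_right_mono mult_left_mono) auto
        finally show ?thesis by (simp add: algebra_simps)
      qed
      have "M * (ent \<mu> (\<lambda>x. (nm x, z x)) - ent \<mu> z) \<le>
        (\<Sum>g\<in>F m. ent \<mu> (\<lambda>x. (name \<phi> \<alpha> (block K g) x, z x)) - ent \<mu> z) + bd m * (M * L)"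
        using block_entropy[OF \<alpha> z K(1,2), of m] by (simp add: nm_def bd_def K(3) N_def[symmetric] lnN)
      also have "(\<Sum>g\<in>F m. ent \<mu> (\<lambda>x. (name \<phi> \<alpha> (block K g) x, z x)) - ent \<mu> z)
          \<le> (\<Sum>g\<in>F m. ln n + 3 * t * (M * L) + C * ct g)"
        by (intro sum_mono local)
      also have "\<dots> = f * ln n + f * (3 * M * (t * L)) + C * (\<Sum>g\<in>F m. ct g)"
        by (simp add: sum.distrib sum_distrib_left f_def algebra_simps)
      also have "\<dots> \<le> f * (M * c / 8) + f * (3 * M * (c / 16)) + C * (f * (2 * \<theta>))"
        using lnM tL ctsum f0 C0 by (intro add_mono mult_left_mono) auto
      also have "C * (f * (2 * \<theta>)) = f * (C * (2 * \<theta>))" by simp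
      also have "\<dots> \<le> f * (M * c / 4)" using C\<theta> f0 by (intro mult_left_mono) auto
      also have "bd m * (M * L) = M * (bd m * L)" by simp
      also have "\<dots> \<le> M * (c / 16 * f)" using 4 by (intro mult_left_mono) auto
      finally have "M * (ent \<mu> (\<lambda>x. (nm x, z x)) - ent \<mu> z) \<le> M * (f * c * (1/8 + 3/16 + 1/4 + 1/16))"
        by (simp add: algebra_simps)
      then have "ent \<mu> (\<lambda>x. (nm x, z x)) - ent \<mu> z \<le> f * c * (1/8 + 3/16 + 1/4 + 1/16)"
        using M(1) by simp
      moreover have "f * c > 0" using f0 c by simp
      ultimately show False using 1 2 3 by (simp add: algebra_simps)
    qed
    with S show "\<exists>S. infinite S \<and> (\<forall>(q :: 'x \<Rightarrow> nat) m. m \<in> S \<longrightarrow> simple_function \<mu> q \<longrightarrow>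
        (\<forall>i. q -` {i} \<in> sets (vimage_algebra UNIV \<pi> borel)) \<longrightarrow>
        \<theta> \<le> cell_tuples \<mu> (\<lambda>x. (q x, d x)) {p \<in> range (\<lambda>x. (q x, d x)). snd p < r} n (many_distinct \<alpha> K W n \<theta> m))"
      by (intro exI[of _ S] conjI allI impI) auto
  qed
qed

text \<open>The least distance between two of the points \<open>x 1\<close>, \<open>\<dots>\<close>, \<open>x n\<close> after translation by \<open>g\<close>; it is
  meaningful only for \<open>n\<close> at least \<open>2\<close>.\<close>

definition spread :: "nat \<Rightarrow> (nat \<Rightarrow> 'x) \<Rightarrow> 'g \<Rightarrow> real" where
  "spread n x g = Min {dist (\<phi> g (x i)) (\<phi> g (x j)) | i j. i \<in> {1..n} \<and> j \<in> {1..n} \<and> i \<noteq> j}"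

text \<open>The pairs of distinct indices between \<open>1\<close> and \<open>n\<close>.\<close>

definition index_pairs :: "nat \<Rightarrow> (nat \<times> nat) set" where
  "index_pairs n = {(i, j). i \<in> {1..n} \<and> j \<in> {1..n} \<and> i \<noteq> j}"

lemma index_pairs_finite_nonempty: "finite (index_pairs n)" "2 \<le> n \<Longrightarrow> index_pairs n \<noteq> {}"
proof -
  have "index_pairs n \<subseteq> {1..n} \<times> {1..n}" by (auto simp: index_pairs_def)
  then show "finite (index_pairs n)" by (rule finite_subset) simp
  show "index_pairs n \<noteq> {}" if "2 \<le> n"
  proof -
    have "(1, 2) \<in> index_pairs n" using that by (auto simp: index_pairs_def)
    then show ?thesis by blast
  qed
qed

lemma spread_alt: "spread n x g = Min ((\<lambda>p. dist (\<phi> g (x (fst p))) (\<phi> g (x (snd p)))) ` index_pairs n)"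
  unfolding spread_def by (rule arg_cong[of _ _ Min]) (force simp: index_pairs_def)

lemma spread_ge_iff:
  assumes "2 \<le> n"
  shows "e \<le> spread n x g \<longleftrightarrow> (\<forall>i\<in>{1..n}. \<forall>j\<in>{1..n}. i \<noteq> j \<longrightarrow> e \<le> dist (\<phi> g (x i)) (\<phi> g (x j)))"
  unfolding spread_alt using index_pairs_finite_nonempty assms by (subst Min_ge_iff) (auto simp: index_pairs_def)

lemma spread_le:
  assumes "i \<in> {1..n}" "j \<in> {1..n}" "i \<noteq> j"
  shows "spread n x g \<le> dist (\<phi> g (x i)) (\<phi> g (x j))"
  unfolding spread_alt using index_pairs_finite_nonempty(1) assms by (intro Min_le) (force simp: index_pairs_def)+

lemma spread_bounded:
  assumes "2 \<le> n"
  obtains B where "\<And>x g. \<bar>spread n x g\<bar> \<le> B"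
proof -
  obtain B where B: "\<And>y y' :: 'x. dist y y' \<le> B"
    using compact_imp_bounded[OF compact_UNIV] by (auto simp: bounded_two_points)
  have "\<bar>spread n x g\<bar> \<le> B" for x g
  proof -
    have "0 \<le> spread n x g" using spread_ge_iff[OF assms, of 0] by simp
    moreover have "spread n x g \<le> B" using spread_le[of 1 n 2 x g] assms B order_trans by fastforce
    ultimately show ?thesis by simp
  qed
  then show thesis using that by blast
qed

lemma tendsto_spread:
  assumes "2 \<le> n" "g \<in> carrier G" "\<And>i. i \<in> {1..n} \<Longrightarrow> (\<lambda>k. x k i) \<longlonglongrightarrow> y i"
  shows "(\<lambda>k. spread n (x k) g) \<longlonglongrightarrow> spread n y g"
  unfolding spread_alt
proof (rule tendsto_Min_image)
  fix p assume p: "p \<in> index_pairs n"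
  have "(\<lambda>k. \<phi> g (x k i)) \<longlonglongrightarrow> \<phi> g (y i)" if "i \<in> {1..n}" for i
    using continuous_on_tendsto_compose[OF cont[OF assms(2)] assms(3)[OF that]] by simp
  with p show "(\<lambda>k. dist (\<phi> g (x k (fst p))) (\<phi> g (x k (snd p)))) \<longlonglongrightarrow> dist (\<phi> g (y (fst p))) (\<phi> g (y (snd p)))"
    by (intro tendsto_dist) (auto simp: index_pairs_def)
qed (use index_pairs_finite_nonempty assms(1) in auto)

text \<open>Points of \<open>W\<close> with distinct names over \<open>K\<close> are at distance at least \<open>\<epsilon>\<close>.\<close>

lemma many_distinct_spread:
  assumes n: "2 \<le> n" and \<epsilon>: "\<epsilon> > 0"
    and sep: "\<And>x y k. x \<in> W \<Longrightarrow> y \<in> W \<Longrightarrow> dist x y < \<epsilon> \<Longrightarrow> k \<in> K \<Longrightarrow> cell \<alpha> (\<phi> k x) = cell \<alpha> (\<phi> k y)"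
    and K: "K \<subseteq> carrier G" and x: "x \<in> many_distinct \<alpha> K W n \<theta> m"
  shows "\<epsilon> * \<theta> \<le> (\<Sum>g\<in>F m. spread n x g) / card (F m)"
proof -
  let ?D = "{g\<in>F m. x \<in> distinct_names \<mu> (name \<phi> \<alpha> (block K g)) (\<phi> g -` W) n}"
  have far: "\<epsilon> \<le> spread n x g" if g: "g \<in> ?D" for g
    unfolding spread_ge_iff[OF n]
  proof (intro ballI impI)
    fix i j assume ij: "i \<in> {1..n}" "j \<in> {1..n}" "i \<noteq> j"
    have gc: "g \<in> carrier G" using g F(3) by blast
    have W: "\<phi> g (x i) \<in> W" "\<phi> g (x j) \<in> W"
      and inj: "inj_on (\<lambda>i. name \<phi> \<alpha> (block K g) (x i)) {1..n}"
      using g ij by (auto simp: distinct_names_def PiE_iff)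
    show "\<epsilon> \<le> dist (\<phi> g (x i)) (\<phi> g (x j))"
    proof (rule ccontr)
      assume "\<not> ?thesis"
      then have "cell \<alpha> (\<phi> k (\<phi> g (x i))) = cell \<alpha> (\<phi> k (\<phi> g (x j)))" if "k \<in> K" for k
        using sep[OF W _ that] by simp
      then have "name \<phi> \<alpha> (block K g) (x i) = name \<phi> \<alpha> (block K g) (x j)"
        using K gc by (auto simp: name_eq_iff act_mult subset_iff)
      then show False using inj_onD[OF inj _ ij(1,2)] ij(3) by simp
    qed
  qed
  have "\<epsilon> * (\<theta> * card (F m)) \<le> \<epsilon> * card ?D"
    using x \<epsilon> by (intro mult_left_mono) (auto simp: many_distinct_def)
  also have "\<dots> = (\<Sum>g\<in>?D. \<epsilon>)" by simp
  also have "\<dots> \<le> (\<Sum>g\<in>?D. spread n x g)" by (intro sum_mono far)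
  also have "\<dots> \<le> (\<Sum>g\<in>F m. spread n x g)"
    using F(1) spread_ge_iff[OF n, of 0] by (intro sum_mono2) auto
  finally show ?thesis using card_F_pos[of m] by (simp add: pos_le_divide_eq mult.assoc)
qed

text \<open>The labelling by the first of \<open>B 0\<close>, \<open>\<dots>\<close>, \<open>B (r - 1)\<close> containing the point, with the label \<open>r\<close>
  for points in none of them.\<close>

lemma least_hit_label:
  assumes B: "\<And>i. B i \<in> sets borel"
  obtains d :: "'x \<Rightarrow> nat" where "range d \<subseteq> {..r}" "simple_function \<mu> d" "d -` {r} = UNIV - (\<Union>i<r. B i)"
    "\<And>x. d x < r \<Longrightarrow> x \<in> B (d x)"
proof -
  define P where "P x i \<longleftrightarrow> i = r \<or> x \<in> B i" for x i
  define d where "d x = (LEAST i. P x i)" for x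
  have P: "P x (d x)" for x unfolding d_def by (rule LeastI[of _ r]) (simp add: P_def)
  have le: "d x \<le> i" if "P x i" for x i using that unfolding d_def by (rule Least_le)
  have ran: "range d \<subseteq> {..r}" using le by (auto simp: P_def)
  have Pb: "{x. P x i} \<in> sets borel" for i
  proof -
    have "{x. P x i} = (if i = r then UNIV else B i)" by (auto simp: P_def)
    then show ?thesis using B by simp
  qed
  have fib: "d -` {i} = {x. P x i} - (\<Union>j<i. {x. P x j})" for i
  proof (intro equalityI subsetI)
    fix x assume "x \<in> d -` {i}"
    then show "x \<in> {x. P x i} - (\<Union>j<i. {x. P x j})" using P[of x] le[of x] by (auto simp: not_le[symmetric])
  next
    fix x assume x: "x \<in> {x. P x i} - (\<Union>j<i. {x. P x j})"
    then have "d x = i" unfolding d_def by (intro Least_equality) (auto simp: not_le[symmetric])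
    then show "x \<in> d -` {i}" by simp
  qed
  have "simple_function \<mu> d"
    unfolding simple_function_def using ran Pb fib by (auto simp: sets_mu intro: finite_subset)
  moreover have "d -` {r} = UNIV - (\<Union>i<r. B i)" unfolding fib by (auto simp: P_def)
  moreover have "x \<in> B (d x)" if "d x < r" for x using P[of x] that by (auto simp: P_def)
  ultimately show thesis using that ran by blast
qed

end

section \<open>Sensitivity\<close>

context ergodic_system
begin

text \<open>Passage from cells to fibres. The space of the factor is partitioned into cells of diameter
  less than \<open>1 / (k + 1)\<close>. By \<open>charged_intersections\<close>, for infinitely many \<open>m\<close> jointly and any
  finite number of them at a time, there are tuples with large spread over \<open>F m\<close>, in a single
  usable set \<open>B i\<close>, and with images at distance less than \<open>1 / (k + 1)\<close>. A limit of such tuples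
  lies in one fibre and has large spread over all these \<open>F m\<close>.\<close>

lemma fibre_tuple_in_translate:
  fixes \<pi> :: "'x \<Rightarrow> 'y::metric_space"
  assumes \<pi>: "continuous_on UNIV \<pi>" and Y: "compact (UNIV :: 'y set)" and n: "2 \<le> n"
    and B: "\<And>i. closed (B i)"
    and d: "range (d :: 'x \<Rightarrow> nat) \<subseteq> {..r}" "simple_function \<mu> d" "\<And>x. d x < r \<Longrightarrow> x \<in> B (d x)"
    and E: "\<And>m. E m \<in> sets (\<Pi>\<^sub>M i\<in>{1..n}. \<mu>)" and S: "infinite S" and \<theta>: "0 < \<theta>"
    and charge: "\<And>(q :: 'x \<Rightarrow> nat) m. m \<in> S \<Longrightarrow> simple_function \<mu> q \<Longrightarrow>
        (\<And>i. q -` {i} \<in> sets (vimage_algebra UNIV \<pi> borel)) \<Longrightarrow>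
        \<theta> \<le> cell_tuples \<mu> (\<lambda>x. (q x, d x)) {p \<in> range (\<lambda>x. (q x, d x)). snd p < r} n (E m)"
    and spread: "\<And>x m. x \<in> E m \<Longrightarrow> \<eta> \<le> (\<Sum>g\<in>F m. spread n x g) / card (F m)"
  obtains l i where "i < r" "\<And>a. a \<in> {1..n} \<Longrightarrow> l a \<in> B i"
    "\<And>a b. a \<in> {1..n} \<Longrightarrow> b \<in> {1..n} \<Longrightarrow> \<pi> (l a) = \<pi> (l b)"
    "\<exists>\<^sub>\<infinity>m. \<eta> \<le> (\<Sum>g\<in>F m. spread n l g) / card (F m)"
proof -
  let ?S = "\<Pi>\<^sub>M i\<in>{1..n}. \<mu>"
  have "\<exists>q :: 'y \<Rightarrow> nat. finite (range q) \<and> (\<forall>i. q -` {i} \<in> sets borel) \<and>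
      (\<forall>y y'. q y = q y' \<longrightarrow> dist y y' < 1 / Suc k)" for k
  proof -
    obtain q :: "'y \<Rightarrow> nat" where "finite (range q)" "\<And>i. q -` {i} \<in> sets borel"
      "\<And>y y'. q y = q y' \<Longrightarrow> dist y y' < 1 / Suc k"
      by (rule fine_partition[OF Y, of "1 / Suc k"]) auto
    then show ?thesis by (intro exI[of _ q]) simp
  qed
  then obtain q :: "nat \<Rightarrow> 'y \<Rightarrow> nat" where q: "\<And>k. finite (range (q k))" "\<And>k i. q k -` {i} \<in> sets borel"
    "\<And>k y y'. q k y = q k y' \<Longrightarrow> dist y y' < 1 / Suc k"
    by metis
  have q\<pi>_sets: "(\<lambda>x. q k (\<pi> x)) -` {i} \<in> sets (vimage_algebra UNIV \<pi> borel)" for k i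
    using in_vimage_algebra[OF q(2)[of k i], of \<pi> UNIV] by (simp add: vimage_def)
  have q\<pi>: "simple_function \<mu> (\<lambda>x. q k (\<pi> x))" for k
    unfolding simple_function_def
  proof (intro conjI ballI)
    show "finite ((\<lambda>x. q k (\<pi> x)) ` space \<mu>)" by (rule finite_subset[OF _ q(1)[of k]]) auto
    show "(\<lambda>x. q k (\<pi> x)) -` {i} \<inter> space \<mu> \<in> events" for i
      using q\<pi>_sets[of k i] subalgebra_fibres[OF \<pi>] by (auto simp: subalgebra_def)
  qed
  define z where "z k x = (q k (\<pi> x), d x)" for k x
  define J where "J k = {p \<in> range (z k). snd p < r}" for k
  have z: "simple_function \<mu> (z k)" for k
    unfolding z_def using simple_function_Pair[OF q\<pi> d(2)] .
  have content: "subprobability_content (space ?S) (sets ?S) (cell_tuples \<mu> (z k) (J k) n)" for k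
    by (rule cell_tuples_content[OF z]) (auto simp: J_def)
  have "\<theta> \<le> cell_tuples \<mu> (z k) (J k) n (E m)" if "m \<in> S" for m k
    using charge[OF that q\<pi> q\<pi>_sets, of k] by (simp add: z_def[abs_def] J_def)
  then obtain T where T: "T \<subseteq> S" "infinite T"
    "\<And>T'. T' \<subseteq> T \<Longrightarrow> finite T' \<Longrightarrow> \<exists>\<^sub>\<infinity>k. 0 < cell_tuples \<mu> (z k) (J k) n (space ?S \<inter> (\<Inter>m\<in>T'. E m))"
    by (rule charged_intersections[OF content E \<theta> S]) iprover+
  have "\<exists>x i. i < r \<and> (\<forall>m\<in>T. m \<le> j \<longrightarrow> x \<in> E m) \<and> (\<forall>a\<in>{1..n}. x a \<in> B i) \<and>
      (\<forall>a\<in>{1..n}. \<forall>b\<in>{1..n}. dist (\<pi> (x a)) (\<pi> (x b)) < 1 / Suc j)" for j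
  proof -
    let ?T = "T \<inter> {..j}" and ?I = "space ?S \<inter> (\<Inter>m\<in>T \<inter> {..j}. E m)"
    have "\<exists>\<^sub>\<infinity>k. 0 < cell_tuples \<mu> (z k) (J k) n ?I" by (rule T(3)) auto
    then obtain k where k: "k \<ge> j" "0 < cell_tuples \<mu> (z k) (J k) n ?I"
      unfolding INFM_nat_le by blast
    have "?I \<in> sets ?S"
    proof (cases "?T = {}")
      case False
      then have "(\<Inter>m\<in>?T. E m) \<in> sets ?S" using E by (intro sets.finite_INT) auto
      then show ?thesis by (rule sets.Int[OF sets.top])
    qed simp
    then obtain p x where x: "p \<in> J k" "x \<in> ?I" "\<And>a. a \<in> {1..n} \<Longrightarrow> x a \<in> space \<mu> \<and> z k (x a) = p"
      by (rule cell_tuples_pos_imp[OF z _ k(2)]) iprover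
    have zp: "z k (x a) = p" if "a \<in> {1..n}" for a using x(3)[OF that] by simp
    have "snd p < r" using x(1) by (simp add: J_def)
    moreover have "\<forall>m\<in>T. m \<le> j \<longrightarrow> x \<in> E m" using x(2) by auto
    moreover have "x a \<in> B (snd p)" if "a \<in> {1..n}" for a
      using zp[OF that] d(3)[of "x a"] \<open>snd p < r\<close> by (auto simp: z_def)
    moreover have "dist (\<pi> (x a)) (\<pi> (x b)) < 1 / Suc j" if "a \<in> {1..n}" "b \<in> {1..n}" for a b
    proof -
      have "q k (\<pi> (x a)) = q k (\<pi> (x b))" using zp[OF that(1)] zp[OF that(2)] by (auto simp: z_def)
      then have "dist (\<pi> (x a)) (\<pi> (x b)) < 1 / Suc k" by (rule q(3))
      also have "\<dots> \<le> 1 / Suc j" using k(1) by (intro divide_left_mono) auto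
      finally show ?thesis .
    qed
    ultimately show ?thesis by (intro exI[of _ x] exI[of _ "snd p"]) simp
  qed
  then obtain X \<iota> where X: "\<And>j. \<iota> j < r" "\<And>j m. m \<in> T \<Longrightarrow> m \<le> j \<Longrightarrow> X j \<in> E m"
    "\<And>j a. a \<in> {1..n} \<Longrightarrow> X j a \<in> B (\<iota> j)"
    "\<And>j a b. a \<in> {1..n} \<Longrightarrow> b \<in> {1..n} \<Longrightarrow> dist (\<pi> (X j a)) (\<pi> (X j b)) < 1 / Suc j"
    by metis
  obtain l s where s: "strict_mono s" and l: "\<And>a. (\<lambda>j. X (s j) a) \<longlonglongrightarrow> l a"
    by (rule countable_product_subsequence[OF compact_UNIV, of X]) (rule UNIV_I, iprover)
  have s_ge: "j \<le> s j" for j using seq_suble[OF s] .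
  have far: "\<eta> \<le> (\<Sum>g\<in>F m. spread n l g) / card (F m)" if m: "m \<in> T" for m
  proof (rule LIMSEQ_le_const)
    show "(\<lambda>j. (\<Sum>g\<in>F m. spread n (X (s j)) g) / card (F m)) \<longlonglongrightarrow> (\<Sum>g\<in>F m. spread n l g) / card (F m)"
      using F(3)[of m] l n card_F_pos[of m] by (intro tendsto_divide tendsto_sum tendsto_spread tendsto_const) auto
    show "\<exists>N. \<forall>j\<ge>N. \<eta> \<le> (\<Sum>g\<in>F m. spread n (X (s j)) g) / card (F m)"
    proof (intro exI allI impI)
      fix j assume "m \<le> j"
      then have "X (s j) \<in> E m" using X(2)[OF m] s_ge[of j] by simp
      then show "\<eta> \<le> (\<Sum>g\<in>F m. spread n (X (s j)) g) / card (F m)" by (rule spread)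
    qed
  qed
  have fibre: "\<pi> (l a) = \<pi> (l b)" if ab: "a \<in> {1..n}" "b \<in> {1..n}" for a b
  proof -
    have \<pi>l: "(\<lambda>j. \<pi> (X (s j) a)) \<longlonglongrightarrow> \<pi> (l a)" for a
      using continuous_on_tendsto_compose[OF \<pi> l] by simp
    have "dist (\<pi> (l a)) (\<pi> (l b)) \<le> 0"
    proof (rule LIMSEQ_le)
      show "(\<lambda>j. dist (\<pi> (X (s j) a)) (\<pi> (X (s j) b))) \<longlonglongrightarrow> dist (\<pi> (l a)) (\<pi> (l b))"
        by (intro tendsto_dist \<pi>l)
      show "(\<lambda>j. 1 / real (Suc j)) \<longlonglongrightarrow> 0" using LIMSEQ_inverse_real_of_nat by (simp add: inverse_eq_divide)
      have "dist (\<pi> (X (s j) a)) (\<pi> (X (s j) b)) \<le> 1 / Suc j" for j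
      proof -
        have "dist (\<pi> (X (s j) a)) (\<pi> (X (s j) b)) < 1 / Suc (s j)" by (rule X(4)[OF ab])
        also have "\<dots> \<le> 1 / Suc j" using s_ge[of j] by (intro divide_left_mono) auto
        finally show ?thesis by simp
      qed
      then show "\<exists>N. \<forall>j\<ge>N. dist (\<pi> (X (s j) a)) (\<pi> (X (s j) b)) \<le> 1 / real (Suc j)" by blast
    qed
    then show ?thesis by simp
  qed
  have "\<exists>i<r. \<forall>a\<in>{1..n}. l a \<in> B i"
  proof (rule ccontr)
    assume "\<not> ?thesis"
    then have "\<forall>i\<in>{..<r}. \<exists>a\<in>{1..n}. l a \<notin> B i" by auto
    then obtain a where a: "\<And>i. i < r \<Longrightarrow> a i \<in> {1..n}" "\<And>i. i < r \<Longrightarrow> l (a i) \<notin> B i" by (metis lessThan_iff)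
    have "\<forall>\<^sub>F j in sequentially. \<forall>i\<in>{..<r}. X (s j) (a i) \<in> - B i"
    proof (intro eventually_ball_finite ballI)
      fix i assume "i \<in> {..<r}"
      then show "\<forall>\<^sub>F j in sequentially. X (s j) (a i) \<in> - B i"
        using B a(2) by (intro topological_tendstoD[OF l]) auto
    qed simp
    from eventually_happens'[OF sequentially_bot this]
    obtain j where j: "\<forall>i\<in>{..<r}. X (s j) (a i) \<in> - B i" ..
    have "X (s j) (a (\<iota> (s j))) \<in> B (\<iota> (s j))" by (rule X(3)[OF a(1)[OF X(1)]])
    then show False using j X(1)[of "s j"] by simp
  qed
  then obtain i where i: "i < r" "\<And>a. a \<in> {1..n} \<Longrightarrow> l a \<in> B i" by blast
  have "T \<subseteq> {m. \<eta> \<le> (\<Sum>g\<in>F m. spread n l g) / card (F m)}" using far by (intro subsetI CollectI)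
  then have "\<exists>\<^sub>\<infinity>m. \<eta> \<le> (\<Sum>g\<in>F m. spread n l g) / card (F m)"
    unfolding frequently_cofinite not_not using T(2) by (rule infinite_super)
  with i fibre show thesis by (rule that)
qed

text \<open>The tuple is found in a translate of a closed subset of \<open>A\<close>; moving it back into \<open>A\<close> costs only
  a right translation of the Folner sets.\<close>

lemma rel_mean_sensitive_of_positive_entropy:
  fixes \<pi> :: "'x \<Rightarrow> 'y::metric_space"
  assumes \<pi>: "continuous_on UNIV \<pi>" and Y: "compact (UNIV :: 'y set)"
    and equivariant: "\<And>g x. g \<in> carrier G \<Longrightarrow> \<pi> (\<phi> g x) = \<psi> g (\<pi> x)"
    and pos: "rel_entropy \<phi> F \<mu> \<pi> > 0" and n: "2 \<le> n"
  shows "rel_mean_sensitive \<phi> F \<mu> \<pi> n"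
proof -
  obtain \<alpha> and c :: real where \<alpha>: "finite \<alpha>" "\<alpha> \<subseteq> sets borel" "partition_on UNIV \<alpha>" and c: "c > 0"
    "\<exists>\<^sub>\<infinity>m. c * card (F m) < rel_entropy_partition \<mu> (common_refinement ((\<lambda>g. (\<lambda>A. \<phi> g -` A) ` \<alpha>) ` F m)) \<pi>"
    by (rule positive_entropy_partition[OF \<pi> pos])
  have n1: "1 \<le> n" using n by simp
  show ?thesis
  proof (rule distinct_tuples_frequent[OF \<pi> \<alpha> c n1])
    fix K \<epsilon> W \<theta> t
    assume K: "K \<subseteq> carrier G" and \<epsilon>: "\<epsilon> > 0" and \<theta>: "\<theta> > 0" and t: "t > 0"
      and sep: "\<And>x y k. x \<in> W \<Longrightarrow> y \<in> W \<Longrightarrow> dist x y < \<epsilon> \<Longrightarrow> k \<in> K \<Longrightarrow> cell \<alpha> (\<phi> k x) = cell \<alpha> (\<phi> k y)"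
      and E: "\<And>m. many_distinct \<alpha> K W n \<theta> m \<in> sets (\<Pi>\<^sub>M i\<in>{1..n}. \<mu>)"
      and frequent: "\<And>(d :: 'x \<Rightarrow> nat) r. range d \<subseteq> {..r} \<Longrightarrow> simple_function \<mu> d \<Longrightarrow> prob (d -` {r}) \<le> t \<Longrightarrow>
      \<exists>S. infinite S \<and> (\<forall>(q :: 'x \<Rightarrow> nat) m. m \<in> S \<longrightarrow> simple_function \<mu> q \<longrightarrow>
        (\<forall>i. q -` {i} \<in> sets (vimage_algebra UNIV \<pi> borel)) \<longrightarrow>
        \<theta> \<le> cell_tuples \<mu> (\<lambda>x. (q x, d x)) {p \<in> range (\<lambda>x. (q x, d x)). snd p < r} n (many_distinct \<alpha> K W n \<theta> m))"
    have \<epsilon>\<theta>: "\<epsilon> * \<theta> > 0" using \<epsilon> \<theta> by simp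
    show ?thesis
      unfolding rel_mean_sensitive_def
    proof (intro exI[of _ "\<epsilon> * \<theta> / 2"] conjI ballI impI)
      show "0 < \<epsilon> * \<theta> / 2" using \<epsilon>\<theta> by simp
      fix A assume A: "A \<in> sets borel" "0 < prob A"
      obtain C where C: "closed C" "C \<subseteq> A" "prob (A - C) < prob A"
        by (rule inner_regular_closed[OF finite_measure_axioms sets_mu A])
      have Cb: "C \<in> sets borel" using C(1) by simp
      have "prob (A - C) = prob A - prob C" using A(1) Cb C(2) by (intro finite_measure_Diff) (auto simp: sets_mu)
      then have "prob C > 0" using C(3) by simp
      obtain a and r :: nat where a: "\<And>i. a i \<in> carrier G" "prob (UNIV - (\<Union>i<r. \<phi> (a i) -` C)) < t"
        by (rule finite_translates_cover[OF Cb \<open>prob C > 0\<close> t]) iprover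
      define B where "B i = \<phi> (a i) -` C" for i
      have B: "closed (B i)" for i unfolding B_def by (intro closed_vimage C(1) cont a(1))
      then have Bb: "B i \<in> sets borel" for i by simp
      obtain d :: "'x \<Rightarrow> nat" where d: "range d \<subseteq> {..r}" "simple_function \<mu> d"
        "d -` {r} = UNIV - (\<Union>i<r. B i)" "\<And>x. d x < r \<Longrightarrow> x \<in> B (d x)"
        by (rule least_hit_label[of B r, OF Bb]) iprover
      have "prob (d -` {r}) \<le> t" using a(2) by (simp add: d(3) B_def)
      from frequent[OF d(1,2) this] obtain S where S: "infinite S" "\<forall>(q :: 'x \<Rightarrow> nat) m. m \<in> S \<longrightarrow> simple_function \<mu> q \<longrightarrow>
        (\<forall>i. q -` {i} \<in> sets (vimage_algebra UNIV \<pi> borel)) \<longrightarrow>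
        \<theta> \<le> cell_tuples \<mu> (\<lambda>x. (q x, d x)) {p \<in> range (\<lambda>x. (q x, d x)). snd p < r} n (many_distinct \<alpha> K W n \<theta> m)"
        by (elim exE conjE)
      obtain l i where l: "i < r" "\<And>b. b \<in> {1..n} \<Longrightarrow> l b \<in> B i"
        "\<And>b b'. b \<in> {1..n} \<Longrightarrow> b' \<in> {1..n} \<Longrightarrow> \<pi> (l b) = \<pi> (l b')"
        "\<exists>\<^sub>\<infinity>m. \<epsilon> * \<theta> \<le> (\<Sum>g\<in>F m. spread n l g) / card (F m)"
      proof (rule fibre_tuple_in_translate[OF \<pi> Y n B d(1,2,4) E S(1) \<theta>])
        show "\<epsilon> * \<theta> \<le> (\<Sum>g\<in>F m. spread n x g) / card (F m)" if "x \<in> many_distinct \<alpha> K W n \<theta> m" for x m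
          by (rule many_distinct_spread[OF n \<epsilon> sep K that])
        fix q :: "'x \<Rightarrow> nat" and m
        assume "m \<in> S" "simple_function \<mu> q" "\<And>i. q -` {i} \<in> sets (vimage_algebra UNIV \<pi> borel)"
        then show "\<theta> \<le> cell_tuples \<mu> (\<lambda>x. (q x, d x)) {p \<in> range (\<lambda>x. (q x, d x)). snd p < r} n (many_distinct \<alpha> K W n \<theta> m)"
          by (intro S(2)[rule_format])
      qed iprover+
      define y where "y b = \<phi> (a i) (l b)" for b
      let ?avg = "\<lambda>x m. (\<Sum>g\<in>F m. spread n x g) / card (F m)"
      have spread_y: "spread n y h = spread n l (h \<otimes> a i)" if "h \<in> carrier G" for h
        using that a(1)[of i] by (simp add: spread_def y_def act_mult)
      obtain b where "\<And>x g. \<bar>spread n x g\<bar> \<le> b" using spread_bounded[OF n] by blast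
      then have "(\<lambda>m. (\<Sum>h\<in>F m. spread n l (h \<otimes> a i)) / card (F m) - ?avg l m) \<longlonglongrightarrow> 0"
        by (intro translated_average[OF a(1), where B = b])
      moreover have "(\<Sum>h\<in>F m. spread n l (h \<otimes> a i)) = (\<Sum>h\<in>F m. spread n y h)" for m
        using F(3)[of m] by (intro sum.cong) (auto simp: spread_y)
      ultimately have "(\<lambda>m. ?avg y m - ?avg l m) \<longlonglongrightarrow> 0" by simp
      then have "\<forall>\<^sub>F m in sequentially. - (\<epsilon> * \<theta> / 4) < ?avg y m - ?avg l m"
        using \<epsilon>\<theta> by (intro order_tendstoD(1)) auto
      then have "\<forall>\<^sub>F m in sequentially. \<epsilon> * \<theta> \<le> ?avg l m \<longrightarrow> \<epsilon> * \<theta> * 3 / 4 \<le> ?avg y m"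
        by eventually_elim linarith
      with l(4) have often: "\<exists>\<^sub>F m in sequentially. \<epsilon> * \<theta> * 3 / 4 \<le> ?avg y m"
        unfolding cofinite_eq_sequentially by (rule frequently_rev_mp)
      show "\<exists>x :: nat \<Rightarrow> 'x. inj_on x {1..n} \<and> x ` {1..n} \<subseteq> A \<and>
           (\<forall>i\<in>{1..n}. \<forall>j\<in>{1..n}. \<pi> (x i) = \<pi> (x j)) \<and>
           limsup (\<lambda>m. ereal ((\<Sum>g\<in>F m. Min {dist (\<phi> g (x i)) (\<phi> g (x j)) | i j.
                              i \<in> {1..n} \<and> j \<in> {1..n} \<and> i \<noteq> j}) / real (card (F m)))) > ereal (\<epsilon> * \<theta> / 2)"
        unfolding spread_def[symmetric]
      proof (intro exI[of _ y] conjI)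
        show "inj_on y {1..n}"
        proof (rule inj_onI, rule ccontr)
          fix b b' assume bb: "b \<in> {1..n}" "b' \<in> {1..n}" "y b = y b'" "b \<noteq> b'"
          have "spread n y g \<le> 0" for g using spread_le[OF bb(1,2,4), of y g] bb(3) by simp
          then have le: "?avg y m \<le> 0" for m by (intro divide_nonpos_nonneg sum_nonpos) auto
          from frequently_ex[OF often] obtain m where "\<epsilon> * \<theta> * 3 / 4 \<le> ?avg y m" ..
          also note le[of m]
          finally have "\<epsilon> * \<theta> * 3 / 4 \<le> 0" .
          then show False using \<epsilon>\<theta> by linarith
        qed
        show "y ` {1..n} \<subseteq> A"
        proof (rule image_subsetI)
          fix b assume "b \<in> {1..n}"
          then have "y b \<in> C" using l(2)[of b] by (simp only: B_def y_def vimage_eq)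
          then show "y b \<in> A" using C(2) by blast
        qed
        show "\<forall>b\<in>{1..n}. \<forall>b'\<in>{1..n}. \<pi> (y b) = \<pi> (y b')"
        proof (intro ballI)
          fix b b' assume "b \<in> {1..n}" "b' \<in> {1..n}"
          then have "\<pi> (l b) = \<pi> (l b')" by (rule l(3))
          then show "\<pi> (y b) = \<pi> (y b')" using a(1)[of i] by (simp add: y_def equivariant)
        qed
        show "ereal (\<epsilon> * \<theta> / 2) < limsup (\<lambda>m. ereal (?avg y m))"
        proof (rule ccontr)
          assume "\<not> ?thesis"
          then have "limsup (\<lambda>m. ereal (?avg y m)) \<le> ereal (\<epsilon> * \<theta> / 2)" by simp
          also have "\<dots> < ereal (\<epsilon> * \<theta> * 3 / 4)" using \<epsilon>\<theta> by simp
          finally have "\<forall>\<^sub>F m in sequentially. ereal (?avg y m) < ereal (\<epsilon> * \<theta> * 3 / 4)" by (rule Limsup_lessD)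
          then have "\<forall>\<^sub>F m in sequentially. \<not> \<epsilon> * \<theta> * 3 / 4 \<le> ?avg y m" by eventually_elim (simp only: less_ereal.simps not_le)
          then show False by (rule notE[OF often[unfolded frequently_def]])
        qed
      qed
    qed
  qed
qed

end

theorem corollary4p5:
  fixes G :: "('g, 'r) monoid_scheme"
    and F :: "nat \<Rightarrow> 'g set"
    and \<phi> :: "'g \<Rightarrow> 'x \<Rightarrow> 'x::metric_space"
    and \<psi> :: "'g \<Rightarrow> 'y \<Rightarrow> 'y::metric_space"
    and \<pi> :: "'x \<Rightarrow> 'y"
    and \<mu> :: "'x measure"
  assumes "countable_amenable_group G" and "infinite (carrier G)"
    and "folner_sequence G F"
    and "tds G \<phi>" and "tds G \<psi>" and "factor_map G \<phi> \<psi> \<pi>"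
    and "\<mu> \<in> ergodic_measures G \<phi>"
    and "rel_entropy \<phi> F \<mu> \<pi> > 0"
  shows "\<forall>n\<ge>2. rel_mean_sensitive \<phi> F \<mu> \<pi> n"
proof (intro allI impI)
  fix n :: nat assume "2 \<le> n"
  interpret ergodic_system G F \<phi> \<mu>
    by (rule ergodic_system.intro[OF assms(1-4,7)])
  show "rel_mean_sensitive \<phi> F \<mu> \<pi> n"
  proof (rule rel_mean_sensitive_of_positive_entropy)
    show "continuous_on UNIV \<pi>" "\<And>g x. g \<in> carrier G \<Longrightarrow> \<pi> (\<phi> g x) = \<psi> g (\<pi> x)"
      using assms(6) by (simp_all add: factor_map_def)
    show "compact (UNIV :: 'y set)" using assms(5) by (simp add: tds_def)
  qed fact+
qed

end
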